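(* Suppose that there is an $n$-ary trace definition of a structure $\mathcal{M}$ in a structure $\mathcal{N}$. If $\mathcal{N}$ has finite dp-rank then $\mathrm{dp}(\mathcal{M})\le n\,\mathrm{dp}(\mathcal{N})$, and if $\mathcal{N}$ has infinite dp-rank then $\mathrm{dp}(\mathcal{M})\le\mathrm{dp}(\mathcal{N})$.
   Context: "Definable" means first order definable with parameters. An $n$-ary trace definition of $\mathcal{M}$ in $\mathcal{N}$ is a map $\tau\colon M\to N^n$ ($n\ge 1$) such that for every $m\ge 1$ and every $\mathcal{M}$-definable $X\subseteq M^m$ there is an $\mathcal{N}$-definable $Y\subseteq N^{mn}$ with $X=\{(a_1,\dots,a_m)\in M^m : (\tau(a_1),\dots,\tau(a_m))\in Y\}$. Dp-rank: for a cardinal $\kappa$, $\mathrm{dp}(\mathcal{M})\ge\kappa$ if in a sufficiently saturated elementary extension of $\mathcal{M}$ there are formulas $\varphi_\alpha(x;y_\alpha)$ with $x$ a single variable and tuples $b_{\alpha,i}$, for $\alpha<\kappa$, $i<\omega$, such that for every $f\colon\kappa\to\omega$ there is an element $a$ with $\varphi_\alpha(a;b_{\alpha,i})\Leftrightarrow f(\alpha)=i$ for all $\alpha<\kappa$, $i<\omega$. The dp-rank is finite if $\mathrm{dp}(\mathcal{M})\ge k$ fails for some $k<\omega$, and in that case $\mathrm{dp}(\mathcal{M})$ is the largest $k$ with $\mathrm{dp}(\mathcal{M})\ge k$; in general $\mathrm{dp}(\mathcal{M})\le\mathrm{dp}(\mathcal{N})$ means that $\mathrm{dp}(\mathcal{M})\ge\kappa$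 implies $\mathrm{dp}(\mathcal{N})\ge\kappa$ for every cardinal $\kappa$. *)

theory Defs
  imports Main
begin

unbundle cardinal_syntax

section \<open>First-order structures\<close>

text \<open>A symbol is a name together with its arity. The sets may be empty, so purely
  relational languages and the language of equality are included.\<close>

record ('f, 'r) language =
  funs :: "('f \<times> nat) set"
  rels :: "('r \<times> nat) set"

datatype 'f fo_term = Var nat | Fn 'f "'f fo_term list"

datatype ('f, 'r) fo_formula =
    Eq "'f fo_term" "'f fo_term"
  | Rel 'r "'f fo_term list"
  | Neg "('f, 'r) fo_formula"
  | Conj "('f, 'r) fo_formula" "('f, 'r) fo_formula"
  | Ex nat "('f, 'r) fo_formula"

fun wf_term :: "('f, 'r) language \<Rightarrow> 'f fo_term \<Rightarrow> bool" where
  "wf_term L (Var i) \<longleftrightarrow> True"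
| "wf_term L (Fn f ts) \<longleftrightarrow> (f, length ts) \<in> funs L \<and> (\<forall>t \<in> set ts. wf_term L t)"

primrec wf_formula :: "('f, 'r) language \<Rightarrow> ('f, 'r) fo_formula \<Rightarrow> bool" where
  "wf_formula L (Eq s t) \<longleftrightarrow> wf_term L s \<and> wf_term L t"
| "wf_formula L (Rel r ts) \<longleftrightarrow> (r, length ts) \<in> rels L \<and> (\<forall>t \<in> set ts. wf_term L t)"
| "wf_formula L (Neg p) \<longleftrightarrow> wf_formula L p"
| "wf_formula L (Conj p q) \<longleftrightarrow> wf_formula L p \<and> wf_formula L q"
| "wf_formula L (Ex i p) \<longleftrightarrow> wf_formula L p"

fun fv_term :: "'f fo_term \<Rightarrow> nat set" where
  "fv_term (Var i) = {i}"
| "fv_term (Fn f ts) = (\<Union>t \<in> set ts. fv_term t)"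

primrec fv :: "('f, 'r) fo_formula \<Rightarrow> nat set" where
  "fv (Eq s t) = fv_term s \<union> fv_term t"
| "fv (Rel r ts) = (\<Union>t \<in> set ts. fv_term t)"
| "fv (Neg p) = fv p"
| "fv (Conj p q) = fv p \<union> fv q"
| "fv (Ex i p) = fv p - {i}"

record ('a, 'f, 'r) fo_structure =
  univ :: "'a set"
  fun_interp :: "'f \<Rightarrow> 'a list \<Rightarrow> 'a"
  rel_interp :: "'r \<Rightarrow> 'a list \<Rightarrow> bool"

text \<open>Interpretations are only constrained, and only ever used in well-formed formulas,
  at argument lists of the length given by the language.\<close>

definition is_structure :: "('f, 'r) language \<Rightarrow> ('a, 'f, 'r) fo_structure \<Rightarrow> bool" where
  "is_structure L M \<longleftrightarrow> univ M \<noteq> {} \<and>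
     (\<forall>f xs. (f, length xs) \<in> funs L \<and> set xs \<subseteq> univ M \<longrightarrow> fun_interp M f xs \<in> univ M)"

fun eval_term :: "('a, 'f, 'r) fo_structure \<Rightarrow> (nat \<Rightarrow> 'a) \<Rightarrow> 'f fo_term \<Rightarrow> 'a" where
  "eval_term M v (Var i) = v i"
| "eval_term M v (Fn f ts) = fun_interp M f (map (eval_term M v) ts)"

primrec sat :: "('a, 'f, 'r) fo_structure \<Rightarrow> (nat \<Rightarrow> 'a) \<Rightarrow> ('f, 'r) fo_formula \<Rightarrow> bool" where
  "sat M v (Eq s t) \<longleftrightarrow> eval_term M v s = eval_term M v t"
| "sat M v (Rel r ts) \<longleftrightarrow> rel_interp M r (map (eval_term M v) ts)"
| "sat M v (Neg p) \<longleftrightarrow> \<not> sat M v p"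
| "sat M v (Conj p q) \<longleftrightarrow> sat M v p \<and> sat M v q"
| "sat M v (Ex i p) \<longleftrightarrow> (\<exists>a \<in> univ M. sat M (v(i := a)) p)"

definition formulas :: "('f, 'r) language \<Rightarrow> nat \<Rightarrow> ('f, 'r) fo_formula set" where
  "formulas L k = {p. wf_formula L p \<and> fv p \<subseteq> {..<k}}"

text \<open>\<open>holds M p xs\<close> is \<open>M \<Turnstile> p(xs)\<close>. It is only used for \<open>p \<in> formulas L (length xs)\<close>, so that
  the assignment is never consulted outside the range of \<open>xs\<close>.\<close>

definition holds :: "('a, 'f, 'r) fo_structure \<Rightarrow> ('f, 'r) fo_formula \<Rightarrow> 'a list \<Rightarrow> bool" where
  "holds M p xs \<longleftrightarrow> sat M (\<lambda>i. xs ! i) p"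

definition tuples :: "('a, 'f, 'r) fo_structure \<Rightarrow> nat \<Rightarrow> 'a list set" where
  "tuples M m = {xs. length xs = m \<and> set xs \<subseteq> univ M}"

section \<open>Trace definitions\<close>

definition definable ::
  "('f, 'r) language \<Rightarrow> ('a, 'f, 'r) fo_structure \<Rightarrow> nat \<Rightarrow> 'a list set \<Rightarrow> bool" where
  "definable L M m X \<longleftrightarrow>
     (\<exists>p bs. set bs \<subseteq> univ M \<and> p \<in> formulas L (m + length bs) \<and>
        X = {xs \<in> tuples M m. holds M p (xs @ bs)})"

text \<open>\<open>concat\<close> identifies \<open>(N\<^sup>n)\<^sup>m\<close> with \<open>N\<^bsup>mn\<^esup>\<close>.\<close>

definition trace_definition ::
  "('f, 'r) language \<Rightarrow> ('a, 'f, 'r) fo_structure \<Rightarrow> ('g, 's) language \<Rightarrow> ('b, 'g, 's) fo_structure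
     \<Rightarrow> nat \<Rightarrow> ('a \<Rightarrow> 'b list) \<Rightarrow> bool" where
  "trace_definition L M K N n \<tau> \<longleftrightarrow>
     1 \<le> n \<and> \<tau> ` univ M \<subseteq> tuples N n \<and>
     (\<forall>m X. 1 \<le> m \<and> definable L M m X \<longrightarrow>
        (\<exists>Y. definable K N (m * n) Y \<and> X = {xs \<in> tuples M m. concat (map \<tau> xs) \<in> Y}))"

section \<open>Saturated elementary extensions\<close>

text \<open>Elementary extensions are taken up to isomorphism, that is, as elementary embeddings.\<close>

definition elementary_embedding ::
  "('f, 'r) language \<Rightarrow> ('a, 'f, 'r) fo_structure \<Rightarrow> ('b, 'f, 'r) fo_structure
     \<Rightarrow> ('a \<Rightarrow> 'b) \<Rightarrow> bool" where
  "elementary_embedding L M M' e \<longleftrightarrow>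
     e ` univ M \<subseteq> univ M' \<and>
     (\<forall>xs p. set xs \<subseteq> univ M \<and> p \<in> formulas L (length xs) \<longrightarrow>
        (holds M p xs \<longleftrightarrow> holds M' p (map e xs)))"

text \<open>\<open>saturated L M S\<close> says that \<open>M\<close> is saturated in the successor cardinal of \<open>S\<close>: types in one
  variable over at most \<open>|S|\<close> parameters are realized. A pair \<open>(p, bs)\<close> stands for
  the formula \<open>p(x; bs)\<close> with parameters \<open>bs\<close>.\<close>

definition saturated ::
  "('f, 'r) language \<Rightarrow> ('a, 'f, 'r) fo_structure \<Rightarrow> 's set \<Rightarrow> bool" where
  "saturated L M S \<longleftrightarrow>
     (\<forall>A \<Gamma>. A \<subseteq> univ M \<and> |A| \<le>o |S| \<and>
        (\<forall>(p, bs) \<in> \<Gamma>. p \<in> formulas L (Suc (length bs)) \<and> set bs \<subseteq> A) \<and>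
        (\<forall>\<Delta> \<subseteq> \<Gamma>. finite \<Delta> \<longrightarrow> (\<exists>a \<in> univ M. \<forall>(p, bs) \<in> \<Delta>. holds M p (a # bs))) \<longrightarrow>
        (\<exists>a \<in> univ M. \<forall>(p, bs) \<in> \<Gamma>. holds M p (a # bs)))"

section \<open>Dp-rank\<close>

text \<open>Cardinals are represented by relations \<open>\<kappa>\<close> with \<open>Card_order \<kappa>\<close>; the ordinals below \<open>\<kappa>\<close> are
  the elements of \<open>Field \<kappa>\<close>.\<close>

definition dp_pattern ::
  "('f, 'r) language \<Rightarrow> ('a, 'f, 'r) fo_structure \<Rightarrow> 'k rel \<Rightarrow> bool" where
  "dp_pattern L M \<kappa> \<longleftrightarrow>
     (\<exists>(l :: 'k \<Rightarrow> nat) (\<phi> :: 'k \<Rightarrow> ('f, 'r) fo_formula) (b :: 'k \<Rightarrow> nat \<Rightarrow> 'a list).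
        (\<forall>\<alpha> \<in> Field \<kappa>. \<phi> \<alpha> \<in> formulas L (Suc (l \<alpha>))) \<and>
        (\<forall>\<alpha> \<in> Field \<kappa>. \<forall>i. b \<alpha> i \<in> tuples M (l \<alpha>)) \<and>
        (\<forall>f :: 'k \<Rightarrow> nat. \<exists>a \<in> univ M.
           \<forall>\<alpha> \<in> Field \<kappa>. \<forall>i. holds M (\<phi> \<alpha>) (a # b \<alpha> i) \<longleftrightarrow> f \<alpha> = i))"

text \<open>The type below has infinite cardinality \<open>\<mu>\<close>, at least the cardinality of \<open>M\<close>, of the language,
  and of \<open>\<kappa>\<close>. Every such \<open>M\<close> has a \<open>\<mu>\<^sup>+\<close>-saturated elementary extension of cardinality at most
  \<open>2\<^sup>\<mu>\<close>, so the power type is large enough to carry one, and \<open>\<mu>\<^sup>+\<close>-saturation is what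
  \<open>sufficiently saturated\<close> means in \<open>dp_rank_ge\<close>.\<close>

type_synonym ('a, 'f, 'r, 'k) small = "'a + 'f + 'r + 'k + nat"

definition dp_rank_ge ::
  "('f, 'r) language \<Rightarrow> ('a, 'f, 'r) fo_structure \<Rightarrow> 'k rel \<Rightarrow> bool" where
  "dp_rank_ge L M \<kappa> \<longleftrightarrow>
     (\<exists>(M' :: (('a, 'f, 'r, 'k) small set, 'f, 'r) fo_structure) e.
        is_structure L M' \<and> elementary_embedding L M M' e \<and>
        saturated L M' (UNIV :: ('a, 'f, 'r, 'k) small set) \<and>
        dp_pattern L M' \<kappa>)"

definition finite_dp_rank :: "('f, 'r) language \<Rightarrow> ('a, 'f, 'r) fo_structure \<Rightarrow> bool" where
  "finite_dp_rank L M \<longleftrightarrow> (\<exists>k :: nat. \<not> dp_rank_ge L M (card_of {..<k}))"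

text \<open>Only meaningful under \<open>finite_dp_rank L M\<close>.\<close>

definition dp_rank :: "('f, 'r) language \<Rightarrow> ('a, 'f, 'r) fo_structure \<Rightarrow> nat" where
  "dp_rank L M = (GREATEST k. dp_rank_ge L M (card_of {..<k}))"

text \<open>The type argument is the type in which the cardinals are represented; a statement about
  every cardinal is polymorphic in it.\<close>

definition dp_rank_le ::
  "'k itself \<Rightarrow> ('f, 'r) language \<Rightarrow> ('a, 'f, 'r) fo_structure
     \<Rightarrow> ('g, 's) language \<Rightarrow> ('b, 'g, 's) fo_structure \<Rightarrow> bool" where
  "dp_rank_le _ L M K N \<longleftrightarrow>
     (\<forall>\<kappa> :: 'k rel. Card_order \<kappa> \<longrightarrow> dp_rank_ge L M \<kappa> \<longrightarrow> dp_rank_ge K N \<kappa>)"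

end

(*
  A pattern in M is carried along the trace definition to a pattern of the same depth in N that is
  cut by n-tuples, so the point is a subadditivity statement: a pattern cut by n-tuples splits into
  n patterns cut by single elements, the j-th one consisting of rows that become non-indiscernible
  when the j-th coordinate is named. By Ramsey one may assume that the pattern is indiscernible,
  apart from the distinguished entry of each row. Starting from all rows, one passes for each
  coordinate in turn to a maximal set of rows that stay mutually indiscernible, distinguished
  entries included, over the coordinates named so far. A row dropped at stage j is broken by the
  j-th coordinate using parameters from surviving rows and from tails only, so that the dropped rows
  remain indiscernible over these parameters and form a pattern in one variable. No row
  survives all n coordinates.
*)

theory Submission
  imports Defs "HOL-Library.Ramsey"
begin

section \<open>Formulas and definable predicates\<close>

text \<open>A trace definition speaks of M and N only, whereas dp-rank is read off in saturated
  extensions, to which the trace definition need not extend. Hence \<open>ict\<close>: the formulas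
  are fixed, and every finite part of the pattern is found in the structure itself. Finite parts
  come down from an extension because their existence is a sentence, and go up by compactness.

  No indiscernible array is ever realized. It is represented by an ultrafilter \<open>F\<close> on
  assignments into \<open>N\<close>, with \<open>eventually P F\<close> in the role of truth, so
  that the splitting argument only manipulates reindexings of variables.

  Rows are indexed by \<open>int\<close>, with the distinguished entry at 0 and room on both sides.
  The sides are treated differently: a row outside the surviving set lends its positive entries
  only. Such parameters can be pushed to the right, out of the way of the translations that move
  distinguished entries, and a row translated far enough to the right becomes an admissible
  parameter itself. Survivors are chosen by maximality, as there may be infinitely many
  rows.\<close>

lemma eval_term_cong:
  "(\<And>i. i \<in> fv_term t \<Longrightarrow> v i = w i) \<Longrightarrow> eval_term M v t = eval_term M w t"
proof (induction t)
  case (Fn f ts)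
  then have "map (eval_term M v) ts = map (eval_term M w) ts" by auto
  then show ?case by (simp only: eval_term.simps)
qed simp

lemma sat_cong: "(\<And>i. i \<in> fv p \<Longrightarrow> v i = w i) \<Longrightarrow> sat M v p = sat M w p"
proof (induction p arbitrary: v w)
  case (Eq s t)
  then show ?case using eval_term_cong[of s v w M] eval_term_cong[of t v w M] by simp
next
  case (Rel r ts)
  then have "map (eval_term M v) ts = map (eval_term M w) ts"
    by (auto intro!: eval_term_cong)
  then show ?case by (simp only: sat.simps)
next
  case (Conj p q)
  show ?case using Conj.IH(1)[of v w] Conj.IH(2)[of v w] Conj.prems by simp
next
  case (Ex i p)
  have "sat M (v(i := a)) p = sat M (w(i := a)) p" for a
    using Ex.prems by (intro Ex.IH) auto
  then show ?case by simp
next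
  case (Neg p)
  show ?case using Neg.IH[of v w] Neg.prems by simp
qed

lemma finite_fv_term: "finite (fv_term t)"
  by (induction t) auto

lemma finite_fv: "finite (fv p)"
  by (induction p) (auto simp: finite_fv_term)

section \<open>Renaming and merging of variables\<close>

primrec rename_term :: "(nat \<Rightarrow> nat) \<Rightarrow> 'f fo_term \<Rightarrow> 'f fo_term" where
  "rename_term s (Var i) = Var (s i)"
| "rename_term s (Fn f ts) = Fn f (map (rename_term s) ts)"

primrec rename :: "(nat \<Rightarrow> nat) \<Rightarrow> ('f, 'r) fo_formula \<Rightarrow> ('f, 'r) fo_formula" where
  "rename s (Eq t u) = Eq (rename_term s t) (rename_term s u)"
| "rename s (Rel r ts) = Rel r (map (rename_term s) ts)"
| "rename s (Neg p) = Neg (rename s p)"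
| "rename s (Conj p q) = Conj (rename s p) (rename s q)"
| "rename s (Ex i p) = Ex (s i) (rename s p)"

lemma eval_rename_term: "eval_term M v (rename_term s t) = eval_term M (v \<circ> s) t"
proof (induction t)
  case (Fn f ts)
  then have "map (eval_term M v) (map (rename_term s) ts) = map (eval_term M (v \<circ> s)) ts"
    by (simp add: comp_def)
  then show ?case by (simp only: rename_term.simps eval_term.simps)
qed simp

lemma fv_rename_term: "fv_term (rename_term s t) = s ` fv_term t"
  by (induction t) auto

lemma wf_rename_term: "wf_term L (rename_term s t) = wf_term L t"
  by (induction t) auto

text \<open>Bound variables are renamed along with the free ones, so injectivity of \<open>s\<close>
  is what rules out capture.\<close>

lemma sat_rename: "inj s \<Longrightarrow> sat M v (rename s p) = sat M (v \<circ> s) p"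
proof (induction p arbitrary: v)
  case (Eq t u)
  then show ?case by (simp add: eval_rename_term del: comp_apply)
next
  case (Rel r ts)
  have "map (eval_term M v) (map (rename_term s) ts) = map (eval_term M (v \<circ> s)) ts"
    by (simp add: eval_rename_term comp_def)
  then show ?case by (simp only: rename.simps sat.simps)
next
  case (Ex i p)
  then have "v(s i := a) \<circ> s = (v \<circ> s)(i := a)" for a
    by (auto simp: fun_eq_iff inj_eq)
  then show ?case using Ex.IH[OF Ex.prems] by (simp del: fun_upd_apply comp_apply)
qed auto

lemma fv_rename: "inj s \<Longrightarrow> fv (rename s p) = s ` fv p"
  by (induction p) (auto simp: fv_rename_term image_Un inj_eq)

lemma wf_rename: "wf_formula L (rename s p) = wf_formula L p"
  by (induction p) (auto simp: wf_rename_term)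

text \<open>Substitution of \<open>j\<close> for the variables in \<open>is\<close>, expressed by
  quantifying them away under an equation, which sidesteps capture. It supplies the non-injective
  changes of variables that \<open>rename\<close> does not cover.\<close>

primrec identify :: "nat \<Rightarrow> nat list \<Rightarrow> ('f, 'r) fo_formula \<Rightarrow> ('f, 'r) fo_formula" where
  "identify j [] p = p"
| "identify j (i # is) p = Ex i (Conj (Eq (Var i) (Var j)) (identify j is p))"

lemma sat_identify:
  "j \<notin> set is \<Longrightarrow> v j \<in> univ M \<Longrightarrow>
     sat M v (identify j is p) = sat M (\<lambda>i. if i \<in> set is then v j else v i) p"
proof (induction "is" arbitrary: v)
  case (Cons k ks)
  have "sat M v (identify j (k # ks) p) = sat M (v(k := v j)) (identify j ks p)"
    using Cons.prems by auto
  also have "\<dots> = sat M (\<lambda>i. if i \<in> set ks then v j else (v(k := v j)) i) p"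
    using Cons.IH[of "v(k := v j)"] Cons.prems by (simp add: fun_upd_def cong: if_cong)
  also have "(\<lambda>i. if i \<in> set ks then v j else (v(k := v j)) i)
      = (\<lambda>i. if i \<in> set (k # ks) then v j else v i)"
    by auto
  finally show ?case .
qed simp

lemma fv_identify: "fv (identify j is p) \<subseteq> insert j (fv p - set is)"
  by (induction "is") auto

lemma wf_identify: "wf_formula L (identify j is p) = wf_formula L p"
  by (induction "is") auto

text \<open>A predicate on assignments is defined by a formula together with a (not necessarily
  injective) map from its variables to those of the assignment. Tracking two structures at once
  lets a sentence be moved along an elementary embedding without being written out.\<close>

definition dfn2 ::
  "('f, 'r) language \<Rightarrow> ('a, 'f, 'r) fo_structure \<Rightarrow> ('b, 'f, 'r) fo_structure \<Rightarrow> 'v set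
     \<Rightarrow> (('v \<Rightarrow> 'a) \<Rightarrow> bool) \<Rightarrow> (('v \<Rightarrow> 'b) \<Rightarrow> bool) \<Rightarrow> bool" where
  "dfn2 L M N V P Q \<longleftrightarrow>
     (\<exists>p s. wf_formula L p \<and> s ` fv p \<subseteq> V \<and>
        (\<forall>v. range v \<subseteq> univ M \<longrightarrow> P v = sat M (v \<circ> s) p) \<and>
        (\<forall>v. range v \<subseteq> univ N \<longrightarrow> Q v = sat N (v \<circ> s) p))"

abbreviation dfn ::
  "('f, 'r) language \<Rightarrow> ('a, 'f, 'r) fo_structure \<Rightarrow> 'v set \<Rightarrow> (('v \<Rightarrow> 'a) \<Rightarrow> bool) \<Rightarrow> bool" where
  "dfn L M V P \<equiv> dfn2 L M M V P P"

lemma dfn2_neg: "dfn2 L M N V P Q \<Longrightarrow> dfn2 L M N V (\<lambda>v. \<not> P v) (\<lambda>v. \<not> Q v)"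
  unfolding dfn2_def
  by (elim exE, rename_tac p s, rule_tac x = "Neg p" in exI, rule_tac x = s in exI) simp

lemma dfn2_conj:
  assumes "dfn2 L M N V P Q" "dfn2 L M N V P' Q'"
  shows "dfn2 L M N V (\<lambda>v. P v \<and> P' v) (\<lambda>v. Q v \<and> Q' v)"
proof -
  obtain p s where p: "wf_formula L p" "s ` fv p \<subseteq> V"
    "\<And>v. range v \<subseteq> univ M \<Longrightarrow> P v = sat M (v \<circ> s) p"
    "\<And>v. range v \<subseteq> univ N \<Longrightarrow> Q v = sat N (v \<circ> s) p"
    using assms(1) unfolding dfn2_def by blast
  obtain p' s' where p': "wf_formula L p'" "s' ` fv p' \<subseteq> V"
    "\<And>v. range v \<subseteq> univ M \<Longrightarrow> P' v = sat M (v \<circ> s') p'"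
    "\<And>v. range v \<subseteq> univ N \<Longrightarrow> Q' v = sat N (v \<circ> s') p'"
    using assms(2) unfolding dfn2_def by blast
  \<comment> \<open>The two formulas may use one variable for different things, so the first is
    moved to the even and the second to the odd variables; \<open>?t\<close> reads both variable
    maps.\<close>
  let ?g = "\<lambda>i::nat. 2 * i" and ?g' = "\<lambda>i::nat. Suc (2 * i)"
  let ?t = "\<lambda>i. if even i then s (i div 2) else s' (i div 2)"
  have inj: "inj ?g" "inj ?g'" by (auto intro: injI)
  have eq: "(v \<circ> ?t) \<circ> ?g = v \<circ> s" "(v \<circ> ?t) \<circ> ?g' = v \<circ> s'" for v :: "_ \<Rightarrow> 'z"
    by (auto simp: fun_eq_iff)
  show ?thesis unfolding dfn2_def
  proof (intro exI[of _ "Conj (rename ?g p) (rename ?g' p')"] exI[of _ ?t] conjI allI impI)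
    show "?t ` fv (Conj (rename ?g p) (rename ?g' p')) \<subseteq> V"
      using p(2) p'(2) inj by (auto simp: fv_rename)
  qed (use p p' in \<open>simp_all add: wf_rename sat_rename[OF inj(1)] sat_rename[OF inj(2)] eq\<close>)
qed

lemma dfn2_iff:
  assumes "dfn2 L M N V P Q" "dfn2 L M N V P' Q'"
  shows "dfn2 L M N V (\<lambda>v. P v \<longleftrightarrow> P' v) (\<lambda>v. Q v \<longleftrightarrow> Q' v)"
proof -
  have "dfn2 L M N V (\<lambda>v. \<not> (P v \<and> \<not> P' v) \<and> \<not> (P' v \<and> \<not> P v))
      (\<lambda>v. \<not> (Q v \<and> \<not> Q' v) \<and> \<not> (Q' v \<and> \<not> Q v))"
    using assms by (intro dfn2_conj dfn2_neg)
  moreover have "(\<lambda>v. \<not> (P v \<and> \<not> P' v) \<and> \<not> (P' v \<and> \<not> P v)) = (\<lambda>v. P v \<longleftrightarrow> P' v)"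
    "(\<lambda>v. \<not> (Q v \<and> \<not> Q' v) \<and> \<not> (Q' v \<and> \<not> Q v)) = (\<lambda>v. Q v \<longleftrightarrow> Q' v)" by auto
  ultimately show ?thesis by simp
qed

lemma dfn2_True:
  assumes "univ M \<noteq> {}" "univ N \<noteq> {}"
  shows "dfn2 L M N V (\<lambda>v. True) (\<lambda>v. True)"
  unfolding dfn2_def using assms
  by (intro exI[of _ "Ex 0 (Eq (Var 0) (Var 0))"] exI) auto

lemma dfn2_const:
  assumes "univ M \<noteq> {}" "univ N \<noteq> {}"
  shows "dfn2 L M N V (\<lambda>v. c) (\<lambda>v. c)"
  using dfn2_True[OF assms] dfn2_neg[OF dfn2_True[OF assms]] by (cases c) auto

lemma dfn2_Ball:
  assumes "univ M \<noteq> {}" "univ N \<noteq> {}" "finite I"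
    and "\<And>i. i \<in> I \<Longrightarrow> dfn2 L M N V (P i) (Q i)"
  shows "dfn2 L M N V (\<lambda>v. \<forall>i\<in>I. P i v) (\<lambda>v. \<forall>i\<in>I. Q i v)"
  using assms(3,4)
proof (induction I rule: finite_induct)
  case empty
  then show ?case using dfn2_True[OF assms(1,2)] by simp
next
  case (insert i I)
  have "dfn2 L M N V (\<lambda>v. P i v \<and> (\<forall>i\<in>I. P i v)) (\<lambda>v. Q i v \<and> (\<forall>i\<in>I. Q i v))"
    using insert by (intro dfn2_conj) auto
  then show ?case by simp
qed

text \<open>The formula stays the same and only its variable map is composed with \<open>r\<close>.
  This makes reindexing of rows a trivial operation on predicates, also when \<open>r\<close> is not
  injective.\<close>

lemma dfn2_comp:
  fixes r :: "'v \<Rightarrow> 'w"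
  assumes "dfn2 L M N V P Q" "r ` V \<subseteq> W"
  shows "dfn2 L M N W (\<lambda>w. P (w \<circ> r)) (\<lambda>w. Q (w \<circ> r))"
proof -
  obtain p s where p: "wf_formula L p" "s ` fv p \<subseteq> V"
    "\<And>v. range v \<subseteq> univ M \<Longrightarrow> P v = sat M (v \<circ> s) p"
    "\<And>v. range v \<subseteq> univ N \<Longrightarrow> Q v = sat N (v \<circ> s) p"
    using assms(1) unfolding dfn2_def by blast
  have *: "range (w \<circ> r) \<subseteq> B" if "range w \<subseteq> B" for w :: "'w \<Rightarrow> 'z" and B
    using that by auto
  show ?thesis unfolding dfn2_def
  proof (intro exI[of _ p] exI[of _ "r \<circ> s"] conjI allI impI)
    show "(r \<circ> s) ` fv p \<subseteq> W" using p(2) assms(2) by auto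
    show "P (w \<circ> r) = sat M (w \<circ> (r \<circ> s)) p" if "range w \<subseteq> univ M" for w
      using p(3)[OF *[OF that]] by (simp only: comp_assoc)
    show "Q (w \<circ> r) = sat N (w \<circ> (r \<circ> s)) p" if "range w \<subseteq> univ N" for w
      using p(4)[OF *[OF that]] by (simp only: comp_assoc)
  qed fact
qed

lemma dfn2_mono: "dfn2 L M N V P Q \<Longrightarrow> V \<subseteq> W \<Longrightarrow> dfn2 L M N W P Q"
  unfolding dfn2_def by (elim ex_forward conj_forward) auto

text \<open>A formula has finitely many free variables. Later this confines a predicate to finitely
  many rows and to a bounded window of indices, on which the Zorn and translation arguments
  rest.\<close>

lemma dfn2_finite_support:
  assumes "dfn2 L M N V P Q"
  obtains W where "finite W" "W \<subseteq> V" "dfn2 L M N W P Q"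
proof -
  obtain p s where p: "wf_formula L p" "s ` fv p \<subseteq> V"
    "\<And>v. range v \<subseteq> univ M \<Longrightarrow> P v = sat M (v \<circ> s) p"
    "\<And>v. range v \<subseteq> univ N \<Longrightarrow> Q v = sat N (v \<circ> s) p"
    using assms unfolding dfn2_def by blast
  show ?thesis
  proof
    show "finite (s ` fv p)" by (simp add: finite_fv)
    show "dfn2 L M N (s ` fv p) P Q" unfolding dfn2_def using p by (intro exI[of _ p] exI[of _ s]) auto
  qed fact
qed

lemma dfn2_cong_on:
  assumes "dfn2 L M N V P Q" "range v \<subseteq> univ M" "range w \<subseteq> univ M"
    and "\<And>x. x \<in> V \<Longrightarrow> v x = w x"
  shows "P v = P w"
proof -
  obtain p s where p: "s ` fv p \<subseteq> V" "\<And>v. range v \<subseteq> univ M \<Longrightarrow> P v = sat M (v \<circ> s) p"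
    using assms(1) unfolding dfn2_def by blast
  have "sat M (v \<circ> s) p = sat M (w \<circ> s) p"
    using p(1) assms(4) by (intro sat_cong) auto
  then show ?thesis using p(2) assms(2,3) by simp
qed

lemma dfn2_holds:
  assumes "p \<in> formulas L (length ys)" "set ys \<subseteq> V"
  shows "dfn2 L M N V (\<lambda>v. holds M p (map v ys)) (\<lambda>v. holds N p (map v ys))"
  unfolding dfn2_def
proof (intro exI[of _ p] exI[of _ "\<lambda>i. ys ! i"] conjI allI impI)
  have fv: "i < length ys" if "i \<in> fv p" for i using assms(1) that by (auto simp: formulas_def)
  show "(!) ys ` fv p \<subseteq> V" using fv assms(2) by (auto dest!: fv)
  show "wf_formula L p" using assms(1) by (simp add: formulas_def)
  show "holds M p (map v ys) = sat M (v \<circ> (!) ys) p" for v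
    unfolding holds_def by (intro sat_cong) (auto dest: fv)
  show "holds N p (map v ys) = sat N (v \<circ> (!) ys) p" for v
    unfolding holds_def by (intro sat_cong) (auto dest: fv)
qed

text \<open>Several variables of the formula may stand for \<open>x\<close>. They are merged into
  the fresh variable \<open>m\<close>, which \<open>g\<close> then sends to slot 0, while variable
  \<open>i < m\<close> goes to slot \<open>Suc i\<close>. The list \<open>ys\<close> may still
  contain \<open>x\<close>, but only at slots that do not occur in \<open>q\<close>.\<close>

lemma dfn2_extract:
  assumes "dfn2 L M N V P Q"
  obtains q ys where "q \<in> formulas L (Suc (length ys))"
    "\<And>i. Suc i \<in> fv q \<Longrightarrow> ys ! i \<in> V - {x}"
    "\<And>v a. range v \<subseteq> univ M \<Longrightarrow> a \<in> univ M \<Longrightarrow> P (v(x := a)) = holds M q (a # map v ys)"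
    "\<And>v a. range v \<subseteq> univ N \<Longrightarrow> a \<in> univ N \<Longrightarrow> Q (v(x := a)) = holds N q (a # map v ys)"
proof -
  obtain p s where p: "wf_formula L p" "s ` fv p \<subseteq> V"
    "\<And>v. range v \<subseteq> univ M \<Longrightarrow> P v = sat M (v \<circ> s) p"
    "\<And>v. range v \<subseteq> univ N \<Longrightarrow> Q v = sat N (v \<circ> s) p"
    using assms unfolding dfn2_def by blast
  obtain m where m: "\<And>i. i \<in> fv p \<Longrightarrow> i < m"
    using finite_fv[of p] finite_nat_set_iff_bounded by metis
  define xs where "xs = filter (\<lambda>i. s i = x) [0..<m]"
  define g where "g = (\<lambda>i. if i = m then 0 else if i < m then Suc i else i)"
  have g: "inj g" by (auto simp: inj_def g_def split: if_splits)
  define q where "q = rename g (identify m xs p)"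
  define ys where "ys = map s [0..<m]"
  have m_xs: "m \<notin> set xs" by (simp add: xs_def)
  have fv: "fv (identify m xs p) \<subseteq> insert m (fv p - set xs)" by (rule fv_identify)
  have key: "sat K (v(x := a) \<circ> s) p = holds K q (a # map v ys)"
    if "a \<in> univ K" for a v and K :: "('z, 'a, 'b) fo_structure"
  proof -
    let ?w = "\<lambda>i. (a # map v ys) ! i"
    have "holds K q (a # map v ys) = sat K (?w \<circ> g) (identify m xs p)"
      unfolding holds_def q_def by (rule sat_rename[OF g])
    also have "\<dots> = sat K (\<lambda>i. if i \<in> set xs then (?w \<circ> g) m else (?w \<circ> g) i) p"
      using that m_xs by (intro sat_identify) (auto simp: g_def)
    also have "\<dots> = sat K (v(x := a) \<circ> s) p"
      by (intro sat_cong) (auto simp: xs_def g_def ys_def dest: m)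
    finally show ?thesis by simp
  qed
  have fvq: "fv q \<subseteq> g ` insert m (fv p - set xs)"
    unfolding q_def fv_rename[OF g] using fv by blast
  show ?thesis
  proof (rule that[of q ys])
    show "q \<in> formulas L (Suc (length ys))"
      unfolding formulas_def using fvq m p(1)
      by (auto simp: q_def wf_rename wf_identify g_def ys_def split: if_splits dest!: subsetD)
    show "ys ! i \<in> V - {x}" if "Suc i \<in> fv q" for i
    proof -
      obtain k where "k \<in> insert m (fv p - set xs)" "Suc i = g k" using fvq \<open>Suc i \<in> fv q\<close> by blast
      then have "k \<in> fv p" "k \<notin> set xs" "k < m" "i = k"
        using m by (auto simp: g_def split: if_splits)
      then show ?thesis using p(2) by (auto simp: ys_def xs_def)
    qed
    show "P (v(x := a)) = holds M q (a # map v ys)" if "range v \<subseteq> univ M" "a \<in> univ M" for v a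
    proof -
      have "range (v(x := a)) \<subseteq> univ M" using that by auto
      then show ?thesis using p(3) key that by metis
    qed
    show "Q (v(x := a)) = holds N q (a # map v ys)" if "range v \<subseteq> univ N" "a \<in> univ N" for v a
    proof -
      have "range (v(x := a)) \<subseteq> univ N" using that by auto
      then show ?thesis using p(4) key that by metis
    qed
  qed
qed

lemma dfn2_Ex:
  assumes "dfn2 L M N V P Q"
  shows "dfn2 L M N (V - {x}) (\<lambda>v. \<exists>a\<in>univ M. P (v(x := a))) (\<lambda>v. \<exists>a\<in>univ N. Q (v(x := a)))"
proof -
  obtain q ys where q: "q \<in> formulas L (Suc (length ys))"
    "\<And>i. Suc i \<in> fv q \<Longrightarrow> ys ! i \<in> V - {x}"
    "\<And>v a. range v \<subseteq> univ M \<Longrightarrow> a \<in> univ M \<Longrightarrow> P (v(x := a)) = holds M q (a # map v ys)"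
    "\<And>v a. range v \<subseteq> univ N \<Longrightarrow> a \<in> univ N \<Longrightarrow> Q (v(x := a)) = holds N q (a # map v ys)"
    using dfn2_extract[OF assms, of x] by metis
  let ?s = "\<lambda>i. ys ! (i - 1)"
  have fv: "i < Suc (length ys)" if "i \<in> fv q" for i
    using q(1) that by (auto simp: formulas_def)
  have key: "holds K q (a # map v ys) = sat K ((v \<circ> ?s)(0 := a)) q"
    for v a and K :: "('z, 'a, 'b) fo_structure"
    unfolding holds_def by (intro sat_cong) (auto simp: nth_Cons split: nat.split dest: fv)
  show ?thesis unfolding dfn2_def
  proof (intro exI[of _ "Ex 0 q"] exI[of _ ?s] conjI allI impI)
    show "wf_formula L (Ex 0 q)" using q(1) by (simp add: formulas_def)
    show "?s ` fv (Ex 0 q) \<subseteq> V - {x}"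
    proof
      fix y assume "y \<in> ?s ` fv (Ex 0 q)"
      then obtain i where "i \<in> fv q" "i \<noteq> 0" "y = ?s i" by auto
      then show "y \<in> V - {x}" using q(2)[of "i - 1"] by simp
    qed
    show "(\<exists>a\<in>univ M. P (v(x := a))) = sat M (v \<circ> ?s) (Ex 0 q)" if "range v \<subseteq> univ M" for v
      unfolding sat.simps by (intro bex_cong refl) (simp only: q(3)[OF that] key)
    show "(\<exists>a\<in>univ N. Q (v(x := a))) = sat N (v \<circ> ?s) (Ex 0 q)" if "range v \<subseteq> univ N" for v
      unfolding sat.simps by (intro bex_cong refl) (simp only: q(4)[OF that] key)
  qed
qed

text \<open>Quantifies a whole finite block of variables at once. The block will consist of all
  entries of a finite pattern, which turns the existence of the pattern into a sentence.\<close>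

lemma dfn2_Ex_set:
  assumes "finite W" "dfn2 L M N V P Q"
  shows "dfn2 L M N (V - W)
     (\<lambda>v. \<exists>w. w ` W \<subseteq> univ M \<and> P (\<lambda>x. if x \<in> W then w x else v x))
     (\<lambda>v. \<exists>w. w ` W \<subseteq> univ N \<and> Q (\<lambda>x. if x \<in> W then w x else v x))"
  using assms
proof (induction W arbitrary: V P Q rule: finite_induct)
  case (insert y W)
  have step: "(\<exists>w. w ` insert y W \<subseteq> A \<and> R (\<lambda>x. if x \<in> insert y W then w x else v x)) \<longleftrightarrow>
     (\<exists>w. w ` W \<subseteq> A \<and> (\<exists>a\<in>A. R ((\<lambda>x. if x \<in> W then w x else v x)(y := a))))"
    (is "?l = ?r") for A :: "'z set" and R v
  proof
    assume ?l
    then obtain w where w: "w ` insert y W \<subseteq> A" "R (\<lambda>x. if x \<in> insert y W then w x else v x)" by blast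
    have "(\<lambda>x. if x \<in> insert y W then w x else v x) = (\<lambda>x. if x \<in> W then w x else v x)(y := w y)"
      using insert.hyps by auto
    then show ?r using w by (intro exI[of _ w] conjI bexI[of _ "w y"]) auto
  next
    assume ?r
    then obtain w a where w: "w ` W \<subseteq> A" "a \<in> A" "R ((\<lambda>x. if x \<in> W then w x else v x)(y := a))" by blast
    have "(\<lambda>x. if x \<in> insert y W then (w(y := a)) x else v x) = (\<lambda>x. if x \<in> W then w x else v x)(y := a)"
      using insert.hyps by auto
    then show ?l using w insert.hyps by (intro exI[of _ "w(y := a)"]) auto
  qed
  have "V - insert y W = (V - {y}) - W" by auto
  then show ?case
    unfolding step using insert.IH[OF dfn2_Ex[OF insert.prems, of y]] by (simp only:)
qed simp

lemma elementary_embedding_dfn2: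
  assumes "elementary_embedding L M N e" "dfn2 L M N V P Q" "range v \<subseteq> univ M"
  shows "P v \<longleftrightarrow> Q (e \<circ> v)"
proof -
  obtain p s where p: "wf_formula L p" 
    "\<And>v. range v \<subseteq> univ M \<Longrightarrow> P v = sat M (v \<circ> s) p"
    "\<And>v. range v \<subseteq> univ N \<Longrightarrow> Q v = sat N (v \<circ> s) p"
    using assms(2) unfolding dfn2_def by blast
  obtain m where m: "\<And>i. i \<in> fv p \<Longrightarrow> i < m"
    using finite_fv[of p] finite_nat_set_iff_bounded by metis
  let ?xs = "map (v \<circ> s) [0..<m]"
  have e: "e ` univ M \<subseteq> univ N" using assms(1) by (simp add: elementary_embedding_def)
  have "holds M p ?xs \<longleftrightarrow> holds N p (map e ?xs)"
  proof -
    have "set ?xs \<subseteq> univ M" using assms(3) by auto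
    moreover have "p \<in> formulas L (length ?xs)" using p(1) m by (auto simp: formulas_def)
    ultimately show ?thesis using assms(1) unfolding elementary_embedding_def by blast
  qed
  moreover have "holds M p ?xs = sat M (v \<circ> s) p"
    unfolding holds_def by (intro sat_cong) (auto dest: m)
  moreover have "holds N p (map e ?xs) = sat N ((e \<circ> v) \<circ> s) p"
    unfolding holds_def by (intro sat_cong) (auto dest: m)
  moreover have "range (e \<circ> v) \<subseteq> univ N" using assms(3) e by auto
  ultimately show ?thesis using p(2)[OF assms(3)] p(3) by metis
qed

section \<open>Ultrafilters\<close>

definition ultra :: "'a filter \<Rightarrow> bool" where
  "ultra F \<longleftrightarrow> F \<noteq> bot \<and> (\<forall>P. eventually P F \<or> eventually (\<lambda>x. \<not> P x) F)"

lemma ex_ultra: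
  assumes "F \<noteq> bot"
  obtains U where "U \<le> F" "ultra U"
proof -
  let ?A = "{G. G \<le> F \<and> G \<noteq> bot}"
  \<comment> \<open>A finer filter is smaller in the order on filters, so Zorn's lemma runs in the
    reversed order and a chain is bounded by its infimum.\<close>
  let ?P = "\<lambda>G H :: 'a filter. H \<le> G"
  have "\<exists>m\<in>?A. \<forall>a\<in>?A. ?P m a \<longrightarrow> a = m"
  proof (rule predicate_Zorn)
    show "partial_order_on ?A (relation_of ?P ?A)"
      by (rule partial_order_on_relation_ofI) auto
    fix C assume "C \<in> Chains (relation_of ?P ?A)"
    then have C: "C \<subseteq> ?A" "\<And>G H. G \<in> C \<Longrightarrow> H \<in> C \<Longrightarrow> G \<le> H \<or> H \<le> G"
      by (auto simp: Chains_def relation_of_def)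
    show "\<exists>u\<in>?A. \<forall>a\<in>C. ?P a u"
    proof (cases "C = {}")
      case True
      then show ?thesis using assms by auto
    next
      case False
      have "eventually P (Inf C) \<longleftrightarrow> (\<exists>b\<in>C. eventually P b)" for P
      proof (rule eventually_Inf_base[OF False])
        fix G H assume GH: "G \<in> C" "H \<in> C"
        then consider "G \<le> H" | "H \<le> G" using C(2) by blast
        then show "\<exists>x\<in>C. x \<le> inf G H"
          using GH by cases (auto intro: bexI[of _ G] bexI[of _ H])
      qed
      then have "Inf C \<noteq> bot" using C(1) by (auto simp: trivial_limit_def)
      moreover have "Inf C \<le> F"
      proof -
        obtain G where "G \<in> C" using False by blast
        then show ?thesis using C(1) by (intro Inf_lower2[of G]) auto
      qed
      ultimately show ?thesis by (auto intro!: bexI[of _ "Inf C"] Inf_lower)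
    qed
  qed
  then obtain m where m: "m \<le> F" "m \<noteq> bot" "\<And>a. a \<le> F \<Longrightarrow> a \<noteq> bot \<Longrightarrow> a \<le> m \<Longrightarrow> a = m" by blast
  have "eventually P m \<or> eventually (\<lambda>x. \<not> P x) m" for P
  proof (cases "inf m (principal {x. P x}) = bot")
    case True
    then have "eventually (\<lambda>x. False) (inf m (principal {x. P x}))" by simp
    then show ?thesis by (simp add: eventually_inf_principal)
  next
    case False
    \<comment> \<open>Adjoining the event \<open>P\<close> gives a proper refinement, so by
      minimality it changes nothing and \<open>P\<close> was eventual already.\<close>
    have "inf m (principal {x. P x}) = m"
      by (rule m(3)) (use False m(1) in \<open>auto intro: le_infI1\<close>)
    moreover have "eventually P (inf m (principal {x. P x}))"
      by (simp add: eventually_inf_principal)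
    ultimately show ?thesis by simp
  qed
  then have "ultra m" using m(2) by (simp add: ultra_def)
  then show ?thesis using that m(1) by blast
qed

lemma ultra_not:
  assumes F: "ultra F"
  shows "eventually (\<lambda>x. \<not> P x) F \<longleftrightarrow> \<not> eventually P F"
proof -
  { assume "eventually (\<lambda>x. \<not> P x) F" "eventually P F"
    then have "eventually (\<lambda>x. False) F" by eventually_elim blast
    with F have False by (simp add: ultra_def) }
  then show ?thesis
    using F by (auto simp: ultra_def)
qed

lemma ultra_iff:
  assumes "ultra F"
  shows "eventually (\<lambda>x. P x \<longleftrightarrow> Q x) F \<longleftrightarrow> (eventually P F \<longleftrightarrow> eventually Q F)"
proof -
  have 1: "eventually P F \<longleftrightarrow> eventually Q F" if "eventually (\<lambda>x. P x \<longleftrightarrow> Q x) F"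
  proof
    assume "eventually P F"
    then show "eventually Q F" using that by eventually_elim blast
  next
    assume "eventually Q F"
    then show "eventually P F" using that by eventually_elim blast
  qed
  have "eventually (\<lambda>x. P x \<longleftrightarrow> Q x) F" if "eventually P F \<longleftrightarrow> eventually Q F"
  proof (cases "eventually P F")
    case True
    with that have "eventually P F" "eventually Q F" by auto
    then show ?thesis by eventually_elim blast
  next
    case False
    with that have "eventually (\<lambda>x. \<not> P x) F" "eventually (\<lambda>x. \<not> Q x) F"
      using ultra_not[OF assms] by blast+
    then show ?thesis by eventually_elim blast
  qed
  with 1 show ?thesis by blast
qed

section \<open>Saturated models\<close>

text \<open>The elements of the model are constants from \<open>S\<close>, identified when they agree almost surely;
  it is the submodel of the ultrapower of \<open>N\<close> generated by the coordinate functions.\<close>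

locale henkin =
  fixes K :: "('g, 's) language" and N :: "('b, 'g, 's) fo_structure"
    and U :: "('c \<Rightarrow> 'b) filter" and S :: "'c set"
  assumes str: "is_structure K N"
    and ultraU: "ultra U"
    and univU: "eventually (\<lambda>w. range w \<subseteq> univ N) U"
    and S_nonempty: "S \<noteq> {}"
    and witness: "\<And>p bs. p \<in> formulas K (Suc (length bs)) \<Longrightarrow> set bs \<subseteq> S \<Longrightarrow>
        eventually (\<lambda>w. \<exists>x\<in>univ N. holds N p (x # map w bs)) U \<Longrightarrow>
        \<exists>c\<in>S. eventually (\<lambda>w. holds N p (w c # map w bs)) U"
begin

text \<open>Chooses one constant from each class of almost sure equality. Representatives keep the
  carrier inside \<open>'c\<close>, the type that will be matched with the one prescribed in
  \<open>dp_rank_ge\<close>.\<close>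

definition rep :: "'c \<Rightarrow> 'c" where
  "rep c = (SOME c'. c' \<in> S \<and> eventually (\<lambda>w. w c' = w c) U)"

lemma rep:
  assumes "c \<in> S"
  shows "rep c \<in> S" "eventually (\<lambda>w. w (rep c) = w c) U"
proof -
  have "c \<in> S \<and> eventually (\<lambda>w. w c = w c) U" using assms by simp
  then have "rep c \<in> S \<and> eventually (\<lambda>w. w (rep c) = w c) U"
    unfolding rep_def by (rule someI)
  then show "rep c \<in> S" "eventually (\<lambda>w. w (rep c) = w c) U" by auto
qed

lemma rep_eq_iff:
  assumes "c \<in> S" "c' \<in> S"
  shows "rep c = rep c' \<longleftrightarrow> eventually (\<lambda>w. w c = w c') U"
proof
  assume eq: "rep c = rep c'"
  show "eventually (\<lambda>w. w c = w c') U"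
    using rep(2)[OF assms(1)] rep(2)[OF assms(2)] unfolding eq by eventually_elim simp
next
  assume eq: "eventually (\<lambda>w. w c = w c') U"
  have "eventually (\<lambda>w. w x = w c) U \<longleftrightarrow> eventually (\<lambda>w. w x = w c') U" for x
  proof
    assume "eventually (\<lambda>w. w x = w c) U"
    then show "eventually (\<lambda>w. w x = w c') U" using eq by eventually_elim simp
  next
    assume "eventually (\<lambda>w. w x = w c') U"
    then show "eventually (\<lambda>w. w x = w c) U" using eq by eventually_elim simp
  qed
  then show "rep c = rep c'" by (simp add: rep_def)
qed

lemma rep_rep:
  assumes "c \<in> rep ` S"
  shows "c \<in> S" "rep c = c"
proof -
  obtain c' where c': "c' \<in> S" "c = rep c'" using assms by blast
  then show "c \<in> S" using rep(1) by simp
  then show "rep c = c" using rep_eq_iff[of c c'] c' rep(2)[of c'] by simp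
qed

definition mdl :: "('c, 'g, 's) fo_structure" where
  "mdl = \<lparr>univ = rep ` S,
     fun_interp = \<lambda>f cs. rep (SOME c. c \<in> S \<and> eventually (\<lambda>w. w c = fun_interp N f (map w cs)) U),
     rel_interp = \<lambda>r cs. eventually (\<lambda>w. rel_interp N r (map w cs)) U\<rparr>"

lemma univ_mdl [simp]: "univ mdl = rep ` S"
  by (simp add: mdl_def)

lemma rel_interp_mdl: "rel_interp mdl r cs \<longleftrightarrow> eventually (\<lambda>w. rel_interp N r (map w cs)) U"
  by (simp add: mdl_def)

text \<open>The formula \<open>x = f(cs)\<close> is among those to which \<open>witness\<close>
  applies, so a constant for each function value is already in \<open>S\<close>.\<close>

lemma fun_interp_mdl:
  assumes "(f, length cs) \<in> funs K" "set cs \<subseteq> S"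
  shows "fun_interp mdl f cs \<in> rep ` S"
    "eventually (\<lambda>w. w (fun_interp mdl f cs) = fun_interp N f (map w cs)) U"
proof -
  let ?p = "Eq (Var 0) (Fn f (map Var [1..<Suc (length cs)])) :: ('g, 's) fo_formula"
  have p: "?p \<in> formulas K (Suc (length cs))"
    using assms(1) by (auto simp: formulas_def simp del: upt_Suc)
  have map: "map (\<lambda>i. (x # map w cs) ! i) [1..<Suc (length cs)] = map w cs" for x :: 'b and w
  proof -
    have "[1..<Suc (length cs)] = map Suc [0..<length cs]" by (simp add: map_Suc_upt)
    then show ?thesis by (auto intro!: nth_equalityI simp del: upt_Suc)
  qed
  have holds: "holds N ?p (x # map w cs) \<longleftrightarrow> x = fun_interp N f (map w cs)" for x w
    using map[of x w] by (simp add: holds_def comp_def del: upt_Suc)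
  have "eventually (\<lambda>w. \<exists>x\<in>univ N. holds N ?p (x # map w cs)) U"
    using univU
  proof eventually_elim
    case (elim w)
    then have "set (map w cs) \<subseteq> univ N" by auto
    moreover have "(f, length (map w cs)) \<in> funs K" using assms(1) by simp
    ultimately have "fun_interp N f (map w cs) \<in> univ N" using str unfolding is_structure_def by blast
    then show ?case using holds by blast
  qed
  then obtain c where "c \<in> S" "eventually (\<lambda>w. holds N ?p (w c # map w cs)) U"
    using witness[OF p assms(2)] by blast
  then have "c \<in> S \<and> eventually (\<lambda>w. w c = fun_interp N f (map w cs)) U" unfolding holds by simp
  then have *: "(SOME c. c \<in> S \<and> eventually (\<lambda>w. w c = fun_interp N f (map w cs)) U) \<in> S \<and>
      eventually (\<lambda>w. w (SOME c. c \<in> S \<and> eventually (\<lambda>w. w c = fun_interp N f (map w cs)) U)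
        = fun_interp N f (map w cs)) U"
    by (rule someI)
  then show "fun_interp mdl f cs \<in> rep ` S" by (simp add: mdl_def)
  show "eventually (\<lambda>w. w (fun_interp mdl f cs) = fun_interp N f (map w cs)) U"
    using rep(2)[OF conjunct1[OF *]] conjunct2[OF *] unfolding mdl_def fo_structure.simps
    by eventually_elim simp
qed

lemma is_structure_mdl: "is_structure K mdl"
proof -
  have "fun_interp mdl f cs \<in> rep ` S" if "(f, length cs) \<in> funs K" "set cs \<subseteq> rep ` S" for f cs
  proof -
    have "set cs \<subseteq> S" using that(2) rep_rep(1) by blast
    then show ?thesis by (rule fun_interp_mdl(1)[OF that(1)])
  qed
  then show ?thesis using S_nonempty by (simp add: is_structure_def)
qed

lemma eval_term_mdl:
  assumes "range u \<subseteq> rep ` S" "wf_term K t"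
  shows "eval_term mdl u t \<in> rep ` S \<and>
     eventually (\<lambda>w. w (eval_term mdl u t) = eval_term N (w \<circ> u) t) U"
  using assms(2)
proof (induction t)
  case (Var i)
  then show ?case using assms(1) by auto
next
  case (Fn f ts)
  let ?cs = "map (eval_term mdl u) ts"
  have cs: "set ?cs \<subseteq> S" "(f, length ?cs) \<in> funs K"
    using Fn rep_rep(1) by auto
  have "eventually (\<lambda>w. \<forall>t\<in>set ts. w (eval_term mdl u t) = eval_term N (w \<circ> u) t) U"
    using Fn by (intro eventually_ball_finite ballI) (auto simp del: comp_apply)
  then have "eventually (\<lambda>w. map w ?cs = map (eval_term N (w \<circ> u)) ts) U"
    by eventually_elim simp
  with fun_interp_mdl(2)[OF cs(2,1)]
  have "eventually (\<lambda>w. w (eval_term mdl u (Fn f ts)) = eval_term N (w \<circ> u) (Fn f ts)) U"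
    unfolding eval_term.simps by eventually_elim (simp only:)
  then show ?case using fun_interp_mdl(1)[OF cs(2,1)] by (simp del: comp_apply)
qed

text \<open>Los's theorem for the submodel. In the existential case the usual pointwise choice of
  witnesses would leave \<open>S\<close>; \<open>witness\<close> provides a constant in its place,
  as in the Tarski-Vaught test.\<close>

lemma los:
  assumes "range u \<subseteq> rep ` S" "wf_formula K p"
  shows "sat mdl u p \<longleftrightarrow> eventually (\<lambda>w. sat N (w \<circ> u) p) U"
  using assms
proof (induction p arbitrary: u)
  case (Eq s t)
  have wf: "wf_term K s" "wf_term K t" using Eq.prems(2) by auto
  note s = eval_term_mdl[OF Eq.prems(1) wf(1)] and t = eval_term_mdl[OF Eq.prems(1) wf(2)]
  have "sat mdl u (Eq s t) \<longleftrightarrow> rep (eval_term mdl u s) = rep (eval_term mdl u t)"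
    unfolding sat.simps rep_rep(2)[OF conjunct1[OF s]] rep_rep(2)[OF conjunct1[OF t]] ..
  also have "\<dots> \<longleftrightarrow> eventually (\<lambda>w. w (eval_term mdl u s) = w (eval_term mdl u t)) U"
    by (rule rep_eq_iff[OF rep_rep(1)[OF conjunct1[OF s]] rep_rep(1)[OF conjunct1[OF t]]])
  also have "\<dots> \<longleftrightarrow> eventually (\<lambda>w. eval_term N (w \<circ> u) s = eval_term N (w \<circ> u) t) U"
  proof -
    have "eventually (\<lambda>w. (w (eval_term mdl u s) = w (eval_term mdl u t)) \<longleftrightarrow>
        (eval_term N (w \<circ> u) s = eval_term N (w \<circ> u) t)) U"
      using conjunct2[OF s] conjunct2[OF t] by eventually_elim (simp only:)
    then show ?thesis using ultra_iff[OF ultraU] by blast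
  qed
  finally show ?case unfolding sat.simps .
next
  case (Rel r ts)
  have "eventually (\<lambda>w. \<forall>t\<in>set ts. w (eval_term mdl u t) = eval_term N (w \<circ> u) t) U"
    using Rel eval_term_mdl[OF Rel.prems(1)]
    by (intro eventually_ball_finite ballI) (auto simp del: comp_apply)
  then have "eventually (\<lambda>w. rel_interp N r (map w (map (eval_term mdl u) ts)) \<longleftrightarrow>
      rel_interp N r (map (eval_term N (w \<circ> u)) ts)) U"
  proof eventually_elim
    case (elim w)
    then have "map w (map (eval_term mdl u) ts) = map (eval_term N (w \<circ> u)) ts" by simp
    then show ?case by (simp only:)
  qed
  then show ?case unfolding sat.simps rel_interp_mdl using ultra_iff[OF ultraU] by blast
next
  case (Neg p)
  then show ?case using ultra_not[OF ultraU] by simp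
next
  case (Conj p q)
  then show ?case by (simp add: eventually_conj_iff)
next
  case (Ex i p)
  have upd: "w \<circ> u(i := c) = (w \<circ> u)(i := w c)" for w :: "'c \<Rightarrow> 'b" and c by auto
  show ?case
  proof
    assume "sat mdl u (Ex i p)"
    then obtain c where c: "c \<in> rep ` S" "sat mdl (u(i := c)) p" by (auto simp del: fun_upd_apply)
    have "range (u(i := c)) \<subseteq> rep ` S" using c(1) Ex.prems(1) by (auto split: if_splits)
    moreover have "wf_formula K p" using Ex.prems(2) by simp
    ultimately have "sat mdl (u(i := c)) p \<longleftrightarrow> eventually (\<lambda>w. sat N (w \<circ> u(i := c)) p) U"
      by (rule Ex.IH)
    with c(2) have "eventually (\<lambda>w. sat N ((w \<circ> u)(i := w c)) p) U" unfolding upd by blast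
    then show "eventually (\<lambda>w. sat N (w \<circ> u) (Ex i p)) U"
      using univU by eventually_elim auto
  next
    assume ev: "eventually (\<lambda>w. sat N (w \<circ> u) (Ex i p)) U"
    obtain m where m: "\<And>j. j \<in> fv p \<Longrightarrow> j < m"
      using finite_fv[of p] finite_nat_set_iff_bounded by metis
    \<comment> \<open>The quantified variable goes to slot 0 and any other \<open>j\<close> to slot
      \<open>Suc j\<close>, the layout that \<open>witness\<close> expects. Slot
      \<open>Suc i\<close> receives a parameter but does not occur in the formula.\<close>
    define s where "s = (\<lambda>j. if j = i then 0 else Suc j)"
    have s: "inj s" by (auto simp: inj_def s_def split: if_splits)
    let ?p = "rename s p" and ?bs = "map u [0..<m]"
    have p: "?p \<in> formulas K (Suc (length ?bs))"
    proof -
      have "s j < Suc m" if "j \<in> fv p" for j using m[OF that] by (simp add: s_def)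
      then have "fv ?p \<subseteq> {..<Suc m}" unfolding fv_rename[OF s] by blast
      then show ?thesis using Ex.prems(2) by (simp add: formulas_def wf_rename)
    qed
    have holds: "holds N ?p (x # map w ?bs) = sat N ((w \<circ> u)(i := x)) p" for x w
    proof -
      have "sat N ((!) (x # map w ?bs) \<circ> s) p = sat N ((w \<circ> u)(i := x)) p"
        by (intro sat_cong) (auto simp: s_def dest: m)
      then show ?thesis by (simp add: holds_def sat_rename[OF s])
    qed
    have "set ?bs \<subseteq> S" using Ex.prems(1) rep_rep(1) by auto
    moreover have "eventually (\<lambda>w. \<exists>x\<in>univ N. holds N ?p (x # map w ?bs)) U"
      using ev unfolding holds by simp
    ultimately obtain c where c: "c \<in> S" "eventually (\<lambda>w. holds N ?p (w c # map w ?bs)) U"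
      using witness[OF p] by blast
    have "eventually (\<lambda>w. sat N (w \<circ> u(i := rep c)) p) U"
      using c(2) rep(2)[OF c(1)] unfolding holds upd by eventually_elim simp
    moreover have "range (u(i := rep c)) \<subseteq> rep ` S" using Ex.prems(1) c(1) by auto
    moreover have "wf_formula K p" using Ex.prems(2) by simp
    ultimately have "sat mdl (u(i := rep c)) p" using Ex.IH[of "u(i := rep c)"] by blast
    then show "sat mdl u (Ex i p)" unfolding sat.simps univ_mdl using c(1) by blast
  qed
qed

lemma los_holds:
  assumes "set xs \<subseteq> S" "p \<in> formulas K (length xs)"
  shows "holds mdl p (map rep xs) \<longleftrightarrow> eventually (\<lambda>w. holds N p (map w xs)) U"
proof -
  obtain c0 where c0: "c0 \<in> S" using S_nonempty by blast
  define u where "u = (\<lambda>i. rep (if i < length xs then xs ! i else c0))"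
  have "rep (xs ! i) \<in> rep ` S" if "i < length xs" for i
    using that assms(1) nth_mem[OF that] by blast
  then have u: "range u \<subseteq> rep ` S" using c0 by (auto simp: u_def)
  have fv: "i < length xs" if "i \<in> fv p" for i using assms(2) that by (auto simp: formulas_def)
  have "holds mdl p (map rep xs) \<longleftrightarrow> sat mdl u p"
    unfolding holds_def by (intro sat_cong) (auto simp: u_def dest: fv)
  also have "\<dots> \<longleftrightarrow> eventually (\<lambda>w. sat N (w \<circ> u) p) U"
    using los[OF u] assms(2) by (simp add: formulas_def)
  also have "\<dots> \<longleftrightarrow> eventually (\<lambda>w. holds N p (map w xs)) U"
  proof -
    have "eventually (\<lambda>w. \<forall>x\<in>set xs. w (rep x) = w x) U"
      using rep(2) assms(1) by (intro eventually_ball_finite) auto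
    then have "eventually (\<lambda>w. sat N (w \<circ> u) p \<longleftrightarrow> holds N p (map w xs)) U"
    proof eventually_elim
      case (elim w)
      show ?case unfolding holds_def
        using elim by (intro sat_cong) (auto simp: u_def dest: fv)
    qed
    then show ?thesis using ultra_iff[OF ultraU] by blast
  qed
  finally show ?thesis .
qed

end

text \<open>Every type over constants that is consistent with the conditions imposed so far gets a
  constant of its own. A maximal consistent set \<open>S\<close> of constants, closed under taking the
  parameters of their defining types, therefore realizes all its types: the constant
  named by a type over \<open>S\<close> does not occur in any other condition imposed by \<open>S\<close>, so its value is free.\<close>

theorem ex_saturated_model:
  fixes K :: "('g, 's) language" and N :: "('b, 'g, 's) fo_structure"
    and base :: "'v \<Rightarrow> 'c" and wit :: "('t \<Rightarrow> ('g, 's) fo_formula \<times> 'c list) \<Rightarrow> 'c"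
    and code :: "('g, 's) fo_formula \<times> 't list \<Rightarrow> 't" and F0 :: "('v \<Rightarrow> 'b) filter"
  assumes str: "is_structure K N"
    and inj: "inj base" "inj wit" "range base \<inter> range wit = {}" "inj code"
    and F0: "F0 \<noteq> bot" "eventually (\<lambda>v. range v \<subseteq> univ N) F0"
  obtains N' :: "('c, 'g, 's) fo_structure" and d :: "'v \<Rightarrow> 'c"
  where "is_structure K N'" "range d \<subseteq> univ N'" "saturated K N' (UNIV :: 't set)"
    "\<forall>p xs. p \<in> formulas K (length xs) \<longrightarrow> eventually (\<lambda>v. holds N p (map v xs)) F0 \<longrightarrow>
       holds N' p (map d xs)"
    "\<forall>g :: 't \<Rightarrow> ('g, 's) fo_formula \<times> 'v list.
       (\<forall>i. fst (g i) \<in> formulas K (Suc (length (snd (g i))))) \<longrightarrow>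
       (\<forall>J. finite J \<longrightarrow>
          eventually (\<lambda>v. \<exists>x\<in>univ N. \<forall>i\<in>J. holds N (fst (g i)) (x # map v (snd (g i)))) F0) \<longrightarrow>
       (\<exists>a\<in>univ N'. \<forall>i. holds N' (fst (g i)) (a # map d (snd (g i))))"
proof -
  \<comment> \<open>\<open>G0\<close> governs assignments of all constants: the \<open>base\<close>
    constants follow \<open>F0\<close>, and the remaining ones range freely over
    \<open>N\<close>.\<close>
  define G0 where "G0 = inf (filtercomap (\<lambda>w. w \<circ> base) F0) (principal {w. range w \<subseteq> univ N})"
  have G0: "eventually A G0 \<longleftrightarrow>
      (\<exists>B. eventually B F0 \<and> (\<forall>w. B (w \<circ> base) \<longrightarrow> range w \<subseteq> univ N \<longrightarrow> A w))" for A
    by (auto simp: G0_def eventually_inf_principal eventually_filtercomap)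
  have G0_F0: "eventually (\<lambda>w. P (w \<circ> base)) G0" if "eventually P F0" for P
    using that unfolding G0 by blast
  define cnd where "cnd = (\<lambda>(g, i) w. holds N (fst (g i)) (w (wit g) # map w (snd (g i))))"
  define ok where "ok = (\<lambda>S. \<forall>X A. finite X \<and> fst ` X \<subseteq> wit -` S \<and> eventually A G0 \<longrightarrow>
      (\<exists>w. A w \<and> (\<forall>x\<in>X. cnd x w)))"
  define closed where "closed = (\<lambda>S. range base \<subseteq> S \<and> (\<forall>g i. wit g \<in> S \<longrightarrow> set (snd (g i)) \<subseteq> S))"
  obtain u0 where u0: "u0 \<in> univ N" using str by (auto simp: is_structure_def)
  have ok0: "ok (range base)"
    unfolding ok_def
  proof (intro allI impI, elim conjE)
    fix X :: "(('t \<Rightarrow> ('g, 's) fo_formula \<times> 'c list) \<times> 't) set" and A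
    assume X: "fst ` X \<subseteq> wit -` range base" and A: "eventually A G0"
    have "x \<notin> X" for x
    proof
      assume "x \<in> X"
      then have "wit (fst x) \<in> range base" using X by blast
      then show False using inj(3) by blast
    qed
    then have "X = {}" by blast
    obtain B where B: "eventually B F0" "\<And>w. B (w \<circ> base) \<Longrightarrow> range w \<subseteq> univ N \<Longrightarrow> A w"
      using A unfolding G0 by blast
    have "eventually (\<lambda>v. B v \<and> range v \<subseteq> univ N) F0" using B(1) F0(2) by eventually_elim simp
    then obtain v where v: "B v" "range v \<subseteq> univ N" using F0(1) eventually_happens by blast
    \<comment> \<open>Off \<open>base\<close> any value in \<open>N\<close> will do, since the names
      in \<open>range base\<close> impose no conditions.\<close>
    define w where "w = (\<lambda>c. if c \<in> range base then v (the_inv base c) else u0)"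
    have "w \<circ> base = v" using inj(1) by (auto simp: w_def the_inv_f_f)
    moreover have "range w \<subseteq> univ N" using v(2) u0 by (auto simp: w_def)
    ultimately show "\<exists>w. A w \<and> (\<forall>x\<in>X. cnd x w)" using B(2)[of w] v(1) \<open>X = {}\<close> by auto
  qed
  have "\<exists>S\<in>{S. closed S \<and> ok S}. \<forall>T\<in>{S. closed S \<and> ok S}. S \<subseteq> T \<longrightarrow> T = S"
  proof (rule subset_Zorn_nonempty)
    show "{S. closed S \<and> ok S} \<noteq> {}"
      using ok0 inj(3) by (auto simp: closed_def intro!: exI[of _ "range base"])
    fix \<C> assume "\<C> \<noteq> {}" "subset.chain {S. closed S \<and> ok S} \<C>"
    then have \<C>: "\<And>S. S \<in> \<C> \<Longrightarrow> closed S" "\<And>S. S \<in> \<C> \<Longrightarrow> ok S"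
      "\<And>S T. S \<in> \<C> \<Longrightarrow> T \<in> \<C> \<Longrightarrow> S \<subseteq> T \<or> T \<subseteq> S"
      by (auto simp: subset_chain_def)
    obtain S0 where S0: "S0 \<in> \<C>" using \<open>\<C> \<noteq> {}\<close> by blast
    have "closed (\<Union>\<C>)"
      unfolding closed_def
    proof (intro conjI allI impI)
      show "range base \<subseteq> \<Union>\<C>" using \<C>(1)[OF S0] S0 by (auto simp: closed_def)
      fix g i assume "wit g \<in> \<Union>\<C>"
      then obtain S where "S \<in> \<C>" "wit g \<in> S" by blast
      then have "set (snd (g i)) \<subseteq> S" using \<C>(1) unfolding closed_def by blast
      then show "set (snd (g i)) \<subseteq> \<Union>\<C>" using \<open>S \<in> \<C>\<close> by blast
    qed
    moreover have "ok (\<Union>\<C>)"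
      unfolding ok_def
    proof (intro allI impI, elim conjE)
      fix X :: "(('t \<Rightarrow> ('g, 's) fo_formula \<times> 'c list) \<times> 't) set" and A
      assume X: "finite X" "fst ` X \<subseteq> wit -` \<Union>\<C>" and A: "eventually A G0"
      have "\<exists>S\<in>\<C>. wit ` fst ` X \<subseteq> S"
      proof (rule finite_subset_Union_chain[of "wit ` fst ` X" \<C> "{S. closed S \<and> ok S}"])
        show "wit ` fst ` X \<subseteq> \<Union>\<C>" using X(2) by auto
      qed (use X(1) \<open>\<C> \<noteq> {}\<close> \<open>subset.chain _ \<C>\<close> in auto)
      then obtain S where "S \<in> \<C>" "fst ` X \<subseteq> wit -` S"
        unfolding image_subset_iff_subset_vimage by blast
      then show "\<exists>w. A w \<and> (\<forall>x\<in>X. cnd x w)" using \<C>(2) X(1) A unfolding ok_def by blast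
    qed
    ultimately show "\<Union>\<C> \<in> {S. closed S \<and> ok S}" by simp
  qed
  then obtain S where S: "closed S" "ok S" "\<And>T. closed T \<Longrightarrow> ok T \<Longrightarrow> S \<subseteq> T \<Longrightarrow> T = S" by blast
  have base_S: "base x \<in> S" for x using S(1) by (auto simp: closed_def)
  define I :: "(('t \<Rightarrow> ('g, 's) fo_formula \<times> 'c list) \<times> 't) set"
    where "I = {x. wit (fst x) \<in> S}"
  define F1 where "F1 = inf G0 (INF x\<in>I. principal {w. cnd x w})"
  have "F1 \<noteq> bot"
  proof
    assume "F1 = bot"
    then have "eventually (\<lambda>w. False) F1" by simp
    then obtain A B where A: "eventually A G0" and B: "eventually B (INF x\<in>I. principal {w. cnd x w})"
      and AB: "\<And>w. A w \<Longrightarrow> B w \<Longrightarrow> False"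
      unfolding F1_def eventually_inf by blast
    obtain X where X: "X \<subseteq> I" "finite X" "eventually B (INF x\<in>X. principal {w. cnd x w})"
      using B unfolding eventually_INF[of _ _ I] by blast
    have "(INF x\<in>X. principal {w. cnd x w}) = principal (\<Inter>x\<in>X. {w. cnd x w})"
      using X(2) by (rule INF_principal_finite)
    then have "B w" if "\<forall>x\<in>X. cnd x w" for w
      using X(3) that by (simp add: eventually_principal)
    moreover have "\<exists>w. A w \<and> (\<forall>x\<in>X. cnd x w)"
    proof -
      have "fst ` X \<subseteq> wit -` S" using X(1) by (auto simp: I_def)
      then show ?thesis using S(2) X(2) A unfolding ok_def by blast
    qed
    ultimately show False using AB by blast
  qed
  then obtain U where U: "U \<le> F1" "ultra U" by (rule ex_ultra)
  have U_G0: "eventually P U" if "eventually P G0" for P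
    using that U(1) unfolding F1_def by (meson filter_leD inf.cobounded1 order.trans)
  have U_cnd: "eventually (cnd x) U" if "wit (fst x) \<in> S" for x
  proof -
    have "eventually (cnd x) (INF x\<in>I. principal {w. cnd x w})"
      by (rule eventually_INF1[of x]) (use that in \<open>auto simp: I_def eventually_principal\<close>)
    then show ?thesis using U(1) unfolding F1_def by (meson filter_leD inf.cobounded2 order.trans)
  qed
  have univU: "eventually (\<lambda>w. range w \<subseteq> univ N) U"
    by (rule U_G0) (auto simp: G0_def eventually_inf_principal)
  have realize: "\<exists>c\<in>S. \<forall>i. eventually (\<lambda>w. holds N (fst (g i)) (w c # map w (snd (g i)))) U"
    if g: "\<And>i. set (snd (g i)) \<subseteq> S"
      and fin: "\<And>J. finite J \<Longrightarrow>
        eventually (\<lambda>w. \<exists>x\<in>univ N. \<forall>i\<in>J. holds N (fst (g i)) (x # map w (snd (g i)))) U"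
    for g :: "'t \<Rightarrow> ('g, 's) fo_formula \<times> 'c list"
  proof -
    have "wit g \<in> S"
    proof (rule ccontr)
      assume wit: "wit g \<notin> S"
      have "ok (insert (wit g) S)"
        unfolding ok_def
      proof (intro allI impI, elim conjE)
        fix X :: "(('t \<Rightarrow> ('g, 's) fo_formula \<times> 'c list) \<times> 't) set" and A
      assume X: "finite X" "fst ` X \<subseteq> wit -` insert (wit g) S" and A: "eventually A G0"
        define X1 where "X1 = {x \<in> X. wit (fst x) \<in> S}"
        define J where "J = snd ` X"
        obtain B where B: "eventually B F0" "\<And>w. B (w \<circ> base) \<Longrightarrow> range w \<subseteq> univ N \<Longrightarrow> A w"
          using A unfolding G0 by blast
        have "eventually (\<lambda>w. \<forall>x\<in>X1. cnd x w) U"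
          using X(1) U_cnd by (intro eventually_ball_finite) (auto simp: X1_def)
        moreover have "eventually (\<lambda>w. \<exists>x\<in>univ N. \<forall>i\<in>J. holds N (fst (g i)) (x # map w (snd (g i)))) U"
          by (rule fin) (simp add: J_def X(1))
        ultimately have "eventually (\<lambda>w. (\<forall>x\<in>X1. cnd x w) \<and> range w \<subseteq> univ N \<and> B (w \<circ> base) \<and>
            (\<exists>x\<in>univ N. \<forall>i\<in>J. holds N (fst (g i)) (x # map w (snd (g i))))) U"
          using univU U_G0[OF G0_F0[OF B(1)]] by eventually_elim (intro conjI; assumption)
        moreover have "U \<noteq> bot" using U(2) by (simp add: ultra_def)
        ultimately obtain w x where w: "\<forall>x\<in>X1. cnd x w" "range w \<subseteq> univ N" "B (w \<circ> base)" "x \<in> univ N"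
          "\<forall>i\<in>J. holds N (fst (g i)) (x # map w (snd (g i)))"
          using eventually_happens' by blast
        let ?w = "w(wit g := x)"
        have w_S: "?w c = w c" if "c \<in> S" for c using that wit by auto
        have map_S: "map ?w bs = map w bs" if "set bs \<subseteq> S" for bs
          by (intro map_cong refl w_S) (use that in blast)
        have "?w \<circ> base = w \<circ> base" using w_S[OF base_S] by (simp add: fun_eq_iff del: fun_upd_apply)
        moreover have "range ?w \<subseteq> univ N" using w(2,4) by auto
        ultimately have "A ?w" using B(2)[of ?w] w(3) by simp
        moreover have "cnd y ?w" if "y \<in> X" for y
        proof (cases "wit (fst y) \<in> S")
          case True
          then have "y \<in> X1" using that by (simp add: X1_def)
          then have "cnd y w" using w(1) by blast
          moreover have "set (snd (fst y (snd y))) \<subseteq> S"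
            using S(1) True unfolding closed_def by blast
          ultimately show ?thesis
            by (simp add: cnd_def case_prod_unfold map_S w_S[OF True] del: fun_upd_apply)
        next
          case False
          then have "wit (fst y) = wit g" using X(2) that by auto
          then have "fst y = g" using inj(2) by (simp add: inj_eq)
          moreover have "snd y \<in> J" using that by (simp add: J_def)
          moreover have "?w (wit g) = x" by simp
          ultimately show ?thesis
            using w(5) by (simp add: cnd_def case_prod_unfold map_S[OF g] del: fun_upd_apply)
        qed
        ultimately show "\<exists>w. A w \<and> (\<forall>x\<in>X. cnd x w)" by blast
      qed
      moreover have "closed (insert (wit g) S)"
        unfolding closed_def
      proof (intro conjI allI impI)
        show "range base \<subseteq> insert (wit g) S" using base_S by auto
        fix h i assume "wit h \<in> insert (wit g) S"
        then have "wit h \<in> S \<or> h = g" using inj(2) by (auto simp: inj_eq)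
        then have "set (snd (h i)) \<subseteq> S" using S(1) g unfolding closed_def by blast
        then show "set (snd (h i)) \<subseteq> insert (wit g) S" by blast
      qed
      ultimately have "insert (wit g) S = S" using S(3) by blast
      with wit show False by blast
    qed
    then show ?thesis using U_cnd[of "(g, _)"] by (auto simp: cnd_def case_prod_unfold)
  qed
  interpret henkin K N U S
  proof
    show "S \<noteq> {}" using base_S by blast
    fix p and bs :: "'c list"
    assume bs: "set bs \<subseteq> S" and ev: "eventually (\<lambda>w. \<exists>x\<in>univ N. holds N p (x # map w bs)) U"
    \<comment> \<open>A single formula is a constant family, so \<open>witness\<close> is a special
      case of \<open>realize\<close>.\<close>
    have "\<exists>c\<in>S. \<forall>i :: 't. eventually (\<lambda>w. holds N (fst (p, bs)) (w c # map w (snd (p, bs)))) U"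
    proof (rule realize[of "\<lambda>i. (p, bs)"])
      show "eventually (\<lambda>w. \<exists>x\<in>univ N. \<forall>i\<in>J. holds N (fst (p, bs)) (x # map w (snd (p, bs)))) U"
        for J :: "'t set"
        using ev by eventually_elim auto
    qed (use bs in simp)
    then show "\<exists>c\<in>S. eventually (\<lambda>w. holds N p (w c # map w bs)) U" by simp
  qed (use str U(2) univU in auto)
  have univ_rep: "map rep bs = bs" if "set bs \<subseteq> univ mdl" for bs
    by (intro map_idI rep_rep(2)) (use that in auto)
  have saturated: "saturated K mdl (UNIV :: 't set)"
    unfolding saturated_def
  proof (intro allI impI, elim conjE)
    fix A :: "'c set" and \<Gamma> :: "(('g, 's) fo_formula \<times> 'c list) set"
    assume A: "A \<subseteq> univ mdl" "|A| \<le>o |UNIV :: 't set|"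
      and \<Gamma>: "\<forall>(p, bs)\<in>\<Gamma>. p \<in> formulas K (Suc (length bs)) \<and> set bs \<subseteq> A"
      and fin: "\<forall>\<Delta>\<subseteq>\<Gamma>. finite \<Delta> \<longrightarrow> (\<exists>a\<in>univ mdl. \<forall>(p, bs)\<in>\<Delta>. holds mdl p (a # bs))"
    have \<Gamma>_in: "fst x \<in> formulas K (Suc (length (snd x)))" "set (snd x) \<subseteq> A" if "x \<in> \<Gamma>" for x
      using bspec[OF \<Gamma> that] by (simp_all add: case_prod_unfold)
    have AS: "A \<subseteq> S" using A(1) rep_rep(1) unfolding univ_mdl by blast
    show "\<exists>a\<in>univ mdl. \<forall>(p, bs)\<in>\<Gamma>. holds mdl p (a # bs)"
    proof (cases "\<Gamma> = {}")
      case True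
      then show ?thesis using S_nonempty by auto
    next
      case False
      obtain e :: "'c \<Rightarrow> 't" where e: "inj_on e A" using A(2) card_of_ordLeq[of A "UNIV :: 't set"] by blast
      \<comment> \<open>A type over at most \<open>|'t|\<close> parameters consists of at most
        \<open>|'t|\<close> pairs, because \<open>code\<close> injects them into \<open>'t\<close>.
        It is therefore the range of a family indexed by \<open>'t\<close>, which is what
        \<open>wit\<close> names. The empty type is the range of no such family, hence the case
        distinction.\<close>
      define h where "h = (\<lambda>(p, bs). code (p, map e bs))"
      have "inj_on h \<Gamma>"
      proof (rule inj_onI)
        fix x y assume xy: "x \<in> \<Gamma>" "y \<in> \<Gamma>" "h x = h y"
        then have "fst x = fst y" "map e (snd x) = map e (snd y)"
          using injD[OF inj(4), of "(fst x, map e (snd x))" "(fst y, map e (snd y))"]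
          by (simp_all add: h_def case_prod_unfold)
        moreover have "inj_on e (set (snd x) \<union> set (snd y))"
          using \<Gamma>_in(2) xy(1,2) by (intro inj_on_subset[OF e]) blast
        ultimately show "x = y" by (simp add: prod_eq_iff inj_on_map_eq_map)
      qed
      then have "\<exists>g :: 't \<Rightarrow> ('g, 's) fo_formula \<times> 'c list. g ` UNIV = \<Gamma>"
        using inj_on_iff_surj[OF False, of "UNIV :: 't set"] by blast
      then obtain g :: "'t \<Rightarrow> ('g, 's) fo_formula \<times> 'c list" where g: "range g = \<Gamma>" by blast
      have g_in: "g i \<in> \<Gamma>" for i using g by blast
      have gA: "set (snd (g i)) \<subseteq> A" "fst (g i) \<in> formulas K (Suc (length (snd (g i))))" for i
        using \<Gamma>_in g_in[of i] by blast+
      have los_g: "holds mdl (fst (g i)) (rep c # snd (g i)) \<longleftrightarrow>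
          eventually (\<lambda>w. holds N (fst (g i)) (w c # map w (snd (g i)))) U" if "c \<in> S" for c i
      proof -
        have "map rep (snd (g i)) = snd (g i)" using gA(1) A(1) by (intro univ_rep) blast
        moreover have "set (c # snd (g i)) \<subseteq> S" using gA(1)[of i] AS that by auto
        ultimately show ?thesis using los_holds[of "c # snd (g i)" "fst (g i)"] gA(2) by simp
      qed
      have "\<exists>c\<in>S. \<forall>i. eventually (\<lambda>w. holds N (fst (g i)) (w c # map w (snd (g i)))) U"
      proof (rule realize)
        show "set (snd (g i)) \<subseteq> S" for i using gA(1) AS by blast
        fix J :: "'t set" assume "finite J"
        moreover have "g ` J \<subseteq> \<Gamma>" using g_in by blast
        ultimately obtain a where a: "a \<in> univ mdl" "\<forall>(p, bs)\<in>g ` J. holds mdl p (a # bs)"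
          using fin by (meson finite_imageI)
        have aS: "a \<in> S" "rep a = a" using a(1) rep_rep[of a] by simp_all
        have "eventually (\<lambda>w. \<forall>i\<in>J. holds N (fst (g i)) (w a # map w (snd (g i)))) U"
        proof (intro eventually_ball_finite ballI)
          fix i assume "i \<in> J"
          then have "holds mdl (fst (g i)) (rep a # snd (g i))"
            using a(2) aS(2) by (auto simp: case_prod_unfold)
          then show "eventually (\<lambda>w. holds N (fst (g i)) (w a # map w (snd (g i)))) U"
            using los_g[OF aS(1)] by blast
        qed fact
        then show "eventually (\<lambda>w. \<exists>x\<in>univ N. \<forall>i\<in>J. holds N (fst (g i)) (x # map w (snd (g i)))) U"
          using univU by eventually_elim blast
      qed
      then obtain c where c: "c \<in> S"
        "\<And>i. eventually (\<lambda>w. holds N (fst (g i)) (w c # map w (snd (g i)))) U" by blast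
      have "holds mdl (fst x) (rep c # snd x)" if "x \<in> \<Gamma>" for x
      proof -
        obtain i where "x = g i" using g \<open>x \<in> \<Gamma>\<close> by blast
        then show ?thesis using los_g[OF c(1)] c(2) by blast
      qed
      moreover have "rep c \<in> univ mdl" using c(1) by simp
      ultimately show ?thesis unfolding case_prod_unfold by blast
    qed
  qed
  have range: "range (rep \<circ> base) \<subseteq> univ mdl" using base_S by auto
  have holds: "holds mdl p (map (rep \<circ> base) xs)"
    if p: "p \<in> formulas K (length xs)" and ev: "eventually (\<lambda>v. holds N p (map v xs)) F0" for p xs
  proof -
    have "eventually (\<lambda>w. holds N p (map w (map base xs))) U"
      using U_G0[OF G0_F0[OF ev]] by simp
    then show ?thesis using los_holds[of "map base xs" p] p base_S by auto
  qed
  have realized: "\<exists>a\<in>univ mdl. \<forall>i. holds mdl (fst (g i)) (a # map (rep \<circ> base) (snd (g i)))"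
    if g: "\<And>i. fst (g i) \<in> formulas K (Suc (length (snd (g i))))"
      and fin: "\<And>J. finite J \<Longrightarrow>
        eventually (\<lambda>v. \<exists>x\<in>univ N. \<forall>i\<in>J. holds N (fst (g i)) (x # map v (snd (g i)))) F0"
    for g :: "'t \<Rightarrow> ('g, 's) fo_formula \<times> 'v list"
  proof -
    have "\<exists>c\<in>S. \<forall>i. eventually (\<lambda>w. holds N (fst (fst (g i), map base (snd (g i))))
        (w c # map w (snd (fst (g i), map base (snd (g i)))))) U"
    proof (rule realize[of "\<lambda>i. (fst (g i), map base (snd (g i)))"])
      show "eventually (\<lambda>w. \<exists>x\<in>univ N. \<forall>i\<in>J. holds N (fst (fst (g i), map base (snd (g i))))
          (x # map w (snd (fst (g i), map base (snd (g i)))))) U" if "finite J" for J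
        using U_G0[OF G0_F0[OF fin[OF that]]] by simp
    qed (use base_S in auto)
    then obtain c where c: "c \<in> S"
      "\<And>i. eventually (\<lambda>w. holds N (fst (g i)) (w c # map w (map base (snd (g i))))) U" by auto
    have "holds mdl (fst (g i)) (rep c # map (rep \<circ> base) (snd (g i)))" for i
      using los_holds[of "c # map base (snd (g i))" "fst (g i)"] c base_S g by auto
    then show ?thesis using c(1) by auto
  qed
  show ?thesis
  proof (rule that[OF is_structure_mdl range saturated]; intro allI impI)
    show "holds mdl p (map (rep \<circ> base) xs)"
      if "p \<in> formulas K (length xs)" "eventually (\<lambda>v. holds N p (map v xs)) F0" for p xs
      using that by (rule holds)
    show "\<exists>a\<in>univ mdl. \<forall>i. holds mdl (fst (g i)) (a # map (rep \<circ> base) (snd (g i)))"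
      if "\<forall>i. fst (g i) \<in> formulas K (Suc (length (snd (g i))))"
        and "\<forall>J. finite J \<longrightarrow>
          eventually (\<lambda>v. \<exists>x\<in>univ N. \<forall>i\<in>J. holds N (fst (g i)) (x # map v (snd (g i)))) F0"
      for g :: "'t \<Rightarrow> ('g, 's) fo_formula \<times> 'v list"
      by (rule realized) (use that in auto)
  qed
qed

section \<open>Patterns\<close>

text \<open>A pattern with set of rows \<open>X\<close>, cut by \<open>n\<close>-tuples, in finitary
  form. The formulas are chosen once for all rows, while the entries may depend on the finite part
  \<open>E\<close>, \<open>R\<close> that is asked for; thus the pattern can be witnessed in
  \<open>N\<close> itself, without saturation.\<close>

definition ict ::
  "('g, 's) language \<Rightarrow> ('b, 'g, 's) fo_structure \<Rightarrow> nat \<Rightarrow> 'k set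
     \<Rightarrow> ('k \<Rightarrow> ('g, 's) fo_formula) \<Rightarrow> ('k \<Rightarrow> nat) \<Rightarrow> bool" where
  "ict K N n X q l \<longleftrightarrow>
     (\<forall>t\<in>X. q t \<in> formulas K (n + l t)) \<and>
     (\<forall>E R. finite E \<and> E \<subseteq> X \<longrightarrow>
        (\<exists>b :: 'k \<Rightarrow> nat \<Rightarrow> 'b list. (\<forall>t\<in>E. \<forall>i. b t i \<in> tuples N (l t)) \<and>
           (\<forall>f \<in> E \<rightarrow>\<^sub>E {..<R}. \<exists>a\<in>tuples N n. \<forall>t\<in>E. \<forall>i<R. holds N (q t) (a @ b t i) \<longleftrightarrow> f t = i)))"

section \<open>Splitting an indiscernible pattern along the coordinates\<close>

text \<open>\<open>Elt j\<close> is the \<open>j\<close>-th coordinate of the tuple cutting the rows; \<open>Row t i c\<close> is component \<open>c\<close> of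
  the \<open>i\<close>-th entry of row \<open>t\<close>. The entry distinguished by the tuple has index \<open>0\<close>.\<close>

datatype 'k var = Elt nat | Row 'k int nat

primrec sub :: "('k \<Rightarrow> int \<Rightarrow> int) \<Rightarrow> 'k var \<Rightarrow> 'k var" where
  "sub h (Elt j) = Elt j"
| "sub h (Row t i c) = Row t (h t i) c"

definition shift :: "'k \<Rightarrow> int \<Rightarrow> 'k \<Rightarrow> int \<Rightarrow> int" where
  "shift t m s i = (if s = t then i + m else i)"

lemma finite_row_bound:
  assumes "finite W"
  obtains w where "0 \<le> w" "\<forall>t i c. Row t i c \<in> W \<longrightarrow> \<bar>i\<bar> \<le> w"
proof -
  let ?f = "\<lambda>x. case x of Elt j \<Rightarrow> 0 | Row t i c \<Rightarrow> \<bar>i\<bar>"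
  let ?S = "insert 0 (?f ` W)"
  have fin: "finite ?S" using assms by simp
  show ?thesis
  proof (rule that[of "Max ?S"])
    show "0 \<le> Max ?S" using fin by simp
    have "\<bar>i\<bar> \<le> Max ?S" if "Row t i c \<in> W" for t i c
    proof -
      have "\<bar>i\<bar> \<in> ?S" using that by force
      then show ?thesis using fin Max_ge by blast
    qed
    then show "\<forall>t i c. Row t i c \<in> W \<longrightarrow> \<bar>i\<bar> \<le> Max ?S" by blast
  qed
qed

text \<open>The variables that a predicate may use at stage \<open>j\<close> when \<open>D\<close>
  is the set of surviving rows. Rows outside \<open>D\<close> keep their entries at 0 and below to
  themselves, so these can be moved without disturbing anything used as a parameter
  elsewhere.\<close>

definition Vs :: "nat \<Rightarrow> 'k set \<Rightarrow> 'k var set" where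
  "Vs j D = {x. case x of Elt i \<Rightarrow> i < j | Row s i c \<Rightarrow> s \<in> D \<or> 0 < i}"

lemma Vs_simps [simp]:
  "Elt k \<in> Vs j D \<longleftrightarrow> k < j" "Row s i c \<in> Vs j D \<longleftrightarrow> s \<in> D \<or> 0 < i"
  by (simp_all add: Vs_def)

lemma strict_mono_pos:
  fixes h :: "int \<Rightarrow> int"
  assumes "strict_mono h" "h 0 = 0" "0 < i"
  shows "0 < h i"
  using strict_monoD[OF assms(1,3)] assms(2) by simp

lemma strict_mono_id_int: "strict_mono (\<lambda>i :: int. i)"
  by (simp add: strict_mono_def)

locale indisc =
  fixes K :: "('g, 's) language" and N :: "('b, 'g, 's) fo_structure"
    and F :: "('k var \<Rightarrow> 'b) filter"
  assumes str: "is_structure K N"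
    and ultraF: "ultra F"
    and univF: "eventually (\<lambda>v. range v \<subseteq> univ N) F"
    and signed_indisc: "\<And>P h. dfn K N UNIV P \<Longrightarrow> (\<And>t. strict_mono (h t)) \<Longrightarrow> (\<And>t. h t 0 = 0) \<Longrightarrow>
      eventually P F \<longleftrightarrow> eventually (\<lambda>v. P (v \<circ> sub h)) F"
begin

text \<open>The rows in \<open>D\<close> are mutually indiscernible over the first \<open>j\<close> coordinates and the positive
  parts of all other rows.\<close>

definition inv :: "nat \<Rightarrow> 'k set \<Rightarrow> bool" where
  "inv j D \<longleftrightarrow> (\<forall>P h. dfn K N (Vs j D) P \<longrightarrow> (\<forall>t. strict_mono (h t)) \<longrightarrow> (\<forall>t. t \<notin> D \<longrightarrow> h t 0 = 0) \<longrightarrow>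
     (eventually P F \<longleftrightarrow> eventually (\<lambda>v. P (v \<circ> sub h)) F))"

lemma univ_ne: "univ N \<noteq> {}"
  using str by (simp add: is_structure_def)

lemma ev_cong:
  assumes "dfn K N W P" "\<And>x. x \<in> W \<Longrightarrow> r x = r' x"
  shows "eventually (\<lambda>v. P (v \<circ> r)) F \<longleftrightarrow> eventually (\<lambda>v. P (v \<circ> r')) F"
proof -
  have "eventually (\<lambda>v. P (v \<circ> r) \<longleftrightarrow> P (v \<circ> r')) F"
    using univF
  proof eventually_elim
    case (elim v)
    then have "range (v \<circ> r) \<subseteq> univ N" "range (v \<circ> r') \<subseteq> univ N" by auto
    then show ?case using assms(2) by (intro dfn2_cong_on[OF assms(1)]) auto
  qed
  then show ?thesis using ultra_iff[OF ultraF] by blast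
qed

text \<open>With no surviving row all reindexings fix 0, so this is \<open>signed_indisc\<close>; it
  makes the family in \<open>inv_maximal\<close> nonempty.\<close>

lemma inv_empty: "inv j {}"
  unfolding inv_def
proof (intro allI impI)
  fix P :: "('k var \<Rightarrow> 'b) \<Rightarrow> bool" and h :: "'k \<Rightarrow> int \<Rightarrow> int"
  assume "dfn K N (Vs j {}) P" "\<forall>t. strict_mono (h t)" "\<forall>t. t \<notin> {} \<longrightarrow> h t 0 = 0"
  then show "eventually P F \<longleftrightarrow> eventually (\<lambda>v. P (v \<circ> sub h)) F"
    using dfn2_mono[of K N N "Vs j {}" P P UNIV] by (intro signed_indisc) auto
qed

text \<open>By Zorn's lemma: a predicate over the union of a chain involves finitely many rows, so
  those of its rows that lie in the union already lie in one member \<open>S\<close>.\<close>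

lemma inv_maximal:
  obtains D' where "D' \<subseteq> D" "inv j D'" "\<forall>t\<in>D - D'. \<not> inv j (insert t D')"
proof -
  let ?A = "{D'. D' \<subseteq> D \<and> inv j D'}"
  have "\<exists>D'\<in>?A. \<forall>T\<in>?A. D' \<subseteq> T \<longrightarrow> T = D'"
  proof (rule subset_Zorn_nonempty)
    show "?A \<noteq> {}" using inv_empty by auto
    fix \<C> assume ne: "\<C> \<noteq> {}" and chain: "subset.chain ?A \<C>"
    have \<C>: "S \<subseteq> D" "inv j S" if "S \<in> \<C>" for S
      using chain that unfolding subset_chain_def by auto
    have "inv j (\<Union>\<C>)"
      unfolding inv_def
    proof (intro allI impI)
      fix P :: "('k var \<Rightarrow> 'b) \<Rightarrow> bool" and h :: "'k \<Rightarrow> int \<Rightarrow> int"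
      assume P: "dfn K N (Vs j (\<Union>\<C>)) P" and h: "\<forall>t. strict_mono (h t)" "\<forall>t. t \<notin> \<Union>\<C> \<longrightarrow> h t 0 = 0"
      obtain W where W: "finite W" "W \<subseteq> Vs j (\<Union>\<C>)" "dfn K N W P"
        by (rule dfn2_finite_support[OF P])
      let ?T = "(\<lambda>x. case x of Row t i c \<Rightarrow> t | Elt j \<Rightarrow> undefined) ` W \<inter> \<Union>\<C>"
      have "\<exists>S\<in>\<C>. ?T \<subseteq> S"
      proof (rule finite_subset_Union_chain[OF _ _ ne chain])
        show "finite ?T" using W(1) by simp
      qed blast+
      then obtain S where S: "S \<in> \<C>" "?T \<subseteq> S" by blast
      have rows: "t \<in> S" if "Row t i c \<in> W" "t \<in> \<Union>\<C>" for t i c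
      proof -
        have "t \<in> ?T" using that(2) by (intro IntI image_eqI[OF _ that(1)]) simp_all
        then show ?thesis using S(2) by blast
      qed
      have "W \<subseteq> Vs j S"
      proof
        fix x assume x: "x \<in> W"
        then have "x \<in> Vs j (\<Union>\<C>)" using W(2) by blast
        then show "x \<in> Vs j S"
        proof (cases x)
          case (Row s i c)
          then have "s \<in> \<Union>\<C> \<or> 0 < i" using \<open>x \<in> Vs j (\<Union>\<C>)\<close> by simp
          then show ?thesis using rows[of s i c] x Row by auto
        qed simp
      qed
      then have "dfn K N (Vs j S) P" by (rule dfn2_mono[OF W(3)])
      \<comment> \<open>Rows of the union outside \<open>S\<close> may have 0 moved by
        \<open>h\<close>, which \<open>inv j S\<close> forbids. They do not occur in
        \<open>W\<close>, so they are reset to the identity.\<close>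
      moreover define h' where "h' = (\<lambda>t. if t \<in> \<Union>\<C> - S then (\<lambda>i. i) else h t)"
      have "\<forall>t. strict_mono (h' t)" using h(1) strict_mono_id_int by (simp add: h'_def)
      moreover have "\<forall>t. t \<notin> S \<longrightarrow> h' t 0 = 0" using h(2) by (auto simp: h'_def)
      ultimately have "eventually P F \<longleftrightarrow> eventually (\<lambda>v. P (v \<circ> sub h')) F"
        using \<C>(2)[OF S(1)] unfolding inv_def by blast
      also have "\<dots> \<longleftrightarrow> eventually (\<lambda>v. P (v \<circ> sub h)) F"
      proof (rule ev_cong[OF W(3)])
        show "sub h' x = sub h x" if "x \<in> W" for x
        proof (cases x)
          case (Row s i c)
          then have "s \<notin> \<Union>\<C> - S" using rows[of s i c] that by blast
          then have "h' s = h s" unfolding h'_def by (rule if_not_P)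
          then show ?thesis using Row by simp
        qed simp
      qed
      finally show "eventually P F \<longleftrightarrow> eventually (\<lambda>v. P (v \<circ> sub h)) F" .
    qed
    then show "\<Union>\<C> \<in> ?A" using \<C>(1) by (simp add: Sup_le_iff)
  qed
  then obtain D' where "D' \<in> ?A" "\<forall>T\<in>?A. D' \<subseteq> T \<longrightarrow> T = D'" by (rule bexE)
  then have D': "D' \<subseteq> D" "inv j D'" "\<And>T. T \<subseteq> D \<Longrightarrow> inv j T \<Longrightarrow> D' \<subseteq> T \<Longrightarrow> T = D'"
    by simp_all
  show ?thesis
  proof (rule that[OF D'(1,2)], rule ballI)
    fix t assume t: "t \<in> D - D'"
    show "\<not> inv j (insert t D')"
    proof
      assume "inv j (insert t D')"
      then have "insert t D' = D'" using t D'(1) by (intro D'(3)) auto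
      with t show False by blast
    qed
  qed
qed

text \<open>Suppose that \<open>P\<close> and its reindexing by \<open>h\<close> differ. Once row
  \<open>t\<close> is translated far to the right, its indices in the support are positive and it
  serves as a parameter over \<open>D\<close>, where \<open>inv j D\<close> makes the two agree.
  Hence one of them differs from its own translate, which reduces arbitrary reindexings to
  translations of row \<open>t\<close>.\<close>

lemma broken_by_shift:
  assumes t: "t \<notin> D" and D: "inv j D" and tD: "\<not> inv j (insert t D)"
  obtains W Q w where "dfn K N W Q" "W \<subseteq> Vs j (insert t D)" "0 \<le> w"
    "\<forall>i c. Row t i c \<in> W \<longrightarrow> \<bar>i\<bar> \<le> w"
    "eventually Q F \<noteq> eventually (\<lambda>v. Q (v \<circ> sub (shift t (w + 1)))) F"
proof -
  obtain P h where P: "dfn K N (Vs j (insert t D)) P" and h: "\<And>s. strict_mono (h s)"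
    "\<And>s. s \<notin> insert t D \<Longrightarrow> h s 0 = 0"
    and neq: "eventually P F \<noteq> eventually (\<lambda>v. P (v \<circ> sub h)) F"
    using tD unfolding inv_def not_all not_imp by (elim exE conjE) (rule that, auto)
  obtain W where W: "finite W" "W \<subseteq> Vs j (insert t D)" "dfn K N W P"
    by (rule dfn2_finite_support[OF P])
  obtain w where w: "0 \<le> w" "\<forall>s i c. Row s i c \<in> W \<longrightarrow> \<bar>i\<bar> \<le> w"
    by (rule finite_row_bound[OF W(1)])
  let ?W' = "sub h ` W"
  obtain w1 where w1: "0 \<le> w1" "\<forall>s i c. Row s i c \<in> ?W' \<longrightarrow> \<bar>i\<bar> \<le> w1"
    by (rule finite_row_bound[OF finite_imageI[OF W(1)]])
  \<comment> \<open>Besides bounding the reindexed support, \<open>w'\<close> is at least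
    \<open>- h t (- w)\<close>, so translation by \<open>w' + 1\<close> makes the image of the
    window under \<open>h t\<close> positive.\<close>
  define w' where "w' = max w1 \<bar>h t (- w)\<bar>"
  have w': "0 \<le> w'" "\<forall>s i c. Row s i c \<in> ?W' \<longrightarrow> \<bar>i\<bar> \<le> w'" "- w' \<le> h t (- w)"
  proof -
    show "0 \<le> w'" "- w' \<le> h t (- w)" using w1(1) by (auto simp: w'_def)
    show "\<forall>s i c. Row s i c \<in> ?W' \<longrightarrow> \<bar>i\<bar> \<le> w'"
      unfolding w'_def le_max_iff_disj using w1(2) by blast
  qed
  have W': "?W' \<subseteq> Vs j (insert t D)"
  proof
    fix x assume "x \<in> ?W'"
    then obtain y where y: "y \<in> W" "x = sub h y" by blast
    then have "y \<in> Vs j (insert t D)" using W(2) by blast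
    show "x \<in> Vs j (insert t D)"
    proof (cases y)
      case (Row s i c)
      show ?thesis
      proof (cases "s \<in> insert t D")
        case False
        then have "0 < i" using Row \<open>y \<in> Vs j (insert t D)\<close> by simp
        then have "0 < h s i" by (rule strict_mono_pos[OF h(1) h(2)[OF False]])
        then show ?thesis using y(2) Row by simp
      qed (use y(2) Row in simp)
    qed (use y(2) \<open>y \<in> Vs j (insert t D)\<close> in simp)
  qed
  have Q': "dfn K N ?W' (\<lambda>v. P (v \<circ> sub h))" by (rule dfn2_comp[OF W(3)]) simp
  let ?P = "\<lambda>v. P (v \<circ> sub (shift t (w + 1)))"
  have "sub (shift t (w + 1)) ` W \<subseteq> Vs j D"
  proof
    fix x assume "x \<in> sub (shift t (w + 1)) ` W"
    then obtain y where y: "y \<in> W" "x = sub (shift t (w + 1)) y" by blast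
    then have yV: "y \<in> Vs j (insert t D)" using W(2) by blast
    show "x \<in> Vs j D"
    proof (cases y)
      case (Row s i c)
      then have "\<bar>i\<bar> \<le> w" using w(2) y(1) by blast
      then show ?thesis using Row y(2) yV by (auto simp: shift_def)
    qed (use y(2) yV in auto)
  qed
  then have "dfn K N (Vs j D) ?P" by (rule dfn2_comp[OF W(3)])
  \<comment> \<open>On positive indices this is \<open>h t\<close> conjugated by the two
    translations; the indices up to 0 stay fixed, as \<open>inv j D\<close> demands of a row outside
    \<open>D\<close>.\<close>
  moreover define h' where
    "h' = (\<lambda>s. if s = t then (\<lambda>i. if i \<le> 0 then i else h t (i - (w + 1)) + (w' + 1)) else h s)"
  have "\<forall>s. strict_mono (h' s)"
  proof
    have "strict_mono (\<lambda>i. if i \<le> 0 then i else h t (i - (w + 1)) + (w' + 1))"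
    proof (rule strict_monoI)
      fix x y :: int assume "x < y"
      have "- w' \<le> h t (y - (w + 1))" if "0 < y"
      proof -
        have "h t (- w) \<le> h t (y - (w + 1))"
          using that by (intro monoD[OF strict_mono_mono[OF h(1)]]) simp
        then show ?thesis using w'(3) by simp
      qed
      moreover have "h t (x - (w + 1)) < h t (y - (w + 1))"
        using \<open>x < y\<close> by (intro strict_monoD[OF h(1)]) simp
      ultimately show "(if x \<le> 0 then x else h t (x - (w + 1)) + (w' + 1))
          < (if y \<le> 0 then y else h t (y - (w + 1)) + (w' + 1))"
        using \<open>x < y\<close> by auto
    qed
    then show "strict_mono (h' s)" for s using h(1) by (simp add: h'_def)
  qed
  moreover have "\<forall>s. s \<notin> D \<longrightarrow> h' s 0 = 0" using h(2) by (auto simp: h'_def)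
  ultimately have "eventually ?P F \<longleftrightarrow> eventually (\<lambda>v. ?P (v \<circ> sub h')) F"
    using D unfolding inv_def by blast
  also have "\<dots> \<longleftrightarrow> eventually (\<lambda>v. P (v \<circ> (sub (shift t (w' + 1)) \<circ> sub h))) F"
    unfolding comp_assoc
  proof (rule ev_cong[OF W(3)])
    fix x assume x: "x \<in> W"
    show "(sub h' \<circ> sub (shift t (w + 1))) x = (sub (shift t (w' + 1)) \<circ> sub h) x"
    proof (cases x)
      case (Row s i c)
      then have "\<bar>i\<bar> \<le> w" using w(2) x by blast
      then show ?thesis using Row by (auto simp: shift_def h'_def)
    qed simp
  qed
  finally have eq: "eventually ?P F \<longleftrightarrow>
      eventually (\<lambda>v. P ((v \<circ> sub (shift t (w' + 1))) \<circ> sub h)) F"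
    by (simp only: comp_assoc)
  show ?thesis
  proof (cases "eventually P F \<longleftrightarrow> eventually ?P F")
    case True
    then have "eventually (\<lambda>v. P (v \<circ> sub h)) F \<noteq>
        eventually (\<lambda>v. P ((v \<circ> sub (shift t (w' + 1))) \<circ> sub h)) F"
      using neq eq by blast
    then show ?thesis using w'(2) by (intro that[OF Q' W' w'(1)]) blast+
  next
    case False
    then show ?thesis using w(2) by (intro that[OF W(3,2) w(1)]) blast+
  qed
qed

text \<open>Both translates lie beyond the window on the same side of 0, and stretching that side,
  which fixes 0, carries one to the other. The reduction to the case where \<open>m\<close> has the
  smaller absolute value ensures that entries move away from 0, so that the stretching is
  monotone.\<close>

lemma shift_eq:
  assumes Q: "dfn K N W Q" and w: "\<forall>i c. Row t i c \<in> W \<longrightarrow> \<bar>i\<bar> \<le> w" "0 \<le> w"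
    and m: "w < m \<and> w < m' \<or> m < - w \<and> m' < - w"
  shows "eventually (\<lambda>v. Q (v \<circ> sub (shift t m))) F \<longleftrightarrow> eventually (\<lambda>v. Q (v \<circ> sub (shift t m'))) F"
  using m
proof (induction "\<bar>m\<bar>" "\<bar>m'\<bar>" arbitrary: m m' rule: linorder_wlog)
  case le
  define h where "h = (\<lambda>s i. if s = t \<and> (0 < i \<longleftrightarrow> 0 < m) \<and> i \<noteq> 0 then i + (m' - m) else i)"
  let ?P = "\<lambda>v. Q (v \<circ> sub (shift t m))"
  have "dfn K N UNIV ?P" by (rule dfn2_comp[OF Q]) simp
  moreover have "strict_mono (h s)" for s
    using le w(2) by (intro strict_monoI) (auto simp: h_def)
  moreover have "h s 0 = 0" for s by (simp add: h_def)
  ultimately have "eventually ?P F \<longleftrightarrow> eventually (\<lambda>v. ?P (v \<circ> sub h)) F"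
    by (rule signed_indisc)
  also have "\<dots> \<longleftrightarrow> eventually (\<lambda>v. Q (v \<circ> sub (shift t m'))) F"
    unfolding comp_assoc
  proof (rule ev_cong[OF Q])
    fix x assume x: "x \<in> W"
    show "(sub h \<circ> sub (shift t m)) x = sub (shift t m') x"
    proof (cases x)
      case (Row s i c)
      then have "\<bar>i\<bar> \<le> w" if "s = t" using w(1) x that by blast
      then show ?thesis using Row le w(2) by (auto simp: shift_def h_def)
    qed simp
  qed
  finally show ?case .
next
  case sym
  then show ?case by blast
qed

text \<open>As a function of the translation of row \<open>t\<close>, the truth value of
  \<open>Q\<close> is constant far to the right and far to the left. Pairs of translations at
  distance \<open>d\<close> are repeated with period \<open>2 * d\<close>, and only the pair with
  \<open>k = 0\<close> sees a change of value.\<close>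

lemma isolate:
  assumes Q: "dfn K N W Q" and w: "\<forall>i c. Row t i c \<in> W \<longrightarrow> \<bar>i\<bar> \<le> w" "0 \<le> w"
    and neq: "eventually Q F \<noteq> eventually (\<lambda>v. Q (v \<circ> sub (shift t (w + 1)))) F"
  obtains z d where "0 < d"
    "\<forall>k. (eventually (\<lambda>v. Q (v \<circ> sub (shift t (z + k * (2 * d))))) F \<noteq>
           eventually (\<lambda>v. Q (v \<circ> sub (shift t (z + d + k * (2 * d))))) F) \<longleftrightarrow> k = 0"
proof -
  define \<chi> where "\<chi> = (\<lambda>m. eventually (\<lambda>v. Q (v \<circ> sub (shift t m))) F)"
  have right: "\<chi> m = \<chi> (w + 1)" if "w < m" for m
    unfolding \<chi>_def by (rule shift_eq[OF Q w]) (use that in auto)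
  have left: "\<chi> m = \<chi> (- (w + 1))" if "m < - w" for m
    unfolding \<chi>_def by (rule shift_eq[OF Q w]) (use that in auto)
  have sub0: "sub (shift t 0) = id"
  proof
    show "sub (shift t 0) x = id x" for x :: "'k var" by (cases x) (auto simp: shift_def)
  qed
  have chi0: "\<chi> 0 \<noteq> \<chi> (w + 1)" using neq by (simp add: \<chi>_def sub0)
  \<comment> \<open>\<open>d\<close> is longer than the window from \<open>- w\<close> to
    \<open>w\<close>. If the two limits of \<open>\<chi>\<close> differ, the pair starts in the left
    limit and ends in the right one; if they agree, it starts at 0, where \<open>\<chi>\<close>
    differs from both.\<close>
  define d where "d = 2 * w + 2"
  have d: "0 < d" using w(2) by (simp add: d_def)
  define z where "z = (if \<chi> (- (w + 1)) \<noteq> \<chi> (w + 1) then - (w + 1) else 0)"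
  have z: "- (w + 1) \<le> z" "z \<le> 0" using w(2) by (auto simp: z_def)
  have "\<chi> (z + k * (2 * d)) \<noteq> \<chi> (z + d + k * (2 * d)) \<longleftrightarrow> k = 0" for k
  proof -
    consider "k = 0" | "1 \<le> k" | "k \<le> -1" by linarith
    then show ?thesis
    proof cases
      case 1
      have "\<chi> z \<noteq> \<chi> (w + 1)" using chi0 by (simp add: z_def)
      moreover have "\<chi> (z + d) = \<chi> (w + 1)" using w(2) z d_def by (intro right) linarith
      ultimately show ?thesis using 1 by simp
    next
      case 2
      then have "1 * (2 * d) \<le> k * (2 * d)" using d by (intro mult_right_mono) auto
      then have "w < z + k * (2 * d)" "w < z + d + k * (2 * d)"
        using w(2) z d_def by linarith+
      then have "\<chi> (z + k * (2 * d)) = \<chi> (z + d + k * (2 * d))" using right by metis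
      then show ?thesis using 2 by simp
    next
      case 3
      then have "k * (2 * d) \<le> (-1) * (2 * d)" using d by (intro mult_right_mono) auto
      then have "z + k * (2 * d) < - w" "z + d + k * (2 * d) < - w"
        using w(2) z d_def by linarith+
      then have "\<chi> (z + k * (2 * d)) = \<chi> (z + d + k * (2 * d))" using left by metis
      then show ?thesis using 3 by simp
    qed
  qed
  then show ?thesis using that[OF d] unfolding \<chi>_def by blast
qed

text \<open>The exclusive or of the two translates from \<open>isolate\<close>. It recognizes one
  position of row \<open>t\<close> among all translates by multiples of the period, and so takes
  over the role of the formula that cuts the row.\<close>

lemma isolating_predicate:
  assumes t: "t \<notin> D" "inv j D" "\<not> inv j (insert t D)"
  obtains \<Xi> d where "dfn K N (Vs j (insert t D)) \<Xi>" "0 < d"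
    "\<forall>k. eventually (\<lambda>v. \<Xi> (v \<circ> sub (shift t (k * d)))) F \<longleftrightarrow> k = 0"
proof -
  obtain W Q w where Q: "dfn K N W Q" "W \<subseteq> Vs j (insert t D)" "0 \<le> w"
    "\<forall>i c. Row t i c \<in> W \<longrightarrow> \<bar>i\<bar> \<le> w"
    "eventually Q F \<noteq> eventually (\<lambda>v. Q (v \<circ> sub (shift t (w + 1)))) F"
    by (rule broken_by_shift[OF t])
  obtain z d where z: "0 < d"
    "\<forall>k. (eventually (\<lambda>v. Q (v \<circ> sub (shift t (z + k * (2 * d))))) F \<noteq>
           eventually (\<lambda>v. Q (v \<circ> sub (shift t (z + d + k * (2 * d))))) F) \<longleftrightarrow> k = 0"
    by (rule isolate[OF Q(1,4,3,5)])
  define \<Xi> where "\<Xi> = (\<lambda>v. \<not> (Q (v \<circ> sub (shift t z)) \<longleftrightarrow> Q (v \<circ> sub (shift t (z + d)))))"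
  have shift_add: "(v \<circ> sub (shift t a)) \<circ> sub (shift t b) = v \<circ> sub (shift t (b + a))"
    for v :: "'k var \<Rightarrow> 'b" and a b
  proof
    show "((v \<circ> sub (shift t a)) \<circ> sub (shift t b)) x = (v \<circ> sub (shift t (b + a))) x" for x
      by (cases x) (auto simp: shift_def add.assoc)
  qed
  have supp: "sub (shift t a) ` W \<subseteq> Vs j (insert t D)" for a
  proof
    fix x assume "x \<in> sub (shift t a) ` W"
    then obtain y where y: "y \<in> W" "x = sub (shift t a) y" by blast
    then have "y \<in> Vs j (insert t D)" using Q(2) by blast
    then show "x \<in> Vs j (insert t D)" using y(2) by (cases y) (auto simp: shift_def)
  qed
  have "dfn K N (Vs j (insert t D)) \<Xi>"
    unfolding \<Xi>_def by (intro dfn2_neg dfn2_iff dfn2_comp[OF Q(1)] supp)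
  moreover have "eventually (\<lambda>v. \<Xi> (v \<circ> sub (shift t (k * (2 * d))))) F \<longleftrightarrow> k = 0" for k
    unfolding \<Xi>_def shift_add ultra_not[OF ultraF] ultra_iff[OF ultraF] using z(2) by blast
  moreover have "0 < 2 * d" using z(1) by simp
  ultimately show ?thesis using that by blast
qed

end

section \<open>Patterns in one variable from the dropped rows\<close>

context indisc
begin

text \<open>In the pattern on the rows of \<open>E\<close>, entry \<open>i\<close> of row \<open>t\<close> is obtained by translating row \<open>t\<close> by
  \<open>i * d t\<close> while the parameters taken from the other rows of \<open>E\<close>, which are positive, are pushed
  beyond \<open>Z\<close>. The element cutting at \<open>f\<close> comes from translating each row back by \<open>f t * d t\<close> below
  \<open>Z\<close>; this is allowed because the rows in \<open>D\<close> are indiscernible over the earlier coordinates.\<close>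

lemma pattern_of_isolating:
  fixes \<Xi> :: "'k \<Rightarrow> ('k var \<Rightarrow> 'b) \<Rightarrow> bool" and d :: "'k \<Rightarrow> int" and R :: nat
  assumes D: "inv j D" "D' \<subseteq> D" and E: "finite E" "E \<subseteq> D - D'"
    and \<Xi>: "\<And>t. t \<in> E \<Longrightarrow> dfn K N (Vs (Suc j) (insert t D')) (\<Xi> t)"
    and d: "\<And>t. t \<in> E \<Longrightarrow> 0 < d t"
    and iso: "\<And>t k. t \<in> E \<Longrightarrow> eventually (\<lambda>v. \<Xi> t (v \<circ> sub (shift t (k * d t)))) F \<longleftrightarrow> k = 0"
  obtains v g where "range v \<subseteq> univ N"
    "\<forall>f \<in> E \<rightarrow>\<^sub>E {..<R}. \<exists>x\<in>univ N. \<forall>t\<in>E. \<forall>i<R. \<Xi> t ((v \<circ> sub (g t i))(Elt j := x)) \<longleftrightarrow> f t = i"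
proof -
  have "\<forall>t\<in>E. \<exists>W. finite W \<and> W \<subseteq> Vs (Suc j) (insert t D') \<and> dfn K N W (\<Xi> t)"
    using dfn2_finite_support[OF \<Xi>] by blast
  then obtain W where W: "\<And>t. t \<in> E \<Longrightarrow> finite (W t)"
    "\<And>t. t \<in> E \<Longrightarrow> W t \<subseteq> Vs (Suc j) (insert t D')" "\<And>t. t \<in> E \<Longrightarrow> dfn K N (W t) (\<Xi> t)"
    by (auto dest!: bchoice)
  have "finite (\<Union>t\<in>E. W t)" using E(1) W(1) by blast
  then obtain w where w: "0 \<le> w" "\<forall>s i c. Row s i c \<in> (\<Union>t\<in>E. W t) \<longrightarrow> \<bar>i\<bar> \<le> w"
    by (rule finite_row_bound)
  define dm where "dm = sum d E"
  have dm: "d t \<le> dm" if "t \<in> E" for t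
    unfolding dm_def using that E(1) d by (intro member_le_sum) (auto intro: less_imp_le)
  have dm0: "0 \<le> dm" unfolding dm_def using d by (intro sum_nonneg) (auto intro: less_imp_le)
  \<comment> \<open>No index of the window exceeds \<open>Z\<close> after translation by
    \<open>i * d t\<close> with \<open>i < R\<close>. Thus \<open>hf f\<close> moves a translated
    row as one block and leaves the pushed parameters, all beyond \<open>Z\<close>, in
    place.\<close>
  define Z where "Z = w + int R * dm"
  have Z: "w \<le> Z" "0 \<le> Z" using w(1) dm0 by (auto simp: Z_def)
  have id_Z: "x + int i * d t \<le> Z" if "t \<in> E" "i < R" "x \<le> w" for t i x
  proof -
    have "int i * d t \<le> int R * dm"
      using that(2) dm[OF that(1)] d[OF that(1)] by (intro mult_mono) auto
    then show ?thesis using that(3) by (simp add: Z_def)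
  qed
  define g where "g = (\<lambda>t i s x. if s = t then x + int i * d t else
      if s \<in> E then (if x \<le> 0 then x else x + Z) else x)"
  define hf where "hf = (\<lambda>f s x. if s \<in> E then (if x \<le> Z then x - int (f s) * d s else x) else x)"
  define \<Theta> where "\<Theta> = (\<lambda>f v. \<forall>t\<in>E. \<forall>i\<in>{..<R}. \<Xi> t (v \<circ> sub (g t i)) \<longleftrightarrow> f t = i)"
  have entry: "eventually (\<lambda>v. \<Xi> t ((v \<circ> sub (hf f)) \<circ> sub (g t i)) \<longleftrightarrow> f t = i) F"
    if t: "t \<in> E" and i: "i \<in> {..<R}" for f t i
  proof -
    \<comment> \<open>The two moves amount to translating row \<open>t\<close> by \<open>m\<close>,
      so by isolation the entry is true exactly when \<open>i = f t\<close>. The other rows of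
      \<open>E\<close> are only displaced by \<open>far\<close>, which fixes 0;
      \<open>signed_indisc\<close> allows this although \<open>\<Xi> t\<close> may mention
      \<open>Elt j\<close>.\<close>
    define m where "m = (int i - int (f t)) * d t"
    define far where "far = (\<lambda>s x. if s \<in> E \<and> s \<noteq> t then (if x \<le> 0 then x else x + Z) else x)"
    let ?P = "\<lambda>v. \<Xi> t (v \<circ> sub (shift t m))"
    have "dfn K N UNIV ?P" by (rule dfn2_comp[OF W(3)[OF t]]) simp
    moreover have "strict_mono (far s)" for s
      using Z(2) by (intro strict_monoI) (auto simp: far_def)
    moreover have "far s 0 = 0" for s by (simp add: far_def)
    ultimately have "eventually ?P F \<longleftrightarrow> eventually (\<lambda>v. ?P (v \<circ> sub far)) F"
      by (rule signed_indisc)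
    also have "\<dots> \<longleftrightarrow> eventually (\<lambda>v. \<Xi> t (v \<circ> (sub (hf f) \<circ> sub (g t i)))) F"
      unfolding comp_assoc
    proof (rule ev_cong[OF W(3)[OF t]])
      fix y assume y: "y \<in> W t"
      show "(sub far \<circ> sub (shift t m)) y = (sub (hf f) \<circ> sub (g t i)) y"
      proof (cases y)
        case (Row s x c)
        then have x: "\<bar>x\<bar> \<le> w" using w(2) y t by blast
        consider "s = t" | "s \<noteq> t" "s \<in> E" | "s \<noteq> t" "s \<notin> E" by blast
        then show ?thesis
        proof cases
          case 1
          then show ?thesis using Row id_Z[OF t, of i x] i x t
            by (simp add: shift_def g_def hf_def far_def m_def algebra_simps)
        next
          case 2
          have "Row s x c \<in> Vs (Suc j) (insert t D')" using W(2)[OF t] y Row by blast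
          moreover have "s \<notin> D'" using 2(2) E(2) by blast
          ultimately have "0 < x" using 2(1) by simp
          then show ?thesis using Row 2 by (simp add: shift_def g_def hf_def far_def)
        next
          case 3
          then show ?thesis using Row by (simp add: shift_def g_def hf_def far_def)
        qed
      qed simp
    qed
    also have "eventually ?P F \<longleftrightarrow> f t = i"
      unfolding m_def iso[OF t] by auto
    finally have "(f t = i) \<longleftrightarrow> eventually (\<lambda>v. \<Xi> t ((v \<circ> sub (hf f)) \<circ> sub (g t i))) F"
      unfolding comp_assoc .
    moreover have "F \<noteq> bot" using ultraF by (simp add: ultra_def)
    ultimately show ?thesis unfolding ultra_iff[OF ultraF] eventually_const_iff by blast
  qed
  \<comment> \<open>\<open>hf f\<close> moves index 0 of rows in \<open>E\<close>, so it may only be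
    applied over \<open>Vs j D\<close>. Quantifying \<open>Elt j\<close> away brings the predicate
    there, and after the reindexing the original coordinate \<open>v (Elt j)\<close> is a
    witness.\<close>
  have each: "eventually (\<lambda>v. \<exists>x\<in>univ N. \<Theta> f (v(Elt j := x))) F" for f
  proof -
    have "dfn K N (Vs (Suc j) D) (\<Theta> f)"
      unfolding \<Theta>_def
    proof (intro dfn2_Ball dfn2_iff dfn2_const univ_ne E(1) finite_lessThan dfn2_comp)
      fix t i assume t: "t \<in> E"
      show "dfn K N (Vs (Suc j) (insert t D')) (\<Xi> t)" by (rule \<Xi>[OF t])
      show "sub (g t i) ` Vs (Suc j) (insert t D') \<subseteq> Vs (Suc j) D"
      proof
        fix y assume "y \<in> sub (g t i) ` Vs (Suc j) (insert t D')"
        then obtain y' where y': "y' \<in> Vs (Suc j) (insert t D')" "y = sub (g t i) y'" by blast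
        show "y \<in> Vs (Suc j) D"
        proof (cases y')
          case (Row s x c)
          then consider "s = t" | "s \<in> D'" | "s \<in> E" | "s \<noteq> t" "s \<notin> E" "0 < x" using y'(1) by auto
          then show ?thesis
          proof cases
            case 4
            then show ?thesis using y'(2) Row by (simp add: g_def)
          qed (use y'(2) Row t D(2) E(2) in auto)
        qed (use y' in auto)
      qed
    qed
    then have "dfn K N (Vs (Suc j) D - {Elt j}) (\<lambda>v. \<exists>x\<in>univ N. \<Theta> f (v(Elt j := x)))"
      by (rule dfn2_Ex)
    moreover have "Vs (Suc j) D - {Elt j} \<subseteq> Vs j D"
    proof
      show "y \<in> Vs j D" if "y \<in> Vs (Suc j) D - {Elt j}" for y using that by (cases y) auto
    qed
    ultimately have dfn: "dfn K N (Vs j D) (\<lambda>v. \<exists>x\<in>univ N. \<Theta> f (v(Elt j := x)))"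
      by (rule dfn2_mono)
    have mono: "\<forall>s. strict_mono (hf f s)"
    proof
      fix s show "strict_mono (hf f s)"
      proof (rule strict_monoI)
        fix x y :: int assume "x < y"
        have "0 \<le> int (f s) * d s" if "s \<in> E" using d[OF that] by simp
        then show "hf f s x < hf f s y" using \<open>x < y\<close> by (auto simp: hf_def)
      qed
    qed
    have zero: "\<forall>s. s \<notin> D \<longrightarrow> hf f s 0 = 0" using E(2) by (auto simp: hf_def)
    have "eventually (\<lambda>v. \<exists>x\<in>univ N. \<Theta> f (v(Elt j := x))) F \<longleftrightarrow>
        eventually (\<lambda>v. \<exists>x\<in>univ N. \<Theta> f ((v \<circ> sub (hf f))(Elt j := x))) F"
      using D(1) dfn mono zero unfolding inv_def by blast
    moreover have "eventually (\<lambda>v. \<forall>t\<in>E. \<forall>i\<in>{..<R}. \<Xi> t ((v \<circ> sub (hf f)) \<circ> sub (g t i)) \<longleftrightarrow> f t = i) F"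
      using entry E(1) by (intro eventually_ball_finite ballI) auto
    then have "eventually (\<lambda>v. \<exists>x\<in>univ N. \<Theta> f ((v \<circ> sub (hf f))(Elt j := x))) F"
      using univF
    proof eventually_elim
      case (elim v)
      have "(v \<circ> sub (hf f))(Elt j := v (Elt j)) = v \<circ> sub (hf f)" by (simp add: fun_eq_iff)
      then have "\<Theta> f ((v \<circ> sub (hf f))(Elt j := v (Elt j)))" using elim(1) unfolding \<Theta>_def by simp
      moreover have "v (Elt j) \<in> univ N" using elim(2) by blast
      ultimately show ?case by blast
    qed
    ultimately show ?thesis by blast
  qed
  have "finite (E \<rightarrow>\<^sub>E {..<R})" using E(1) by (intro finite_PiE) auto
  then have "eventually (\<lambda>v. \<forall>f \<in> E \<rightarrow>\<^sub>E {..<R}. \<exists>x\<in>univ N. \<Theta> f (v(Elt j := x))) F"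
    using each by (intro eventually_ball_finite) auto
  then have "eventually (\<lambda>v. range v \<subseteq> univ N \<and> (\<forall>f \<in> E \<rightarrow>\<^sub>E {..<R}. \<exists>x\<in>univ N. \<Theta> f (v(Elt j := x)))) F"
    using univF by (intro eventually_conj)
  moreover have "F \<noteq> bot" using ultraF by (simp add: ultra_def)
  ultimately obtain v where v: "range v \<subseteq> univ N"
    "\<forall>f \<in> E \<rightarrow>\<^sub>E {..<R}. \<exists>x\<in>univ N. \<Theta> f (v(Elt j := x))"
    using eventually_happens' by blast
  have upd: "v(Elt j := x) \<circ> sub (g t i) = (v \<circ> sub (g t i))(Elt j := x)" for x t i
  proof
    show "(v(Elt j := x) \<circ> sub (g t i)) y = ((v \<circ> sub (g t i))(Elt j := x)) y" for y
      by (cases y) auto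
  qed
  show ?thesis
    using v(2) unfolding \<Theta>_def upd by (intro that[OF v(1), of g]) (simp only: Ball_def lessThan_iff)
qed

text \<open>\<open>c t\<close> is the stage at which row \<open>t\<close> is dropped. Coordinate
  \<open>c t\<close> becomes the only variable of the new formula, and earlier coordinates turn into
  parameters.\<close>

theorem split_pattern:
  assumes X: "inv 0 X" and q: "\<And>t. t \<in> X \<Longrightarrow> q t \<in> formulas K (n + l t)"
    and ev: "\<And>t. t \<in> X \<Longrightarrow>
      eventually (\<lambda>v. holds N (q t) (map v (map Elt [0..<n] @ map (Row t 0) [0..<l t]))) F"
      "\<And>t. t \<in> X \<Longrightarrow>
      \<not> eventually (\<lambda>v. holds N (q t) (map v (map Elt [0..<n] @ map (Row t 1) [0..<l t]))) F"
  obtains c q' l' where "\<forall>t\<in>X. c t < n" "\<forall>j. ict K N 1 {t \<in> X. c t = j} q' l'"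
proof -
  have "\<exists>D. \<forall>j. (inv j (D j) \<and> (j = 0 \<longrightarrow> D j = X)) \<and>
      (D (Suc j) \<subseteq> D j \<and> (\<forall>t\<in>D j - D (Suc j). \<not> inv (Suc j) (insert t (D (Suc j)))))"
  proof (rule dependent_nat_choice)
    show "\<exists>D. inv 0 D \<and> (0 = (0::nat) \<longrightarrow> D = X)" using X by blast
    fix D j
    obtain D' where "D' \<subseteq> D" "inv (Suc j) D'" "\<forall>t\<in>D - D'. \<not> inv (Suc j) (insert t D')"
      by (rule inv_maximal)
    then show "\<exists>D'. (inv (Suc j) D' \<and> (Suc j = 0 \<longrightarrow> D' = X)) \<and>
        (D' \<subseteq> D \<and> (\<forall>t\<in>D - D'. \<not> inv (Suc j) (insert t D')))" by blast
  qed
  then obtain D where D: "\<And>j. inv j (D j)" "D 0 = X" "\<And>j. D (Suc j) \<subseteq> D j"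
    "\<And>j t. t \<in> D j - D (Suc j) \<Longrightarrow> \<not> inv (Suc j) (insert t (D (Suc j)))" by blast
  have DX: "D j \<subseteq> X" for j by (induction j) (use D(2,3) in blast)+
  \<comment> \<open>A row surviving all stages could be translated by 1 over all \<open>n\<close>
    coordinates without changing truth; but that replaces entry 0, where \<open>q t\<close> holds,
    by entry 1, where it fails.\<close>
  have Dn: "D n = {}"
  proof (rule ccontr)
    assume "D n \<noteq> {}"
    then obtain t where t: "t \<in> D n" by blast
    then have tX: "t \<in> X" using DX by blast
    let ?ys = "\<lambda>i. map Elt [0..<n] @ map (Row t i) [0..<l t]"
    let ?P = "\<lambda>v. holds N (q t) (map v (?ys 0))"
    have "dfn K N (Vs n (D n)) ?P"
      using q[OF tX] t by (intro dfn2_holds) auto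
    moreover have "\<forall>s. strict_mono (shift t 1 s)" by (auto simp: strict_mono_def shift_def)
    moreover have "\<forall>s. s \<notin> D n \<longrightarrow> shift t 1 s 0 = 0" using t by (auto simp: shift_def)
    ultimately have "eventually ?P F \<longleftrightarrow> eventually (\<lambda>v. ?P (v \<circ> sub (shift t 1))) F"
      using D(1)[of n] unfolding inv_def by blast
    moreover have "map (v \<circ> sub (shift t 1)) (?ys 0) = map v (?ys 1)" for v :: "'k var \<Rightarrow> 'b"
      by (simp add: shift_def)
    ultimately show False using ev[OF tX] by (simp only: simp_thms)
  qed
  define c where "c = (\<lambda>t. LEAST j. t \<notin> D (Suc j))"
  have c: "c t < n" "t \<in> D (c t) - D (Suc (c t))" if t: "t \<in> X" for t
  proof -
    have "n \<noteq> 0" using Dn D(2) t by (metis empty_iff)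
    then have n: "t \<notin> D (Suc (n - 1))" using Dn by simp
    then have "c t \<le> n - 1" unfolding c_def by (rule Least_le[of "\<lambda>j. t \<notin> D (Suc j)"])
    then show "c t < n" using \<open>n \<noteq> 0\<close> by simp
    have "t \<notin> D (Suc (c t))" unfolding c_def by (rule LeastI[of "\<lambda>j. t \<notin> D (Suc j)", OF n])
    moreover have "t \<in> D (c t)"
    proof (cases "c t")
      case 0
      then show ?thesis using t D(2) by simp
    next
      case (Suc m)
      then have "m < (LEAST j. t \<notin> D (Suc j))" by (simp add: c_def)
      then show ?thesis using not_less_Least[of m "\<lambda>j. t \<notin> D (Suc j)"] Suc by simp
    qed
    ultimately show "t \<in> D (c t) - D (Suc (c t))" by blast
  qed
  have "\<exists>\<Xi> d. dfn K N (Vs (Suc (c t)) (insert t (D (Suc (c t))))) \<Xi> \<and> 0 < d \<and>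
      (\<forall>k. eventually (\<lambda>v. \<Xi> (v \<circ> sub (shift t (k * d)))) F \<longleftrightarrow> k = 0)" if tX: "t \<in> X" for t
  proof -
    have 1: "t \<notin> D (Suc (c t))" using c(2)[OF tX] by blast
    obtain \<Xi> d where "dfn K N (Vs (Suc (c t)) (insert t (D (Suc (c t))))) \<Xi>" "0 < d"
      "\<forall>k. eventually (\<lambda>v. \<Xi> (v \<circ> sub (shift t (k * d)))) F \<longleftrightarrow> k = 0"
      by (rule isolating_predicate[OF 1 D(1) D(4)[OF c(2)[OF tX]]])
    then show ?thesis by blast
  qed
  then obtain \<Xi> d where \<Xi>: "\<And>t. t \<in> X \<Longrightarrow> dfn K N (Vs (Suc (c t)) (insert t (D (Suc (c t))))) (\<Xi> t)"
    "\<And>t. t \<in> X \<Longrightarrow> 0 < d t"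
    "\<And>t k. t \<in> X \<Longrightarrow> eventually (\<lambda>v. \<Xi> t (v \<circ> sub (shift t (k * d t)))) F \<longleftrightarrow> k = 0"
    by metis
  have "\<exists>p ys. p \<in> formulas K (Suc (length ys)) \<and>
      (\<forall>v a. range v \<subseteq> univ N \<longrightarrow> a \<in> univ N \<longrightarrow> \<Xi> t (v(Elt (c t) := a)) = holds N p (a # map v ys))"
    if tX: "t \<in> X" for t
  proof -
    obtain p ys where "p \<in> formulas K (Suc (length ys))"
      "\<And>v a. range v \<subseteq> univ N \<Longrightarrow> a \<in> univ N \<Longrightarrow> \<Xi> t (v(Elt (c t) := a)) = holds N p (a # map v ys)"
      using dfn2_extract[OF \<Xi>(1)[OF tX], of "Elt (c t)"] by metis
    then show ?thesis by blast
  qed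
  then obtain p ys where p: "\<And>t. t \<in> X \<Longrightarrow> p t \<in> formulas K (Suc (length (ys t)))"
    "\<And>t v a. t \<in> X \<Longrightarrow> range v \<subseteq> univ N \<Longrightarrow> a \<in> univ N \<Longrightarrow>
       \<Xi> t (v(Elt (c t) := a)) = holds N (p t) (a # map v (ys t))"
    by metis
  show ?thesis
  proof (rule that)
    show "\<forall>t\<in>X. c t < n" using c(1) by blast
    show "\<forall>j. ict K N 1 {t \<in> X. c t = j} p (\<lambda>t. length (ys t))"
      unfolding ict_def
    proof (intro allI conjI impI ballI)
      fix j t assume "t \<in> {t \<in> X. c t = j}"
      then show "p t \<in> formulas K (1 + length (ys t))" using p(1) by simp
    next
      fix j and E :: "'k set" and R :: nat
      assume E: "finite E \<and> E \<subseteq> {t \<in> X. c t = j}"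
      have EX: "t \<in> X" "c t = j" if "t \<in> E" for t using E that by auto
      have ED: "E \<subseteq> D j - D (Suc j)" using c(2) EX by blast
      have \<Xi>E: "dfn K N (Vs (Suc j) (insert t (D (Suc j)))) (\<Xi> t)" if "t \<in> E" for t
        using \<Xi>(1)[OF EX(1)[OF that]] EX(2)[OF that] by simp
      obtain v g where v: "range v \<subseteq> univ N" and pat: "\<forall>f \<in> E \<rightarrow>\<^sub>E {..<R}. \<exists>x\<in>univ N. \<forall>t\<in>E. \<forall>i<R.
          \<Xi> t ((v \<circ> sub (g t i))(Elt j := x)) \<longleftrightarrow> f t = i"
        using pattern_of_isolating[OF D(1,3) conjunct1[OF E] ED \<Xi>E \<Xi>(2)[OF EX(1)] \<Xi>(3)[OF EX(1)], of R]
        by blast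
      define b where "b = (\<lambda>t i. map (v \<circ> sub (g t i)) (ys t))"
      have rng: "range (v \<circ> sub (g t i)) \<subseteq> univ N" for t i using v by auto
      have "\<forall>f \<in> E \<rightarrow>\<^sub>E {..<R}. \<exists>a\<in>tuples N 1. \<forall>t\<in>E. \<forall>i<R. holds N (p t) (a @ b t i) \<longleftrightarrow> f t = i"
      proof
        fix f assume "f \<in> E \<rightarrow>\<^sub>E {..<R}"
        then obtain x where x: "x \<in> univ N"
          "\<forall>t\<in>E. \<forall>i<R. \<Xi> t ((v \<circ> sub (g t i))(Elt j := x)) \<longleftrightarrow> f t = i" using pat by blast
        have "holds N (p t) ([x] @ b t i) \<longleftrightarrow> f t = i" if "t \<in> E" "i < R" for t i
          using p(2)[OF EX(1)[OF that(1)] rng[of t i] x(1)] EX(2)[OF that(1)] x(2) that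
          by (simp add: b_def)
        moreover have "[x] \<in> tuples N 1" using x(1) by (simp add: tuples_def)
        ultimately show "\<exists>a\<in>tuples N 1. \<forall>t\<in>E. \<forall>i<R. holds N (p t) (a @ b t i) \<longleftrightarrow> f t = i" by blast
      qed
      moreover have "\<forall>t\<in>E. \<forall>i. b t i \<in> tuples N (length (ys t))"
        using v by (auto simp: b_def tuples_def)
      ultimately show "\<exists>b. (\<forall>t\<in>E. \<forall>i. b t i \<in> tuples N (length (ys t))) \<and>
          (\<forall>f \<in> E \<rightarrow>\<^sub>E {..<R}. \<exists>a\<in>tuples N 1. \<forall>t\<in>E. \<forall>i<R. holds N (p t) (a @ b t i) \<longleftrightarrow> f t = i)"
        by blast
    qed
  qed
qed

end

section \<open>Extracting an indiscernible pattern\<close>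

text \<open>Finite Ramsey for colourings of lists, with sublists given by increasing position maps.
  The bound \<open>N\<close> precedes the colouring because the length of a finite pattern has to be
  requested before its entries, and hence the colouring, are known.\<close>

lemma ramsey_lists:
  fixes C :: "'c set"
  assumes "finite C"
  obtains N :: nat where "\<forall>col :: nat list \<Rightarrow> 'c. (\<forall>xs. col xs \<in> C) \<longrightarrow>
     (\<exists>ys. length ys = r' \<and> sorted_wrt (<) ys \<and> set ys \<subseteq> {..<N} \<and> (\<exists>c. \<forall>\<kappa>.
        (\<forall>k<r. \<kappa> k < r') \<and> (\<forall>k k'. k < k' \<and> k' < r \<longrightarrow> \<kappa> k < \<kappa> k') \<longrightarrow>
        col (map (\<lambda>k. ys ! \<kappa> k) [0..<r]) = c))"
proof -
  obtain e where e: "bij_betw e C {..<card C}"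
    using ex_bij_betw_finite_nat[OF assms] by (metis atLeast0LessThan)
  obtain N :: nat where N: "partn_lst {..<N} (replicate (card C) r') r"
    using ramsey_full by blast
  show ?thesis
  proof (rule that, intro allI impI)
    fix col :: "nat list \<Rightarrow> 'c" assume col: "\<forall>xs. col xs \<in> C"
    let ?f = "\<lambda>S. e (col (sorted_list_of_set S))"
    have "?f \<in> nsets {..<N} r \<rightarrow> {..<length (replicate (card C) r')}"
      using col bij_betwE[OF e] by auto
    then obtain i where "i < length (replicate (card C) r')"
        "monochromatic {..<N} (replicate (card C) r' ! i) r ?f i"
      using N unfolding partn_lst_def by blast
    then obtain H where H: "H \<in> nsets {..<N} r'" "?f ` nsets H r \<subseteq> {i}"
      unfolding monochromatic_def by auto
    have finH: "finite H" "card H = r'" "H \<subseteq> {..<N}" using H(1) by (auto simp: nsets_def)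
    define ys where "ys = sorted_list_of_set H"
    have ys: "length ys = r'" "set ys = H" "sorted_wrt (<) ys"
      using finH by (simp_all add: ys_def)
    have "e (col (map (\<lambda>k. ys ! \<kappa> k) [0..<r])) = i"
      if \<kappa>: "(\<forall>k<r. \<kappa> k < r') \<and> (\<forall>k k'. k < k' \<and> k' < r \<longrightarrow> \<kappa> k < \<kappa> k')" for \<kappa>
    proof -
      let ?xs = "map (\<lambda>k. ys ! \<kappa> k) [0..<r]"
      have sorted: "sorted_wrt (<) ?xs"
        unfolding sorted_wrt_iff_nth_less
        using \<kappa> sorted_wrt_nth_less[OF ys(3)] ys(1) by auto
      have sub: "set ?xs \<subseteq> H" using \<kappa> ys(1,2) by auto
      have "distinct ?xs" using sorted strict_sorted_iff by blast
      then have "card (set ?xs) = r" using distinct_card[of ?xs] by simp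
      then have "set ?xs \<in> nsets H r" using sub by (simp add: nsets_def)
      then have "?f (set ?xs) = i" using H(2) by blast
      moreover have "sorted_list_of_set (set ?xs) = ?xs"
        using sorted by (intro strict_sorted_equal) auto
      ultimately show ?thesis by simp
    qed
    then have "col (map (\<lambda>k. ys ! \<kappa> k) [0..<r]) = the_inv_into C e i"
      if "(\<forall>k<r. \<kappa> k < r') \<and> (\<forall>k k'. k < k' \<and> k' < r \<longrightarrow> \<kappa> k < \<kappa> k')" for \<kappa>
      using that col bij_betw_imp_inj_on[OF e] the_inv_into_f_eq by metis
    then show "\<exists>ys. length ys = r' \<and> sorted_wrt (<) ys \<and> set ys \<subseteq> {..<N} \<and> (\<exists>c. \<forall>\<kappa>.
        (\<forall>k<r. \<kappa> k < r') \<and> (\<forall>k k'. k < k' \<and> k' < r \<longrightarrow> \<kappa> k < \<kappa> k') \<longrightarrow>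
        col (map (\<lambda>k. ys ! \<kappa> k) [0..<r]) = c)"
      using ys finH(3) by (intro exI[of _ ys]) blast
  qed
qed

text \<open>Rows of equal length are stored as consecutive blocks. Increasing maps chosen separately
  for each row then combine to one increasing map of positions, since blocks go to the corresponding
  blocks.\<close>

lemma lex_embedding:
  fixes u :: "nat \<Rightarrow> nat \<Rightarrow> nat"
  assumes u_less: "\<forall>a b. a < m \<and> b < L \<longrightarrow> u a b < L'"
    and u_mono: "\<forall>a b b'. a < m \<and> b < b' \<and> b' < L \<longrightarrow> u a b < u a b'"
    and \<kappa>_def: "\<And>k. \<kappa> k = (k div L) * L' + u (k div L) (k mod L)"
  shows "\<forall>k < m * L. \<kappa> k < m * L'" "\<forall>k k'. k < k' \<and> k' < m * L \<longrightarrow> \<kappa> k < \<kappa> k'"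
    "\<And>a b. b < L \<Longrightarrow> \<kappa> (a * L + b) = a * L' + u a b"
proof -
  have u: "\<And>a b. a < m \<Longrightarrow> b < L \<Longrightarrow> u a b < L'"
    "\<And>a b b'. a < m \<Longrightarrow> b < b' \<Longrightarrow> b' < L \<Longrightarrow> u a b < u a b'"
    using u_less u_mono by blast+
  have bounds: "k div L < m" "k mod L < L" if "k < m * L" for k
  proof -
    have "0 < L" using that by (cases L) auto
    then show "k div L < m" "k mod L < L" using that by (auto simp: less_mult_imp_div_less)
  qed
  have up: "a * L' + u a b < a' * L'" if "a < a'" "a < m" "b < L" for a a' b
  proof -
    have "a * L' + u a b < Suc a * L'" using u(1)[OF that(2,3)] by simp
    also have "\<dots> \<le> a' * L'" using that(1) by (intro mult_le_mono1) simp
    finally show ?thesis .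
  qed
  show "\<forall>k < m * L. \<kappa> k < m * L'" unfolding \<kappa>_def using up bounds by blast
  show "\<forall>k k'. k < k' \<and> k' < m * L \<longrightarrow> \<kappa> k < \<kappa> k'"
  proof (intro allI impI, elim conjE)
    fix k k' assume k: "k < k'" "k' < m * L"
    then have km: "k < m * L" by simp
    have "k div L \<le> k' div L" using k(1) by (intro div_le_mono) simp
    then consider "k div L < k' div L" | "k div L = k' div L" by linarith
    then show "\<kappa> k < \<kappa> k'"
    proof cases
      case 1
      then have "\<kappa> k < (k' div L) * L'" unfolding \<kappa>_def using up bounds[OF km] by blast
      then show ?thesis unfolding \<kappa>_def by linarith
    next
      case 2
      then have "k mod L < k' mod L" using k(1) by (metis div_mult_mod_eq nat_add_left_cancel_less)
      then show ?thesis unfolding \<kappa>_def 2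
        using u(2)[OF bounds(1)[OF k(2)] _ bounds(2)[OF k(2)]] by simp
    qed
  qed
  show "\<kappa> (a * L + b) = a * L' + u a b" if "b < L" for a b
    using that by (simp add: \<kappa>_def)
qed

text \<open>Given finitely many indiscernibility requirements, a sufficiently long finite pattern satisfies
  them after thinning: its entries, ordered lexicographically by row and index, form a
  single increasing sequence, so the ordinary Ramsey theorem applies.\<close>

lemma ex_finitely_indiscernible:
  fixes K :: "('g, 's) language" and N :: "('b, 'g, 's) fo_structure"
    and \<S> :: "((('k var \<Rightarrow> 'b) \<Rightarrow> bool) \<times> ('k \<Rightarrow> int \<Rightarrow> int)) set"
  assumes str: "is_structure K N" and ict: "ict K N n X q l"
    and fin: "finite \<S>" "finite Y" "Y \<subseteq> X"
    and dfn: "\<And>P h. (P, h) \<in> \<S> \<Longrightarrow> dfn K N UNIV P"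
    and mono: "\<And>P h t. (P, h) \<in> \<S> \<Longrightarrow> strict_mono (h t)"
    and zero: "\<And>P h. (P, h) \<in> \<S> \<Longrightarrow> (\<forall>t. h t 0 = 0) \<or> (dfn K N (Vs 0 X) P)"
  obtains v where "range v \<subseteq> univ N" "\<forall>(P, h) \<in> \<S>. P v \<longleftrightarrow> P (v \<circ> sub h)"
    "\<forall>t\<in>Y. holds N (q t) (map v (map Elt [0..<n] @ map (Row t 0) [0..<l t]))"
    "\<forall>t\<in>Y. \<not> holds N (q t) (map v (map Elt [0..<n] @ map (Row t 1) [0..<l t]))"
proof -
  obtain u0 where u0: "u0 \<in> univ N" using str by (auto simp: is_structure_def)
  have "\<forall>x\<in>\<S>. \<exists>W. finite W \<and> dfn K N W (fst x) \<and> ((\<forall>t. snd x t 0 = 0) \<or> W \<subseteq> Vs 0 X)"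
  proof
    fix x assume "x \<in> \<S>"
    then have x: "(fst x, snd x) \<in> \<S>" by simp
    show "\<exists>W. finite W \<and> dfn K N W (fst x) \<and> ((\<forall>t. snd x t 0 = 0) \<or> W \<subseteq> Vs 0 X)"
      using zero[OF x]
    proof
      assume "\<forall>t. snd x t 0 = 0"
      moreover obtain W where "finite W" "W \<subseteq> UNIV" "dfn K N W (fst x)"
        by (rule dfn2_finite_support[OF dfn[OF x]])
      ultimately show ?thesis by blast
    next
      assume P: "dfn K N (Vs 0 X) (fst x)"
      obtain W where "finite W" "W \<subseteq> Vs 0 X" "dfn K N W (fst x)"
        by (rule dfn2_finite_support[OF P])
      then show ?thesis by blast
    qed
  qed
  then obtain W where W: "\<And>x. x \<in> \<S> \<Longrightarrow> finite (W x)" "\<And>x. x \<in> \<S> \<Longrightarrow> dfn K N (W x) (fst x)"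
    "\<And>x. x \<in> \<S> \<Longrightarrow> (\<forall>t. snd x t 0 = 0) \<or> W x \<subseteq> Vs 0 X"
    by (auto dest!: bchoice)
  have finW: "finite (\<Union>x\<in>\<S>. W x)" using fin(1) W(1) by blast
  define E where "E = X \<inter> (Y \<union> (\<lambda>y. case y of Elt j \<Rightarrow> undefined | Row t i c \<Rightarrow> t) ` (\<Union>x\<in>\<S>. W x))"
  have E: "finite E" "E \<subseteq> X" "Y \<subseteq> E" using finW fin by (auto simp: E_def)
  have E_row: "t \<in> E" if "x \<in> \<S>" "Row t i c \<in> W x" "t \<in> X" for x t i c
    unfolding E_def using that by (intro IntI UnI2 image_eqI[of _ _ "Row t i c"]) auto
  obtain w0 where w0: "0 \<le> w0" "\<forall>t i c. Row t i c \<in> (\<Union>x\<in>\<S>. W x) \<longrightarrow> \<bar>i\<bar> \<le> w0"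
    using finW by (rule finite_row_bound)
  \<comment> \<open>The added 1 keeps entry 1, where the formulas must fail, inside the
    window.\<close>
  define w where "w = nat w0 + 1"
  have w: "\<bar>i\<bar> \<le> int w" if "x \<in> \<S>" "Row t i c \<in> W x" for x t i c
  proof -
    have "\<bar>i\<bar> \<le> w0" using w0(2) that by blast
    then show ?thesis using w0(1) by (simp add: w_def)
  qed
  let ?V = "(\<lambda>(t, i, h). \<bar>h t i\<bar>) ` (E \<times> {- int w..int w} \<times> insert (\<lambda>t i. i) (snd ` \<S>))"
  have finV: "finite ?V" using E(1) fin(1) by auto
  \<comment> \<open>The half-width of a larger window, into which the identity and all reindexings
    in question map the smaller one.\<close>
  define w' where "w' = nat (Max (insert 0 ?V)) + w"
  have w': "\<bar>h t i\<bar> \<le> int w'" if "t \<in> E" "\<bar>i\<bar> \<le> int w" "h \<in> insert (\<lambda>t i. i) (snd ` \<S>)" for h t i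
  proof -
    have "\<bar>h t i\<bar> \<in> ?V"
      by (rule image_eqI[of _ _ "(t, i, h)"]) (use that in auto)
    then have "\<bar>h t i\<bar> \<le> Max (insert 0 ?V)" using finV by (intro Max_ge) auto
    then show ?thesis unfolding w'_def by linarith
  qed
  have ww': "1 \<le> w" "w \<le> w'" by (simp_all add: w_def w'_def)
  define m where "m = card E"
  obtain e where e: "bij_betw e E {..<m}"
    using ex_bij_betw_finite_nat[OF E(1)] unfolding m_def by (metis atLeast0LessThan)
  have e_less: "e t < m" if "t \<in> E" for t using bij_betwE[OF e] that by blast
  define einv where "einv = the_inv_into E e"
  have einv: "einv (e t) = t" if "t \<in> E" for t
    unfolding einv_def using that bij_betw_imp_inj_on[OF e] by (intro the_inv_into_f_f)
  have einv_E: "einv a \<in> E" if "a < m" for a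
    unfolding einv_def using that e by (intro the_inv_into_into[of e E]) (auto simp: bij_betw_def)
  define L where "L = 2 * w + 1"
  define L' where "L' = 2 * w' + 1"
  \<comment> \<open>A colour is the set of requirements whose predicate is true, so
    \<open>Pow \<S>\<close> is the finite set of colours. Windows of \<open>m\<close> rows and
    half-width \<open>w\<close> are coloured, and a homogeneous array of half-width
    \<open>w'\<close> is sought.\<close>
  obtain R where R: "\<forall>col :: nat list \<Rightarrow> ((('k var \<Rightarrow> 'b) \<Rightarrow> bool) \<times> ('k \<Rightarrow> int \<Rightarrow> int)) set.
     (\<forall>xs. col xs \<in> Pow \<S>) \<longrightarrow>
     (\<exists>ys. length ys = m * L' \<and> sorted_wrt (<) ys \<and> set ys \<subseteq> {..<R} \<and> (\<exists>c. \<forall>\<kappa>.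
        (\<forall>k < m * L. \<kappa> k < m * L') \<and> (\<forall>k k'. k < k' \<and> k' < m * L \<longrightarrow> \<kappa> k < \<kappa> k') \<longrightarrow>
        col (map (\<lambda>k. ys ! \<kappa> k) [0..<m * L]) = c))"
    by (rule ramsey_lists[of "Pow \<S>"]) (use fin(1) in simp)
  have "\<exists>\<beta> :: 'k \<Rightarrow> nat \<Rightarrow> 'b list. (\<forall>t\<in>E. \<forall>i. \<beta> t i \<in> tuples N (l t)) \<and>
      (\<forall>f \<in> E \<rightarrow>\<^sub>E {..<R}. \<exists>a\<in>tuples N n. \<forall>t\<in>E. \<forall>i<R. holds N (q t) (a @ \<beta> t i) \<longleftrightarrow> f t = i)"
    using conjunct2[OF ict[unfolded ict_def], THEN spec, THEN spec, THEN mp, OF conjI[OF E(1,2)]] .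
  then obtain \<beta> where \<beta>0: "\<forall>t\<in>E. \<forall>i. \<beta> t i \<in> tuples N (l t)"
    and \<beta>1: "\<forall>f \<in> E \<rightarrow>\<^sub>E {..<R}. \<exists>a\<in>tuples N n. \<forall>t\<in>E. \<forall>i<R. holds N (q t) (a @ \<beta> t i) \<longleftrightarrow> f t = i"
    by (elim exE conjE)
  have \<beta>: "\<beta> t i \<in> tuples N (l t)" if "t \<in> E" for t i using \<beta>0 that by blast
  obtain \<alpha> where \<alpha>0: "\<forall>f \<in> E \<rightarrow>\<^sub>E {..<R}. \<alpha> f \<in> tuples N n \<and>
      (\<forall>t\<in>E. \<forall>i<R. holds N (q t) (\<alpha> f @ \<beta> t i) \<longleftrightarrow> f t = i)"
    using bchoice[OF \<beta>1[unfolded Bex_def]] by (elim exE)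
  have \<alpha>: "\<alpha> f \<in> tuples N n" "t \<in> E \<Longrightarrow> i < R \<Longrightarrow> holds N (q t) (\<alpha> f @ \<beta> t i) \<longleftrightarrow> f t = i"
    if "f \<in> E \<rightarrow>\<^sub>E {..<R}" for f t i
    using bspec[OF \<alpha>0 that] by auto
  \<comment> \<open>Reads an assignment off a choice \<open>x\<close> of pattern entries; the
    coordinates are those of the tuple that cuts every row at its chosen entry \<open>x t 0\<close>.
    The default \<open>u0\<close> absorbs choices out of range, which occur because a colouring is
    defined on all lists.\<close>
  define asg where "asg = (\<lambda>(x :: 'k \<Rightarrow> int \<Rightarrow> nat) w y. case y of
      Elt j \<Rightarrow> if j < n \<and> (\<lambda>t\<in>E. x t 0) \<in> E \<rightarrow>\<^sub>E {..<R} then \<alpha> (\<lambda>t\<in>E. x t 0) ! j else u0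
    | Row t i c \<Rightarrow> if t \<in> E \<and> \<bar>i\<bar> \<le> int w \<and> c < l t then \<beta> t (x t i) ! c else u0)"
  have asg_univ: "range (asg x k) \<subseteq> univ N" for x k
  proof
    fix z assume "z \<in> range (asg x k)"
    then obtain y where y: "z = asg x k y" by blast
    show "z \<in> univ N"
    proof (cases y)
      case (Elt j)
      show ?thesis
      proof (cases "j < n \<and> (\<lambda>t\<in>E. x t 0) \<in> E \<rightarrow>\<^sub>E {..<R}")
        case True
        then have "\<alpha> (\<lambda>t\<in>E. x t 0) ! j \<in> univ N"
          using \<alpha>(1)[of "\<lambda>t\<in>E. x t 0"] nth_mem[of j "\<alpha> (\<lambda>t\<in>E. x t 0)"] by (auto simp: tuples_def)
        then show ?thesis using True y Elt by (simp add: asg_def)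
      qed (use y Elt u0 in \<open>auto simp: asg_def\<close>)
    next
      case (Row t i c)
      show ?thesis
      proof (cases "t \<in> E \<and> \<bar>i\<bar> \<le> int k \<and> c < l t")
        case True
        then have "\<beta> t (x t i) ! c \<in> univ N"
          using \<beta>[of t "x t i"] nth_mem[of c "\<beta> t (x t i)"] by (auto simp: tuples_def)
        then show ?thesis using True y Row by (simp add: asg_def)
      qed (use y Row u0 in \<open>auto simp: asg_def\<close>)
    qed
  qed
  define pos where "pos = (\<lambda>(L :: nat) w t i. e t * L + nat (i + int w))"
  define rd where "rd = (\<lambda>xs :: nat list. \<lambda>t i. xs ! pos L w t i)"
  define col where "col = (\<lambda>xs. {x \<in> \<S>. fst x (asg (rd xs) w)})"
  have colS: "\<forall>xs. col xs \<in> Pow \<S>" by (auto simp: col_def)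
  obtain ys c where ys: "length ys = m * L'" "sorted_wrt (<) ys" "set ys \<subseteq> {..<R}"
    and c: "\<forall>\<kappa>. (\<forall>k < m * L. \<kappa> k < m * L') \<and> (\<forall>k k'. k < k' \<and> k' < m * L \<longrightarrow> \<kappa> k < \<kappa> k') \<longrightarrow>
        col (map (\<lambda>k. ys ! \<kappa> k) [0..<m * L]) = c"
    using R[THEN spec, THEN mp, OF colS] by (elim exE conjE)
  define y where "y = (\<lambda>t i. ys ! pos L' w' t i)"
  define v where "v = asg y w'"
  have v_univ: "range v \<subseteq> univ N" unfolding v_def by (rule asg_univ)
  have pos_less: "pos (2 * k + 1) k t i < m * (2 * k + 1)" if "t \<in> E" "\<bar>i\<bar> \<le> int k" for t i k
  proof -
    have "nat (i + int k) < 2 * k + 1" using that(2) by linarith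
    then have "pos (2 * k + 1) k t i < Suc (e t) * (2 * k + 1)" by (simp add: pos_def)
    also have "\<dots> \<le> m * (2 * k + 1)" using e_less[OF that(1)] by (intro mult_le_mono1) simp
    finally show ?thesis .
  qed
  have y_less: "y t i < R" if "t \<in> E" "\<bar>i\<bar> \<le> int w'" for t i
      proof -
    have "ys ! pos L' w' t i \<in> set ys" using pos_less[OF that] ys(1) by (intro nth_mem) (simp add: L'_def)
    then show ?thesis using ys(3) by (auto simp: y_def)
  qed
  \<comment> \<open>Seen through the window, \<open>v\<close> reindexed by \<open>h\<close> is read
    off a sublist of \<open>ys\<close>, and these sublists share one colour. The coordinates are
    determined by the entries 0 of \<open>v\<close>, so \<open>h\<close> may move 0 only when the
    support avoids the coordinates; this is the assumption \<open>h0\<close>.\<close>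
  have homogeneous: "fst x (v \<circ> sub h) \<longleftrightarrow> x \<in> c"
    if x: "x \<in> \<S>" and h: "h \<in> insert (\<lambda>t i. i) (snd ` \<S>)"
      and h0: "(\<forall>t. h t 0 = 0) \<or> W x \<subseteq> Vs 0 X" for x h
  proof -
    have h_mono: "strict_mono (h t)" for t
      using h mono by (auto simp: strict_mono_id_int)
    define u where "u = (\<lambda>a b. nat (h (einv a) (int b - int w) + int w'))"
    define \<kappa> where "\<kappa> = (\<lambda>k. (k div L) * L' + u (k div L) (k mod L))"
    have off: "\<bar>h (einv a) (int b - int w)\<bar> \<le> int w'" if "a < m" "b < L" for a b
      using that einv_E by (intro w' h) (auto simp: L_def)
    have u1: "u a b < L'" if "a < m" "b < L" for a b
      using off[OF that] by (auto simp: u_def L'_def)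
    have u2: "u a b < u a b'" if "a < m" "b < b'" "b' < L" for a b b'
    proof -
      have "h (einv a) (int b - int w) < h (einv a) (int b' - int w)"
        using that(2) by (intro strict_monoD[OF h_mono]) simp
      then show ?thesis using off[of a b] off[of a b'] that by (auto simp: u_def)
    qed
    have u12: "\<forall>a b. a < m \<and> b < L \<longrightarrow> u a b < L'"
      "\<forall>a b b'. a < m \<and> b < b' \<and> b' < L \<longrightarrow> u a b < u a b'"
      using u1 u2 by blast+
    have "\<kappa> k = (k div L) * L' + u (k div L) (k mod L)" for k by (simp add: \<kappa>_def)
    note lex = lex_embedding[OF u12 this]
    let ?xs = "map (\<lambda>k. ys ! \<kappa> k) [0..<m * L]"
    have rd: "rd ?xs t i = y t (h t i)" if "t \<in> E" "\<bar>i\<bar> \<le> int w" for t i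
    proof -
      have "nat (i + int w) < L" using that(2) by (auto simp: L_def)
      then have "\<kappa> (pos L w t i) = e t * L' + u (e t) (nat (i + int w))"
        unfolding pos_def by (rule lex(3))
      also have "\<dots> = pos L' w' t (h t i)"
        using that by (simp add: u_def pos_def einv)
      finally show ?thesis
        using pos_less[OF that] by (simp add: rd_def y_def L_def)
    qed
    have f: "(\<lambda>t\<in>E. rd ?xs t 0) = (\<lambda>t\<in>E. y t 0)" if "\<forall>t. h t 0 = 0"
      using rd[of _ 0] that by (auto simp: restrict_def fun_eq_iff)
    have "(v \<circ> sub h) z = asg (rd ?xs) w z" if z: "z \<in> W x" for z
    proof (cases z)
      case (Elt j)
      then have "\<not> W x \<subseteq> Vs 0 X" using z by auto
      then have "\<forall>t. h t 0 = 0" using h0 by blast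
      then show ?thesis using Elt f by (simp add: v_def asg_def)
    next
      case (Row t i c')
      then have i: "\<bar>i\<bar> \<le> int w" using w[OF x] z by blast
      show ?thesis
      proof (cases "t \<in> E")
        case True
        then have "\<bar>h t i\<bar> \<le> int w'" using w' i h by blast
        then show ?thesis using Row True i rd[OF True i] by (simp add: v_def asg_def)
      qed (use Row in \<open>simp add: v_def asg_def\<close>)
    qed
    moreover have "range (v \<circ> sub h) \<subseteq> univ N" using v_univ by auto
    ultimately have "fst x (v \<circ> sub h) \<longleftrightarrow> fst x (asg (rd ?xs) w)"
      using asg_univ by (intro dfn2_cong_on[OF W(2)[OF x]])
    also have "\<dots> \<longleftrightarrow> x \<in> col ?xs" using x by (simp add: col_def)
    also have "col ?xs = c" by (rule c[THEN spec, THEN mp, OF conjI[OF lex(1,2)]])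
    finally show ?thesis .
  qed
  have sub_id: "v \<circ> sub (\<lambda>t i. i) = v"
  proof
    show "(v \<circ> sub (\<lambda>t i. i)) z = v z" for z by (cases z) auto
  qed
  have inv: "\<forall>(P, h) \<in> \<S>. P v \<longleftrightarrow> P (v \<circ> sub h)"
  proof (intro ballI, clarify)
    fix P h assume x: "(P, h) \<in> \<S>"
    have "P (v \<circ> sub h) \<longleftrightarrow> (P, h) \<in> c"
      using homogeneous[OF x, of h] W(3)[OF x] x by force
    moreover have "P v \<longleftrightarrow> (P, h) \<in> c"
      using homogeneous[OF x, of "\<lambda>t i. i"] by (simp add: sub_id)
    ultimately show "P v \<longleftrightarrow> P (v \<circ> sub h)" by simp
  qed
  define f where "f = (\<lambda>t\<in>E. y t 0)"
  have f: "f \<in> E \<rightarrow>\<^sub>E {..<R}" using y_less[of _ 0] by (auto simp: f_def)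
  have row: "map v (map Elt [0..<n] @ map (Row t i) [0..<l t]) = \<alpha> f @ \<beta> t (y t i)"
    if "t \<in> E" "\<bar>i\<bar> \<le> int w'" for t i
  proof -
    have "map (v \<circ> Elt) [0..<n] = \<alpha> f"
      using \<alpha>(1)[OF f] f by (intro nth_equalityI) (auto simp: tuples_def v_def asg_def f_def[symmetric])
    moreover have "map (v \<circ> Row t i) [0..<l t] = \<beta> t (y t i)"
      using \<beta>[OF that(1), of "y t i"] that by (intro nth_equalityI) (auto simp: tuples_def v_def asg_def)
    ultimately show ?thesis by simp
  qed
  have y01: "y t 0 \<noteq> y t 1" if "t \<in> E" for t
  proof -
    have "pos L' w' t 0 < pos L' w' t 1" by (simp add: pos_def)
    moreover have "pos L' w' t 1 < length ys" using pos_less[OF that, of 1 w'] ww' ys(1) by (simp add: L'_def)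
    ultimately have "y t 0 < y t 1" unfolding y_def by (rule sorted_wrt_nth_less[OF ys(2)])
    then show ?thesis by simp
  qed
  have cut: "holds N (q t) (map v (map Elt [0..<n] @ map (Row t i) [0..<l t])) \<longleftrightarrow> y t 0 = y t i"
    if "t \<in> E" "\<bar>i\<bar> \<le> int w'" for t i
    unfolding row[OF that] using \<alpha>(2)[OF f that(1) y_less[OF that]] that(1) by (simp add: f_def)
  show ?thesis
  proof (rule that[OF v_univ inv])
    show "\<forall>t\<in>Y. holds N (q t) (map v (map Elt [0..<n] @ map (Row t 0) [0..<l t]))"
      using cut[of _ 0] E(3) by auto
    show "\<forall>t\<in>Y. \<not> holds N (q t) (map v (map Elt [0..<n] @ map (Row t 1) [0..<l t]))"
      using cut[of _ 1] y01 E(3) ww' by auto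
  qed
qed

section \<open>Subadditivity\<close>

text \<open>An ultrafilter amalgamates the finitely indiscernible assignments. The requirements in
  \<open>\<S>\<close> are of two kinds: those fixing 0 hold for all predicates and give
  \<open>signed_indisc\<close>; those for predicates without coordinates may move 0 and give
  \<open>inv 0 X\<close>.\<close>

theorem ict_split:
  fixes K :: "('g, 's) language" and N :: "('b, 'g, 's) fo_structure" and X :: "'k set"
  assumes str: "is_structure K N" and ict: "ict K N n X q l"
  obtains c q' l' where "\<forall>t\<in>X. c t < n" "\<forall>j. ict K N 1 {t \<in> X. c t = j} q' l'"
proof -
  define \<S> :: "((('k var \<Rightarrow> 'b) \<Rightarrow> bool) \<times> ('k \<Rightarrow> int \<Rightarrow> int)) set" where
    "\<S> = {(P, h). dfn K N UNIV P \<and> (\<forall>t. strict_mono (h t)) \<and> ((\<forall>t. h t 0 = 0) \<or> dfn K N (Vs 0 X) P)}"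
  define good where "good = (\<lambda>(S, Y) v. range v \<subseteq> univ N \<and> (\<forall>(P, h) \<in> S. P v \<longleftrightarrow> P (v \<circ> sub h)) \<and>
    (\<forall>t\<in>Y. holds N (q t) (map v (map Elt [0..<n] @ map (Row t 0) [0..<l t])) \<and>
      \<not> holds N (q t) (map v (map Elt [0..<n] @ map (Row t 1) [0..<l t]))))"
  define J where "J = {(S, Y). finite S \<and> S \<subseteq> \<S> \<and> finite Y \<and> Y \<subseteq> X}"
  define F0 where "F0 = (INF x\<in>J. principal {v. good x v})"
  have J_ne: "({}, {}) \<in> J" by (simp add: J_def)
  have ev0: "eventually A F0 \<longleftrightarrow> (\<exists>x\<in>J. eventually A (principal {v. good x v}))" for A
    unfolding F0_def
  proof (rule eventually_INF_base)
    show "J \<noteq> {}" using J_ne by blast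
    fix x y assume xy: "x \<in> J" "y \<in> J"
    have "(fst x \<union> fst y, snd x \<union> snd y) \<in> J" using xy by (auto simp: J_def)
    moreover have "principal {v. good (fst x \<union> fst y, snd x \<union> snd y) v}
        \<le> inf (principal {v. good x v}) (principal {v. good y v})"
      by (auto simp: good_def case_prod_unfold)
    ultimately show "\<exists>z\<in>J. principal {v. good z v} \<le> inf (principal {v. good x v}) (principal {v. good y v})"
      by blast
  qed
  have "F0 \<noteq> bot"
  proof
    assume "F0 = bot"
    then have "eventually (\<lambda>v. False) F0" by simp
    then obtain S Y where x: "(S, Y) \<in> J" and no: "\<And>v. \<not> good (S, Y) v"
      unfolding ev0 eventually_principal by auto
    have SY: "finite S" "finite Y" "Y \<subseteq> X" "S \<subseteq> \<S>" using x by (auto simp: J_def)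
    obtain v where "range v \<subseteq> univ N" "\<forall>(P, h) \<in> S. P v \<longleftrightarrow> P (v \<circ> sub h)"
      "\<forall>t\<in>Y. holds N (q t) (map v (map Elt [0..<n] @ map (Row t 0) [0..<l t]))"
      "\<forall>t\<in>Y. \<not> holds N (q t) (map v (map Elt [0..<n] @ map (Row t 1) [0..<l t]))"
    proof (rule ex_finitely_indiscernible[OF str ict SY(1-3)])
      show "dfn K N UNIV P" "strict_mono (h t)" "(\<forall>t. h t 0 = 0) \<or> dfn K N (Vs 0 X) P"
        if "(P, h) \<in> S" for P h t
        using that SY(4) by (auto simp: \<S>_def)
    qed blast
    then have "good (S, Y) v" unfolding good_def by simp
    with no show False by blast
  qed
  then obtain F where F: "F \<le> F0" "ultra F" by (rule ex_ultra)
  have ev: "eventually (good x) F" if "x \<in> J" for x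
  proof (rule filter_leD[OF F(1)])
    show "eventually (good x) F0" unfolding ev0 eventually_principal using that by blast
  qed
  have ev_inv: "eventually P F \<longleftrightarrow> eventually (\<lambda>v. P (v \<circ> sub h)) F" if "(P, h) \<in> \<S>" for P h
  proof -
    have "({(P, h)}, {}) \<in> J" using that by (simp add: J_def)
    then have "eventually (\<lambda>v. P v \<longleftrightarrow> P (v \<circ> sub h)) F"
      by (rule eventually_mono[OF ev]) (simp add: good_def)
    then show ?thesis unfolding ultra_iff[OF F(2)] .
  qed
  have ev_row: "eventually (\<lambda>v. holds N (q t) (map v (map Elt [0..<n] @ map (Row t 0) [0..<l t])) \<and>
      \<not> holds N (q t) (map v (map Elt [0..<n] @ map (Row t 1) [0..<l t]))) F" if "t \<in> X" for t
  proof -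
    have "({}, {t}) \<in> J" using that by (simp add: J_def)
    then show ?thesis by (rule eventually_mono[OF ev]) (simp add: good_def del: map_append)
  qed
  interpret indisc K N F
  proof
    show "eventually (\<lambda>v. range v \<subseteq> univ N) F"
      by (rule eventually_mono[OF ev[OF J_ne]]) (simp add: good_def)
    show "eventually P F \<longleftrightarrow> eventually (\<lambda>v. P (v \<circ> sub h)) F"
      if "dfn K N UNIV P" "\<And>t. strict_mono (h t)" "\<And>t. h t 0 = 0" for P h
      by (rule ev_inv) (use that in \<open>simp add: \<S>_def\<close>)
  qed (rule str F(2))+
  have "inv 0 X"
    unfolding inv_def
  proof (intro allI impI)
    fix P h assume P: "dfn K N (Vs 0 X) P" and h: "\<forall>t :: 'k. strict_mono (h t :: int \<Rightarrow> int)"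
    have "dfn K N UNIV P" using dfn2_mono[OF P] by simp
    then show "eventually P F \<longleftrightarrow> eventually (\<lambda>v. P (v \<circ> sub h)) F"
      by (intro ev_inv) (use P h in \<open>simp add: \<S>_def\<close>)
  qed
  moreover have "q t \<in> formulas K (n + l t)" if "t \<in> X" for t
    using ict that unfolding ict_def by (elim conjE) (rule bspec)
  moreover have "eventually (\<lambda>v. holds N (q t) (map v (map Elt [0..<n] @ map (Row t 0) [0..<l t]))) F"
    if "t \<in> X" for t
    by (rule eventually_mono[OF ev_row[OF that]]) (rule conjunct1)
  moreover have "\<not> eventually (\<lambda>v. holds N (q t) (map v (map Elt [0..<n] @ map (Row t 1) [0..<l t]))) F"
    if "t \<in> X" for t
    unfolding ultra_not[OF F(2), symmetric]
    by (rule eventually_mono[OF ev_row[OF that]]) (rule conjunct2)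
  ultimately obtain c q' l' where "\<forall>t\<in>X. c t < n" "\<forall>j. ict K N 1 {t \<in> X. c t = j} q' l'"
    by (rule split_pattern)
  then show ?thesis by (rule that)
qed

lemma ict_reindex:
  fixes g :: "'k \<Rightarrow> 'm"
  assumes ict: "ict K N n X q l" and g: "inj_on g Y" "g ` Y \<subseteq> X"
  shows "ict K N n Y (q \<circ> g) (l \<circ> g)"
  unfolding ict_def
proof (intro conjI ballI allI impI)
  show "(q \<circ> g) t \<in> formulas K (n + (l \<circ> g) t)" if "t \<in> Y" for t
  proof -
    have "g t \<in> X" using g(2) that by blast
    then show ?thesis using conjunct1[OF ict[unfolded ict_def]] by simp
  qed
  fix E :: "'k set" and R :: nat assume E: "finite E \<and> E \<subseteq> Y"
  then have gE: "finite (g ` E) \<and> g ` E \<subseteq> X" using g(2) by auto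
  obtain b where b: "\<forall>t\<in>g ` E. \<forall>i. b t i \<in> tuples N (l t)"
    "\<forall>f \<in> g ` E \<rightarrow>\<^sub>E {..<R}. \<exists>a\<in>tuples N n. \<forall>t\<in>g ` E. \<forall>i<R. holds N (q t) (a @ b t i) \<longleftrightarrow> f t = i"
    using conjunct2[OF ict[unfolded ict_def], THEN spec, THEN spec, THEN mp, OF gE, of R]
    by (elim exE conjE)
  have injE: "inj_on g E" using E g(1) inj_on_subset by blast
  have "\<exists>a\<in>tuples N n. \<forall>t\<in>E. \<forall>i<R. holds N ((q \<circ> g) t) (a @ b (g t) i) \<longleftrightarrow> f t = i"
    if f: "f \<in> E \<rightarrow>\<^sub>E {..<R}" for f
  proof -
    define f' where "f' = (\<lambda>s\<in>g ` E. f (the_inv_into E g s))"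
    have f': "f' (g t) = f t" if "t \<in> E" for t
      using that injE by (simp add: f'_def the_inv_into_f_f)
    have "f' \<in> g ` E \<rightarrow>\<^sub>E {..<R}"
    proof (rule PiE_I)
      show "f' s \<in> {..<R}" if "s \<in> g ` E" for s
        using that f' f by (auto simp: PiE_iff)
      show "f' s = undefined" if "s \<notin> g ` E" for s
        unfolding f'_def restrict_def using that by (rule if_not_P)
    qed
    then obtain a where "a \<in> tuples N n"
      "\<forall>t\<in>g ` E. \<forall>i<R. holds N (q t) (a @ b t i) \<longleftrightarrow> f' t = i" using b(2) by blast
    then show ?thesis using f' by (intro bexI[of _ a]) auto
  qed
  then show "\<exists>b. (\<forall>t\<in>E. \<forall>i. b t i \<in> tuples N ((l \<circ> g) t)) \<and> (\<forall>f \<in> E \<rightarrow>\<^sub>E {..<R}. \<exists>a\<in>tuples N n.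
      \<forall>t\<in>E. \<forall>i<R. holds N ((q \<circ> g) t) (a @ b t i) \<longleftrightarrow> f t = i)"
    using b(1) by (intro exI[of _ "\<lambda>t. b (g t)"]) simp
qed

section \<open>Patterns and trace definitions\<close>

text \<open>The trace definition replaces the set defined by \<open>q t\<close> by an
  \<open>N\<close>-definable one, whose parameters \<open>cs t\<close> are appended to every entry
  of row \<open>t\<close>. The two agree only on images under \<open>\<tau>\<close>; this suffices
  because all entries and cutting elements of a finite pattern come from \<open>M\<close>.\<close>

theorem trace_definition_ict:
  fixes X :: "'k set"
  assumes trace: "trace_definition L M K N n \<tau>" and ict: "ict L M 1 X q l"
  obtains q' l' where "ict K N n X q' l'"
proof -
  have \<tau>: "length (\<tau> x) = n" "set (\<tau> x) \<subseteq> univ N" if "x \<in> univ M" for x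
    using trace that unfolding trace_definition_def tuples_def by auto
  have len: "length (concat (map \<tau> xs)) = length xs * n" if "set xs \<subseteq> univ M" for xs
    using that by (induction xs) (auto simp: \<tau>(1))
  have "\<exists>p cs. set cs \<subseteq> univ N \<and> p \<in> formulas K (Suc (l t) * n + length cs) \<and>
      (\<forall>xs \<in> tuples M (Suc (l t)). holds M (q t) xs \<longleftrightarrow> holds N p (concat (map \<tau> xs) @ cs))"
    if t: "t \<in> X" for t
  proof -
    let ?X = "{xs \<in> tuples M (Suc (l t)). holds M (q t) xs}"
    have "q t \<in> formulas L (Suc (l t))" using conjunct1[OF ict[unfolded ict_def]] t by simp
    then have "definable L M (Suc (l t)) ?X"
      unfolding definable_def by (intro exI[of _ "q t"] exI[of _ "[]"]) simp
    then have "1 \<le> Suc (l t) \<and> definable L M (Suc (l t)) ?X" by simp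
    then have "\<exists>Y. definable K N (Suc (l t) * n) Y \<and>
        ?X = {xs \<in> tuples M (Suc (l t)). concat (map \<tau> xs) \<in> Y}"
      using trace[unfolded trace_definition_def, THEN conjunct2, THEN conjunct2, THEN spec, THEN spec, THEN mp]
      by blast
    then obtain Y where Y: "definable K N (Suc (l t) * n) Y"
      "?X = {xs \<in> tuples M (Suc (l t)). concat (map \<tau> xs) \<in> Y}"
      by (elim exE conjE)
    obtain p cs where p: "set cs \<subseteq> univ N" "p \<in> formulas K (Suc (l t) * n + length cs)"
      "Y = {xs \<in> tuples N (Suc (l t) * n). holds N p (xs @ cs)}"
      using Y(1) unfolding definable_def by blast
    have "holds M (q t) xs \<longleftrightarrow> holds N p (concat (map \<tau> xs) @ cs)"
      if xs: "xs \<in> tuples M (Suc (l t))" for xs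
    proof -
      have "length (concat (map \<tau> xs)) = Suc (l t) * n"
        using xs len[of xs] by (simp add: tuples_def)
      moreover have "set (concat (map \<tau> xs)) \<subseteq> univ N" using xs \<tau>(2) by (auto simp: tuples_def)
      ultimately have "concat (map \<tau> xs) \<in> tuples N (Suc (l t) * n)" by (simp add: tuples_def)
      then have "concat (map \<tau> xs) \<in> Y \<longleftrightarrow> holds N p (concat (map \<tau> xs) @ cs)"
        unfolding p(3) by blast
      moreover have "xs \<in> ?X \<longleftrightarrow> concat (map \<tau> xs) \<in> Y" unfolding Y(2) using xs by blast
      ultimately show ?thesis using xs by blast
    qed
    then show ?thesis using p(1,2) by blast
  qed
  then obtain p cs where p: "\<And>t. t \<in> X \<Longrightarrow> set (cs t) \<subseteq> univ N"
    "\<And>t. t \<in> X \<Longrightarrow> p t \<in> formulas K (Suc (l t) * n + length (cs t))"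
    "\<And>t xs. t \<in> X \<Longrightarrow> xs \<in> tuples M (Suc (l t)) \<Longrightarrow>
       holds M (q t) xs \<longleftrightarrow> holds N (p t) (concat (map \<tau> xs) @ cs t)"
    by metis
  define l' where "l' = (\<lambda>t. l t * n + length (cs t))"
  have "ict K N n X p l'"
    unfolding ict_def
  proof (intro conjI ballI allI impI)
    show "p t \<in> formulas K (n + l' t)" if "t \<in> X" for t
      using p(2)[OF that] by (simp add: l'_def add.assoc)
    fix E :: "'k set" and R :: nat assume E: "finite E \<and> E \<subseteq> X"
    obtain b where b: "\<forall>t\<in>E. \<forall>i. b t i \<in> tuples M (l t)"
      "\<forall>f \<in> E \<rightarrow>\<^sub>E {..<R}. \<exists>a\<in>tuples M 1. \<forall>t\<in>E. \<forall>i<R. holds M (q t) (a @ b t i) \<longleftrightarrow> f t = i"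
      using conjunct2[OF ict[unfolded ict_def], THEN spec, THEN spec, THEN mp, OF E, of R]
      by (elim exE conjE)
    define b' where "b' = (\<lambda>t i. concat (map \<tau> (b t i)) @ cs t)"
    have "b' t i \<in> tuples N (l' t)" if "t \<in> E" for t i
    proof -
      have bt: "b t i \<in> tuples M (l t)" using b(1) that by blast
      then have "length (concat (map \<tau> (b t i))) = l t * n"
        using len[of "b t i"] by (simp add: tuples_def)
      moreover have "set (concat (map \<tau> (b t i))) \<subseteq> univ N" using bt \<tau>(2) by (auto simp: tuples_def)
      moreover have "set (cs t) \<subseteq> univ N" using p(1) E that by blast
      ultimately show ?thesis by (simp add: tuples_def b'_def l'_def)
    qed
    moreover have "\<exists>a\<in>tuples N n. \<forall>t\<in>E. \<forall>i<R. holds N (p t) (a @ b' t i) \<longleftrightarrow> f t = i"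
      if "f \<in> E \<rightarrow>\<^sub>E {..<R}" for f
    proof -
      obtain a where a: "a \<in> tuples M 1" "\<forall>t\<in>E. \<forall>i<R. holds M (q t) (a @ b t i) \<longleftrightarrow> f t = i"
        using b(2) \<open>f \<in> E \<rightarrow>\<^sub>E {..<R}\<close> by blast
      obtain x where x: "a = [x]" "x \<in> univ M" using a(1) by (auto simp: tuples_def length_Suc_conv)
      have "holds N (p t) (\<tau> x @ b' t i) \<longleftrightarrow> f t = i" if ti: "t \<in> E" "i < R" for t i
      proof -
        have "b t i \<in> tuples M (l t)" using b(1) ti(1) by blast
        then have "x # b t i \<in> tuples M (Suc (l t))" using x(2) by (simp add: tuples_def)
        moreover have "t \<in> X" using ti(1) E by blast
        ultimately have "holds M (q t) (x # b t i) \<longleftrightarrow> holds N (p t) (concat (map \<tau> (x # b t i)) @ cs t)"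
          using p(3) by blast
        then show ?thesis using a(2) ti x(1) by (simp add: b'_def)
      qed
      moreover have "\<tau> x \<in> tuples N n" using \<tau>[OF x(2)] by (simp add: tuples_def)
      ultimately show ?thesis by blast
    qed
    ultimately show "\<exists>b. (\<forall>t\<in>E. \<forall>i. b t i \<in> tuples N (l' t)) \<and> (\<forall>f \<in> E \<rightarrow>\<^sub>E {..<R}. \<exists>a\<in>tuples N n.
        \<forall>t\<in>E. \<forall>i<R. holds N (p t) (a @ b t i) \<longleftrightarrow> f t = i)"
      by (intro exI[of _ b']) simp
  qed
  then show ?thesis by (rule that)
qed

section \<open>Coding formulas in an infinite type\<close>

lemma ex_inj_pair:
  assumes "infinite (UNIV :: 'x set)"
  obtains pr :: "'x \<times> 'x \<Rightarrow> 'x" where "inj pr"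
proof -
  have "|(UNIV :: 'x set) \<times> (UNIV :: 'x set)| =o |UNIV :: 'x set|"
    by (rule card_of_Times_same_infinite[OF assms])
  then obtain f :: "'x \<times> 'x \<Rightarrow> 'x" where "bij_betw f (UNIV \<times> UNIV) UNIV"
    unfolding card_of_ordIso[symmetric] by blast
  then show ?thesis using that[of f] by (simp add: bij_betw_def)
qed

primrec code_list :: "('x \<times> 'x \<Rightarrow> 'x) \<Rightarrow> 'x \<Rightarrow> 'x list \<Rightarrow> 'x" where
  "code_list pr z [] = z"
| "code_list pr z (x # xs) = pr (x, code_list pr z xs)"

lemma code_list_inj:
  assumes "inj pr"
  shows "length xs = length ys \<Longrightarrow> code_list pr z xs = code_list pr z ys \<Longrightarrow> xs = ys"
proof (induction xs arbitrary: ys)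
  case (Cons x xs)
  then obtain y ys' where ys: "ys = y # ys'" by (cases ys) auto
  then have "x = y" "code_list pr z xs = code_list pr z ys'"
    using Cons.prems(2) injD[OF assms, of "(x, code_list pr z xs)" "(y, code_list pr z ys')"] by auto
  then show ?case using Cons ys by simp
qed simp

lemma ex_inj_list:
  assumes "infinite (UNIV :: 'x set)"
  obtains ls :: "'x list \<Rightarrow> 'x" where "inj ls"
proof -
  obtain pr :: "'x \<times> 'x \<Rightarrow> 'x" where pr: "inj pr" using assms by (rule ex_inj_pair)
  obtain nt :: "nat \<Rightarrow> 'x" where nt: "inj nt" using infinite_countable_subset[OF assms] by blast
  show ?thesis
  proof (rule that, rule injI)
    fix xs ys :: "'x list"
    assume eq: "pr (nt (length xs), code_list pr (nt 0) xs) = pr (nt (length ys), code_list pr (nt 0) ys)"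
    have "(nt (length xs), code_list pr (nt 0) xs) = (nt (length ys), code_list pr (nt 0) ys)"
      using pr eq by (rule injD)
    then have "length xs = length ys" "code_list pr (nt 0) xs = code_list pr (nt 0) ys"
      using nt by (auto simp: inj_eq)
    then show "xs = ys" by (rule code_list_inj[OF pr])
  qed
qed

text \<open>Goedel coding with values in an infinite type; the numerals mark the constructors. Its
  purpose is to bound the number of formulas by the size of \<open>'x\<close>.\<close>

primrec code_term ::
  "('f \<Rightarrow> 'x) \<Rightarrow> (nat \<Rightarrow> 'x) \<Rightarrow> ('x \<times> 'x \<Rightarrow> 'x) \<Rightarrow> ('x list \<Rightarrow> 'x) \<Rightarrow> 'f fo_term \<Rightarrow> 'x" where
  "code_term ft nt pr ls (Var i) = pr (nt 0, nt i)"
| "code_term ft nt pr ls (Fn f ts) = pr (nt 1, pr (ft f, ls (map (code_term ft nt pr ls) ts)))"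

primrec code_formula ::
  "('f \<Rightarrow> 'x) \<Rightarrow> ('r \<Rightarrow> 'x) \<Rightarrow> (nat \<Rightarrow> 'x) \<Rightarrow> ('x \<times> 'x \<Rightarrow> 'x) \<Rightarrow> ('x list \<Rightarrow> 'x)
     \<Rightarrow> ('f, 'r) fo_formula \<Rightarrow> 'x" where
  "code_formula ft rt nt pr ls (Eq s t) =
     pr (nt 0, pr (code_term ft nt pr ls s, code_term ft nt pr ls t))"
| "code_formula ft rt nt pr ls (Rel r ts) =
     pr (nt 1, pr (rt r, ls (map (code_term ft nt pr ls) ts)))"
| "code_formula ft rt nt pr ls (Neg p) = pr (nt 2, code_formula ft rt nt pr ls p)"
| "code_formula ft rt nt pr ls (Conj p q) =
     pr (nt 3, pr (code_formula ft rt nt pr ls p, code_formula ft rt nt pr ls q))"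
| "code_formula ft rt nt pr ls (Ex i p) = pr (nt 4, pr (nt i, code_formula ft rt nt pr ls p))"

lemma map_eq_imp_eq:
  "(\<And>x y. x \<in> set xs \<Longrightarrow> f x = f y \<Longrightarrow> x = y) \<Longrightarrow> map f xs = map f ys \<Longrightarrow> xs = ys"
proof (induction xs arbitrary: ys)
  case (Cons x xs)
  then obtain y ys' where ys: "ys = y # ys'" by (cases ys) auto
  then have "x = y" using Cons.prems(1)[of x y] Cons.prems(2) by simp
  moreover have "xs = ys'"
    by (rule Cons.IH) (use Cons.prems ys in auto)
  ultimately show ?case using ys by simp
qed simp

context
  fixes ft :: "'f \<Rightarrow> 'x" and rt :: "'r \<Rightarrow> 'x" and nt :: "nat \<Rightarrow> 'x"
    and pr :: "'x \<times> 'x \<Rightarrow> 'x" and ls :: "'x list \<Rightarrow> 'x"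
  assumes inj: "inj ft" "inj rt" "inj nt" "inj pr" "inj ls"
begin

lemma code_eq_iff: "ft x = ft x' \<longleftrightarrow> x = x'" "rt r = rt r' \<longleftrightarrow> r = r'" "nt i = nt i' \<longleftrightarrow> i = i'"
  "pr a = pr a' \<longleftrightarrow> a = a'" "ls as = ls as' \<longleftrightarrow> as = as'"
  using inj by (simp_all add: inj_eq)

lemma code_term_inj: "code_term ft nt pr ls s = code_term ft nt pr ls t \<Longrightarrow> s = t"
proof (induction s arbitrary: t)
  case (Var i)
  then show ?case by (cases t) (simp_all add: code_eq_iff)
next
  case (Fn f ts)
  then obtain us where t: "t = Fn f us" "map (code_term ft nt pr ls) ts = map (code_term ft nt pr ls) us"
    by (cases t) (simp_all add: code_eq_iff)
  have "ts = us" by (rule map_eq_imp_eq[OF _ t(2)]) (rule Fn.IH)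
  then show ?case using t(1) by simp
qed

lemma code_formula_inj: "inj (code_formula ft rt nt pr ls)"
proof (rule injI)
  show "code_formula ft rt nt pr ls p = code_formula ft rt nt pr ls q \<Longrightarrow> p = q" for p q
  proof (induction p arbitrary: q)
    case (Eq s t)
    then show ?case by (cases q) (auto simp: code_eq_iff dest: code_term_inj)
  next
    case (Rel r ts)
    then obtain us where q: "q = Rel r us" "map (code_term ft nt pr ls) ts = map (code_term ft nt pr ls) us"
      by (cases q) (simp_all add: code_eq_iff)
    have "ts = us" by (rule map_eq_imp_eq[OF _ q(2)]) (rule code_term_inj)
    then show ?case using q(1) by simp
  next
    case (Neg p)
    then show ?case by (cases q) (auto simp: code_eq_iff)
  next
    case (Conj p p')
    then show ?case by (cases q) (auto simp: code_eq_iff)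
  next
    case (Ex i p)
    then show ?case by (cases q) (auto simp: code_eq_iff)
  qed
qed

end

text \<open>This is the cardinal arithmetic behind the power type: families indexed by
  \<open>'t\<close> of elements of \<open>'t set\<close> are again coded in \<open>'t set\<close>,
  by gathering pairs of an index and a member. The tags \<open>UNIV\<close> and \<open>{}\<close>
  keep \<open>base\<close> and \<open>wit\<close> disjoint.\<close>

lemma ex_inj_constants:
  fixes ft :: "'f \<Rightarrow> 't" and rt :: "'r \<Rightarrow> 't" and vt :: "'v \<Rightarrow> 't"
  assumes inf: "infinite (UNIV :: 't set)" and inj: "inj ft" "inj rt" "inj vt"
  obtains base :: "'v \<Rightarrow> 't set" and wit :: "('t \<Rightarrow> ('f, 'r) fo_formula \<times> 't set list) \<Rightarrow> 't set"
    and code :: "('f, 'r) fo_formula \<times> 't list \<Rightarrow> 't"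
  where "inj base" "inj wit" "range base \<inter> range wit = {}" "inj code"
proof -
  obtain pr :: "'t \<times> 't \<Rightarrow> 't" where pr: "inj pr" using inf by (rule ex_inj_pair)
  obtain ls :: "'t list \<Rightarrow> 't" where ls: "inj ls" using inf by (rule ex_inj_list)
  obtain nt :: "nat \<Rightarrow> 't" where nt: "inj nt" using infinite_countable_subset[OF inf] by blast
  define e where "e = code_formula ft rt nt pr ls"
  have e: "inj e" unfolding e_def by (rule code_formula_inj[OF inj(1,2) nt pr ls])
  have "finite (Pow (UNIV :: 't set)) \<longleftrightarrow> finite (UNIV :: 't set)" by (rule finite_Pow_iff)
  then have inf': "infinite (UNIV :: 't set set)" using inf by simp
  obtain pr' :: "'t set \<times> 't set \<Rightarrow> 't set" where pr': "inj pr'" using inf' by (rule ex_inj_pair)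
  obtain ls' :: "'t set list \<Rightarrow> 't set" where ls': "inj ls'" using inf' by (rule ex_inj_list)
  define entry where "entry = (\<lambda>x :: ('f, 'r) fo_formula \<times> 't set list. pr' ({e (fst x)}, ls' (snd x)))"
  have entry: "entry x = entry y \<longleftrightarrow> x = y" for x y
    using pr' ls' e by (auto simp: entry_def inj_eq prod_eq_iff)
  define fam where "fam = (\<lambda>g :: 't \<Rightarrow> 't set. {pr (i, y) | i y. y \<in> g i})"
  have mem: "pr (i, y) \<in> fam g \<longleftrightarrow> y \<in> g i" for i y g
    using pr by (auto simp: fam_def inj_eq)
  have fam: "g = g'" if "fam g = fam g'" for g g'
  proof (intro ext set_eqI)
    show "y \<in> g i \<longleftrightarrow> y \<in> g' i" for i y using mem[of i y g] mem[of i y g'] that by simp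
  qed
  define wit where "wit = (\<lambda>g. pr' ({}, fam (\<lambda>i. entry (g i))))"
  define base where "base = (\<lambda>x. pr' (UNIV, {vt x}))"
  show ?thesis
  proof (rule that[of base wit "\<lambda>x. pr (e (fst x), ls (snd x))"])
    show "inj base" using pr' inj(3) by (auto simp: base_def inj_eq intro!: injI)
    show "inj wit"
    proof (rule injI)
      fix g g' assume "wit g = wit g'"
      then have "fam (\<lambda>i. entry (g i)) = fam (\<lambda>i. entry (g' i))"
        using pr' by (simp add: wit_def inj_eq)
      then have "(\<lambda>i. entry (g i)) = (\<lambda>i. entry (g' i))" by (rule fam)
      then show "g = g'" using entry by (simp add: fun_eq_iff)
    qed
    show "range base \<inter> range wit = {}" using pr' by (auto simp: base_def wit_def inj_eq)
    show "inj (\<lambda>x. pr (e (fst x), ls (snd x)))"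
      using pr e ls by (intro injI) (auto simp: inj_eq prod_eq_iff)
  qed
qed

section \<open>Dp-rank and finite patterns\<close>

text \<open>That a finite part of the pattern exists is a first-order sentence. It is true in the
  extension, hence true in \<open>M\<close>.\<close>

theorem ict_of_dp_rank_ge:
  fixes M :: "('a, 'f, 'r) fo_structure" and \<kappa> :: "'k rel"
  assumes str: "is_structure L M" and rank: "dp_rank_ge L M \<kappa>"
  obtains q l where "ict L M 1 (Field \<kappa>) q l"
proof -
  obtain M' :: "(('a, 'f, 'r, 'k) small set, 'f, 'r) fo_structure" and e
    where M': "is_structure L M'" "elementary_embedding L M M' e" "dp_pattern L M' \<kappa>"
    using rank unfolding dp_rank_ge_def by (elim exE conjE)
  obtain l q b where q: "\<forall>t \<in> Field \<kappa>. q t \<in> formulas L (Suc (l t))"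
    and b: "\<forall>t \<in> Field \<kappa>. \<forall>i. b t i \<in> tuples M' (l t)"
    and cut: "\<forall>f :: 'k \<Rightarrow> nat. \<exists>a \<in> univ M'. \<forall>t \<in> Field \<kappa>. \<forall>i. holds M' (q t) (a # b t i) \<longleftrightarrow> f t = i"
    using M'(3) unfolding dp_pattern_def by (elim exE conjE)
  obtain u where u: "u \<in> univ M" using str by (auto simp: is_structure_def)
  have ne: "univ M \<noteq> {}" "univ M' \<noteq> {}" using str M'(1) by (auto simp: is_structure_def)
  have "ict L M 1 (Field \<kappa>) q l"
    unfolding ict_def
  proof (intro conjI ballI allI impI)
    show "q t \<in> formulas L (1 + l t)" if "t \<in> Field \<kappa>" for t using q that by simp
    fix E :: "'k set" and R :: nat assume E: "finite E \<and> E \<subseteq> Field \<kappa>"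
    \<comment> \<open>\<open>None\<close> is the variable for the cutting element and
      \<open>Some (t, i, c)\<close> the one for component \<open>c\<close> of entry \<open>i\<close>
      in row \<open>t\<close>. Quantifying both away leaves a predicate without free
      variables.\<close>
    define W where "W = Some ` (SIGMA t:E. {..<R} \<times> {..<l t})"
    have W: "finite W" unfolding W_def using E by (intro finite_imageI finite_SigmaI) auto
    define ys where "ys = (\<lambda>(t :: 'k) (i :: nat). map (\<lambda>c. Some (t, i, c)) [0..<l t])"
    have ysW: "set (ys t i) \<subseteq> W" if "t \<in> E" "i \<in> {..<R}" for t i
      using that by (auto simp: ys_def W_def)
    have entry: "dfn2 L M M' (insert None W) (\<lambda>v. holds M (q t) (map v (None # ys t i)))
        (\<lambda>v. holds M' (q t) (map v (None # ys t i)))" if "t \<in> E" "i \<in> {..<R}" for t i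
    proof (rule dfn2_holds)
      have "t \<in> Field \<kappa>" using E that(1) by blast
      then show "q t \<in> formulas L (length (None # ys t i))" using q by (simp add: ys_def)
      show "set (None # ys t i) \<subseteq> insert None W" using ysW[OF that] by auto
    qed
    let ?\<Phi> = "\<lambda>S v. \<forall>f \<in> E \<rightarrow>\<^sub>E {..<R}. \<exists>a\<in>univ S. \<forall>t\<in>E. \<forall>i\<in>{..<R}.
        holds S (q t) (map (v(None := a)) (None # ys t i)) \<longleftrightarrow> f t = i"
    have "finite (E \<rightarrow>\<^sub>E {..<R})" using E by (intro finite_PiE) auto
    then have "dfn2 L M M' (insert None W - {None}) (?\<Phi> M) (?\<Phi> M')"
      by (intro dfn2_Ball[OF ne] dfn2_Ex dfn2_iff dfn2_const[OF ne] entry) (use E in auto)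
    from dfn2_Ex_set[OF W this]
    have dfn: "dfn2 L M M' (insert None W - {None} - W)
        (\<lambda>v. \<exists>w. w ` W \<subseteq> univ M \<and> ?\<Phi> M (\<lambda>x. if x \<in> W then w x else v x))
        (\<lambda>v. \<exists>w. w ` W \<subseteq> univ M' \<and> ?\<Phi> M' (\<lambda>x. if x \<in> W then w x else v x))" .
    define w' where "w' = (\<lambda>x. case x of None \<Rightarrow> undefined | Some (t, i, c) \<Rightarrow> b t i ! c)"
    have "w' ` W \<subseteq> univ M'"
    proof
      fix x assume "x \<in> w' ` W"
      then obtain t i c where "t \<in> E" "c < l t" "x = b t i ! c" by (auto simp: W_def w'_def)
      moreover then have "b t i \<in> tuples M' (l t)" using b E by blast
      ultimately show "x \<in> univ M'" using nth_mem[of c "b t i"] by (auto simp: tuples_def)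
    qed
    moreover have "?\<Phi> M' (\<lambda>x. if x \<in> W then w' x else (e \<circ> (\<lambda>_. u)) x)"
    proof
      fix f assume "f \<in> E \<rightarrow>\<^sub>E {..<R}"
      obtain a where a: "a \<in> univ M'" "\<forall>t \<in> Field \<kappa>. \<forall>i. holds M' (q t) (a # b t i) \<longleftrightarrow> f t = i"
        using cut by blast
      have "map ((\<lambda>x. if x \<in> W then w' x else (e \<circ> (\<lambda>_. u)) x)(None := a)) (None # ys t i) = a # b t i"
        if "t \<in> E" "i \<in> {..<R}" for t i
      proof -
        have "b t i \<in> tuples M' (l t)" using b E that by blast
        then show ?thesis
          using that by (auto simp: ys_def W_def w'_def tuples_def intro!: nth_equalityI)
      qed
      then show "\<exists>a\<in>univ M'. \<forall>t\<in>E. \<forall>i\<in>{..<R}. holds M' (q t)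
          (map ((\<lambda>x. if x \<in> W then w' x else (e \<circ> (\<lambda>_. u)) x)(None := a)) (None # ys t i)) \<longleftrightarrow> f t = i"
        using a E by (intro bexI[of _ a] ballI) (simp_all only: subset_iff)
    qed
    ultimately have "\<exists>w. w ` W \<subseteq> univ M' \<and> ?\<Phi> M' (\<lambda>x. if x \<in> W then w x else (e \<circ> (\<lambda>_. u)) x)"
      by (intro exI[of _ w'] conjI)
    then have "\<exists>w. w ` W \<subseteq> univ M \<and> ?\<Phi> M (\<lambda>x. if x \<in> W then w x else u)"
      using elementary_embedding_dfn2[OF M'(2) dfn, of "\<lambda>_. u"] u by simp
    then obtain w where w: "w ` W \<subseteq> univ M" "?\<Phi> M (\<lambda>x. if x \<in> W then w x else u)" by (elim exE conjE)
    define v where "v = (\<lambda>x. if x \<in> W then w x else u)"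
    have v: "v x \<in> univ M" for x using w(1) u by (auto simp: v_def)
    have upd: "map (v(None := a)) (None # ys t i) = a # map v (ys t i)" for a t i
      by (simp add: ys_def)
    show "\<exists>b. (\<forall>t\<in>E. \<forall>i. b t i \<in> tuples M (l t)) \<and>
        (\<forall>f \<in> E \<rightarrow>\<^sub>E {..<R}. \<exists>a\<in>tuples M 1. \<forall>t\<in>E. \<forall>i<R. holds M (q t) (a @ b t i) \<longleftrightarrow> f t = i)"
    proof (intro exI[of _ "\<lambda>t i. map v (ys t i)"] conjI ballI allI)
      show "map v (ys t i) \<in> tuples M (l t)" for t i using v by (auto simp: tuples_def ys_def)
      fix f assume "f \<in> E \<rightarrow>\<^sub>E {..<R}"
      then obtain a where "a \<in> univ M" "\<forall>t\<in>E. \<forall>i\<in>{..<R}. holds M (q t) (a # map v (ys t i)) \<longleftrightarrow> f t = i"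
        using w(2)[folded v_def] unfolding upd by blast
      then show "\<exists>a\<in>tuples M 1. \<forall>t\<in>E. \<forall>i<R. holds M (q t) (a @ map v (ys t i)) \<longleftrightarrow> f t = i"
        by (intro bexI[of _ "[a]"]) (auto simp: tuples_def)
    qed
  qed
  then show ?thesis by (rule that)
qed

text \<open>Compactness: assignments carrying ever larger finite patterns generate a filter, and the
  saturated model built over it contains the whole array. For each \<open>f\<close>, the type of an
  element cutting along \<open>f\<close> is finitely satisfiable in the good assignments, so it is
  realized. The variables \<open>Inl a\<close> name the elements of \<open>N\<close> and yield the
  embedding.\<close>

theorem dp_rank_ge_of_ict:
  fixes N :: "('b, 'g, 's) fo_structure" and \<kappa> :: "'k rel"
  assumes str: "is_structure K N" and ict: "ict K N 1 (Field \<kappa>) q l"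
  shows "dp_rank_ge K N \<kappa>"
proof -
  obtain u0 where u0: "u0 \<in> univ N" using str by (auto simp: is_structure_def)
  define row where "row = (\<lambda>(t :: 'k) (i :: nat). map (\<lambda>c :: nat. Inr (t, i, c) :: 'b + 'k \<times> nat \<times> nat) [0..<l t])"
  define good where "good = (\<lambda>(E, R :: nat) v. range v \<subseteq> univ N \<and> (\<forall>a\<in>univ N. v (Inl a) = a) \<and>
     (\<forall>f \<in> E \<rightarrow>\<^sub>E {..<R}. \<exists>a\<in>univ N. \<forall>t\<in>E. \<forall>i<R. holds N (q t) (a # map v (row t i)) \<longleftrightarrow> f t = i))"
  define J :: "('k set \<times> nat) set" where "J = {(E, R). finite E \<and> E \<subseteq> Field \<kappa>}"
  have good_mono: "good (E, R) v" if v: "good (E', R') v" and sub: "E \<subseteq> E'" "R \<le> R'" "0 < R'" for E R E' R' v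
  proof -
    have "\<exists>a\<in>univ N. \<forall>t\<in>E. \<forall>i<R. holds N (q t) (a # map v (row t i)) \<longleftrightarrow> f t = i"
      if f: "f \<in> E \<rightarrow>\<^sub>E {..<R}" for f
    proof -
      define f' where "f' = (\<lambda>t\<in>E'. if t \<in> E then f t else 0)"
      have "f' \<in> E' \<rightarrow>\<^sub>E {..<R'}"
        using f sub by (auto simp: f'_def PiE_iff intro: less_le_trans)
      then obtain a where a: "a \<in> univ N"
        "\<forall>t\<in>E'. \<forall>i<R'. holds N (q t) (a # map v (row t i)) \<longleftrightarrow> f' t = i"
        using v unfolding good_def by blast
      have "holds N (q t) (a # map v (row t i)) \<longleftrightarrow> f t = i" if "t \<in> E" "i < R" for t i
      proof -
        have "t \<in> E'" "i < R'" using that sub by auto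
        moreover from this have "f' t = f t" using that by (simp add: f'_def)
        ultimately show ?thesis using a(2) by metis
      qed
      then show ?thesis using a(1) by blast
    qed
    then show ?thesis using v unfolding good_def by simp
  qed
  define F0 where "F0 = (INF x\<in>J. principal {v. good x v})"
  have J_ne: "({}, 0) \<in> J" by (simp add: J_def)
  have ev0: "eventually A F0 \<longleftrightarrow> (\<exists>x\<in>J. eventually A (principal {v. good x v}))" for A
    unfolding F0_def
  proof (rule eventually_INF_base)
    show "J \<noteq> {}" using J_ne by blast
    fix x y assume xy: "x \<in> J" "y \<in> J"
    \<comment> \<open>\<open>Suc\<close> makes the common length positive: in
      \<open>good_mono\<close> a function on \<open>E\<close> is extended to the additional rows by
      the value 0.\<close>
    let ?z = "(fst x \<union> fst y, Suc (max (snd x) (snd y)))"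
    have "?z \<in> J" using xy by (auto simp: J_def)
    moreover have "good x v \<and> good y v" if "good ?z v" for v
      using good_mono[OF that, of "fst x" "snd x"] good_mono[OF that, of "fst y" "snd y"] by auto
    then have "principal {v. good ?z v} \<le> inf (principal {v. good x v}) (principal {v. good y v})"
      by auto
    ultimately show "\<exists>z\<in>J. principal {v. good z v} \<le> inf (principal {v. good x v}) (principal {v. good y v})"
      by blast
  qed
  have ev_good: "eventually (good x) F0" if "x \<in> J" for x
    unfolding ev0 eventually_principal using that by blast
  have F0: "F0 \<noteq> bot"
  proof
    assume "F0 = bot"
    then have "eventually (\<lambda>v. False) F0" by simp
    then obtain E R where x: "(E, R) \<in> J" and no: "\<And>v. \<not> good (E, R) v"
      unfolding ev0 eventually_principal by auto
    then have E: "finite E \<and> E \<subseteq> Field \<kappa>" by (simp add: J_def)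
    obtain b where b: "\<forall>t\<in>E. \<forall>i. b t i \<in> tuples N (l t)"
      "\<forall>f \<in> E \<rightarrow>\<^sub>E {..<R}. \<exists>a\<in>tuples N 1. \<forall>t\<in>E. \<forall>i<R. holds N (q t) (a @ b t i) \<longleftrightarrow> f t = i"
      using conjunct2[OF ict[unfolded ict_def], THEN spec, THEN spec, THEN mp, OF E, of R]
      by (elim exE conjE)
    define v where "v = (\<lambda>x. case x of Inl a \<Rightarrow> if a \<in> univ N then a else u0
       | Inr (t, i, c) \<Rightarrow> if t \<in> E \<and> c < l t then b t i ! c else u0)"
    have "v x \<in> univ N" for x
    proof (cases x)
      case (Inr y)
      obtain t i c where y: "y = (t, i, c)" by (cases y) auto
      show ?thesis
      proof (cases "t \<in> E \<and> c < l t")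
        case True
        then have "b t i \<in> tuples N (l t)" using b(1) by blast
        then have "b t i ! c \<in> univ N" using True nth_mem[of c "b t i"] by (auto simp: tuples_def)
        then show ?thesis using True Inr y by (simp add: v_def)
      next
        case False
        then show ?thesis using Inr y u0 by (auto simp: v_def)
      qed
    qed (use u0 in \<open>simp add: v_def\<close>)
    then have "range v \<subseteq> univ N" by blast
    moreover have "\<forall>a\<in>univ N. v (Inl a) = a" by (simp add: v_def)
    moreover have rowE: "map v (row t i) = b t i" if "t \<in> E" for t i
    proof -
      have "b t i \<in> tuples N (l t)" using b(1) that by blast
      then show ?thesis using that by (intro nth_equalityI) (auto simp: row_def v_def tuples_def)
    qed
    have "\<exists>a\<in>univ N. \<forall>t\<in>E. \<forall>i<R. holds N (q t) (a # map v (row t i)) \<longleftrightarrow> f t = i"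
      if f: "f \<in> E \<rightarrow>\<^sub>E {..<R}" for f
    proof -
      obtain a where a: "a \<in> tuples N 1" "\<forall>t\<in>E. \<forall>i<R. holds N (q t) (a @ b t i) \<longleftrightarrow> f t = i"
        using b(2) f by blast
      obtain x where x: "a = [x]" "x \<in> univ N" using a(1) by (auto simp: tuples_def length_Suc_conv)
      show ?thesis by (intro bexI[of _ x]) (use a(2) x rowE in auto)
    qed
    ultimately have "good (E, R) v" unfolding good_def by simp
    with no show False by blast
  qed
  define nt where "nt = (\<lambda>i :: nat. Inr (Inr (Inr (Inr i))) :: ('b, 'g, 's, 'k) small)"
  have nt: "inj nt" by (auto simp: nt_def inj_def)
  have inf: "infinite (UNIV :: ('b, 'g, 's, 'k) small set)"
    using range_inj_infinite[OF nt] by (rule infinite_super[OF subset_UNIV])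
  obtain pr :: "('b, 'g, 's, 'k) small \<times> ('b, 'g, 's, 'k) small \<Rightarrow> ('b, 'g, 's, 'k) small"
    where pr: "inj pr" using inf by (rule ex_inj_pair)
  define idx where "idx = (\<lambda>(t :: 'k, i :: nat). pr (Inr (Inr (Inr (Inl t))), nt i))"
  have idx: "inj idx" by (rule injI) (auto simp: idx_def inj_eq[OF pr] inj_eq[OF nt])
  define vt where "vt = (\<lambda>x :: 'b + 'k \<times> nat \<times> nat. case x of Inl a \<Rightarrow> pr (nt 0, Inl a)
     | Inr (t, i, c) \<Rightarrow> pr (nt 1, pr (idx (t, i), nt c)))"
  have vt: "inj vt"
    by (rule injI)
      (auto simp: vt_def inj_eq[OF pr] inj_eq[OF nt] inj_eq[OF idx] split: sum.splits)
  have inj_fr: "inj (\<lambda>f :: 'g. Inr (Inl f) :: ('b, 'g, 's, 'k) small)"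
    "inj (\<lambda>r :: 's. Inr (Inr (Inl r)) :: ('b, 'g, 's, 'k) small)" by (auto simp: inj_def)
  obtain base wit code
    where const: "inj (base :: 'b + 'k \<times> nat \<times> nat \<Rightarrow> ('b, 'g, 's, 'k) small set)"
    "inj (wit :: (('b, 'g, 's, 'k) small \<Rightarrow> ('g, 's) fo_formula \<times> ('b, 'g, 's, 'k) small set list)
        \<Rightarrow> ('b, 'g, 's, 'k) small set)"
    "range base \<inter> range wit = {}"
    "inj (code :: ('g, 's) fo_formula \<times> ('b, 'g, 's, 'k) small list \<Rightarrow> ('b, 'g, 's, 'k) small)"
    by (rule ex_inj_constants[OF inf inj_fr vt])
  have univ0: "eventually (\<lambda>v. range v \<subseteq> univ N) F0"
    by (rule eventually_mono[OF ev_good[OF J_ne]]) (simp add: good_def)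
  obtain N' :: "(('b, 'g, 's, 'k) small set, 'g, 's) fo_structure" and d
    where N': "is_structure K N'" "range d \<subseteq> univ N'"
      "saturated K N' (UNIV :: ('b, 'g, 's, 'k) small set)"
      and holds0: "\<forall>p xs. p \<in> formulas K (length xs) \<longrightarrow> eventually (\<lambda>v. holds N p (map v xs)) F0 \<longrightarrow>
        holds N' p (map d xs)"
      and realized0: "\<forall>g :: ('b, 'g, 's, 'k) small \<Rightarrow> ('g, 's) fo_formula \<times> ('b + 'k \<times> nat \<times> nat) list.
        (\<forall>i. fst (g i) \<in> formulas K (Suc (length (snd (g i))))) \<longrightarrow>
        (\<forall>J. finite J \<longrightarrow>
           eventually (\<lambda>v. \<exists>x\<in>univ N. \<forall>i\<in>J. holds N (fst (g i)) (x # map v (snd (g i)))) F0) \<longrightarrow>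
        (\<exists>a\<in>univ N'. \<forall>i. holds N' (fst (g i)) (a # map d (snd (g i))))"
    by (rule ex_saturated_model[OF str const F0 univ0])
  note holds = holds0[rule_format] and realized = realized0[rule_format]
  have d: "d x \<in> univ N'" for x using N'(2) by blast
  have "elementary_embedding K N N' (d \<circ> Inl)"
    unfolding elementary_embedding_def
  proof (intro conjI allI impI, goal_cases)
    case 1
    then show ?case using d by auto
  next
    case (2 xs p)
    then have xs: "set xs \<subseteq> univ N" and p: "p \<in> formulas K (length xs)" by auto
    have "eventually (\<lambda>v. map v (map Inl xs) = xs) F0"
      by (rule eventually_mono[OF ev_good[OF J_ne]]) (use xs in \<open>auto simp: good_def intro!: map_idI\<close>)
    then have ev: "eventually (\<lambda>v. holds N p' (map v (map Inl xs))) F0" if "holds N p' xs" for p'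
      by (rule eventually_mono) (use that in simp)
    have "holds N' p (map d (map Inl xs))" if "holds N p xs"
      by (rule holds[OF _ ev[OF that]]) (use p in simp)
    \<comment> \<open>\<open>holds0\<close> transfers truth in one direction only; applied to the
      negation it gives the converse.\<close>
    moreover have "holds N' (Neg p) (map d (map Inl xs))" if "\<not> holds N p xs"
      by (rule holds[OF _ ev]) (use p that in \<open>simp_all add: formulas_def holds_def\<close>)
    ultimately show ?case by (auto simp: holds_def)
  qed
  moreover have "dp_pattern K N' \<kappa>"
    unfolding dp_pattern_def
  proof (intro exI[of _ l] exI[of _ q] exI[of _ "\<lambda>t i. map d (row t i)"] conjI ballI allI)
    show q: "q t \<in> formulas K (Suc (l t))" if "t \<in> Field \<kappa>" for t
      using conjunct1[OF ict[unfolded ict_def]] that by simp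
    show "map d (row t i) \<in> tuples N' (l t)" for t i using d by (auto simp: tuples_def row_def)
    fix f :: "'k \<Rightarrow> nat"
    \<comment> \<open>The type of an element that cuts along \<open>f\<close>, listed by indices in
      the small type: \<open>idx\<close> places the condition on entry \<open>i\<close> of row
      \<open>t\<close>, and all other indices carry the trivial \<open>x = x\<close>.\<close>
    define g :: "('b, 'g, 's, 'k) small \<Rightarrow> ('g, 's) fo_formula \<times> ('b + 'k \<times> nat \<times> nat) list" where
      "g = (\<lambda>j. if j \<in> idx ` (Field \<kappa> \<times> UNIV)
         then case the_inv idx j of (t, i) \<Rightarrow> (if f t = i then q t else Neg (q t), row t i)
         else (Eq (Var 0) (Var 0), []))"
    have g: "g (idx (t, i)) = (if f t = i then q t else Neg (q t), row t i)" if "t \<in> Field \<kappa>" for t i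
      using that idx by (auto simp: g_def the_inv_f_f)
    have g_cases: "(\<exists>t i. t \<in> Field \<kappa> \<and> j = idx (t, i)) \<or> g j = (Eq (Var 0) (Var 0), [])" for j
      by (cases "j \<in> idx ` (Field \<kappa> \<times> UNIV)") (auto simp: g_def)
    have "\<exists>a\<in>univ N'. \<forall>j. holds N' (fst (g j)) (a # map d (snd (g j)))"
    proof (rule realized)
      show "fst (g j) \<in> formulas K (Suc (length (snd (g j))))" for j
        using g_cases[of j]
      proof
        assume "\<exists>t i. t \<in> Field \<kappa> \<and> j = idx (t, i)"
        then obtain t i where t: "t \<in> Field \<kappa>" "j = idx (t, i)" by blast
        then show ?thesis using q[OF t(1)] g[OF t(1), of i] by (simp add: row_def formulas_def)
      qed (simp add: formulas_def)
      fix I :: "('b, 'g, 's, 'k) small set" assume I: "finite I"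
      define I' where "I' = idx -` I"
      have I': "finite I'" unfolding I'_def by (rule finite_vimageI[OF I idx])
      define E where "E = fst ` I' \<inter> Field \<kappa>"
      \<comment> \<open>\<open>R\<close> exceeds the entries mentioned by the finitely many
        conditions and also the values of \<open>f\<close> on \<open>E\<close>, so that
        \<open>f\<close> restricted to \<open>E\<close> is a legitimate choice.\<close>
      define R where "R = Suc (Max (insert 0 (snd ` I' \<union> f ` E)))"
      have E: "(E, R) \<in> J" using I' by (auto simp: J_def E_def)
      have fin: "finite (insert 0 (snd ` I' \<union> f ` E))" using I' by (auto simp: E_def)
      have bound: "k < R" if "k \<in> snd ` I' \<union> f ` E" for k
        unfolding R_def less_Suc_eq_le using that fin by (intro Max_ge) auto
      have f: "restrict f E \<in> E \<rightarrow>\<^sub>E {..<R}" using bound by auto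
      show "eventually (\<lambda>v. \<exists>x\<in>univ N. \<forall>j\<in>I. holds N (fst (g j)) (x # map v (snd (g j)))) F0"
      proof (rule eventually_mono[OF ev_good[OF E]])
        fix v assume "good (E, R) v"
        then obtain a where a: "a \<in> univ N"
          "\<forall>t\<in>E. \<forall>i<R. holds N (q t) (a # map v (row t i)) \<longleftrightarrow> restrict f E t = i"
          using f unfolding good_def by blast
        have "holds N (fst (g j)) (a # map v (snd (g j)))" if "j \<in> I" for j
          using g_cases[of j]
        proof
          assume "\<exists>t i. t \<in> Field \<kappa> \<and> j = idx (t, i)"
          then obtain t i where t: "t \<in> Field \<kappa>" "j = idx (t, i)" by blast
          then have ti: "(t, i) \<in> I'" using that by (simp add: I'_def)
          then have "t \<in> E" using t(1) by (force simp: E_def)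
          moreover have "i < R" using bound ti by force
          ultimately have "holds N (q t) (a # map v (row t i)) \<longleftrightarrow> f t = i" using a(2) by simp
          then show ?thesis using g[OF t(1), of i] t(2) by (simp add: holds_def)
        qed (simp add: holds_def)
        then show "\<exists>x\<in>univ N. \<forall>j\<in>I. holds N (fst (g j)) (x # map v (snd (g j)))" using a(1) by blast
      qed
    qed
    then obtain a where a: "a \<in> univ N'" "\<forall>j. holds N' (fst (g j)) (a # map d (snd (g j)))" by blast
    have "holds N' (q t) (a # map d (row t i)) \<longleftrightarrow> f t = i" if "t \<in> Field \<kappa>" for t i
      using spec[OF a(2), of "idx (t, i)"] g[OF that, of i] by (simp add: holds_def split: if_splits)
    then show "\<exists>a\<in>univ N'. \<forall>t\<in>Field \<kappa>. \<forall>i. holds N' (q t) (a # map d (row t i)) \<longleftrightarrow> f t = i"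
      using a(1) by blast
  qed
  ultimately show ?thesis unfolding dp_rank_ge_def using N'(1,3) by blast
qed

section \<open>Rank inequalities for finite and infinite depth\<close>

lemma dp_rank_ge_iff:
  assumes "is_structure K N"
  shows "dp_rank_ge K N \<kappa> \<longleftrightarrow> (\<exists>q l. ict K N 1 (Field \<kappa>) q l)"
proof
  assume "dp_rank_ge K N \<kappa>"
  then obtain q l where "ict K N 1 (Field \<kappa>) q l" by (rule ict_of_dp_rank_ge[OF assms])
  then show "\<exists>q l. ict K N 1 (Field \<kappa>) q l" by blast
qed (use dp_rank_ge_of_ict[OF assms] in blast)

lemma dp_rank_ge_of_ict_inj:
  assumes "is_structure K N" "ict K N 1 X q l" "inj_on g (Field \<kappa>)" "g ` Field \<kappa> \<subseteq> X"
  shows "dp_rank_ge K N \<kappa>"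
  by (rule dp_rank_ge_of_ict[OF assms(1) ict_reindex[OF assms(2-4)]])

lemma dp_rank_ge_0:
  assumes "is_structure K N"
  shows "dp_rank_ge K N (card_of {..<0 :: nat})"
proof -
  obtain u where "u \<in> univ N" using assms by (auto simp: is_structure_def)
  then have "[u] \<in> tuples N 1" by (simp add: tuples_def)
  then have "ict K N 1 {..<0 :: nat} q l" for q l by (auto simp: ict_def)
  then show ?thesis unfolding dp_rank_ge_iff[OF assms] Field_card_of by blast
qed

lemma dp_rank_ge_antimono:
  assumes "is_structure K N" "dp_rank_ge K N (card_of {..<k})" "j \<le> k"
  shows "dp_rank_ge K N (card_of {..<j :: nat})"
proof -
  obtain q l where "ict K N 1 {..<k} q l"
    using assms(2) unfolding dp_rank_ge_iff[OF assms(1)] by (auto simp: Field_card_of)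
  then show ?thesis
    by (rule dp_rank_ge_of_ict_inj[OF assms(1), where g = id]) (use assms(3) in \<open>auto simp: Field_card_of\<close>)
qed

lemma dp_rank_greatest:
  assumes "is_structure K N" "finite_dp_rank K N"
  shows "dp_rank_ge K N (card_of {..<dp_rank K N})"
    "dp_rank_ge K N (card_of {..<k :: nat}) \<Longrightarrow> k \<le> dp_rank K N"
proof -
  obtain k0 where k0: "\<not> dp_rank_ge K N (card_of {..<k0 :: nat})"
    using assms(2) by (auto simp: finite_dp_rank_def)
  have bound: "k \<le> k0" if "dp_rank_ge K N (card_of {..<k :: nat})" for k
    using dp_rank_ge_antimono[OF assms(1) that, of k0] k0 by linarith
  show "dp_rank_ge K N (card_of {..<dp_rank K N})"
    unfolding dp_rank_def
    by (rule GreatestI_nat[of "\<lambda>k. dp_rank_ge K N (card_of {..<k})", OF dp_rank_ge_0[OF assms(1)]])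
      (rule bound)
  show "k \<le> dp_rank K N" if "dp_rank_ge K N (card_of {..<k :: nat})" for k
    unfolding dp_rank_def
    by (rule Greatest_le_nat[of "\<lambda>k. dp_rank_ge K N (card_of {..<k})", OF that]) (rule bound)
qed

lemma trace_definition_split:
  assumes "is_structure L M" "is_structure K N" "trace_definition L M K N n \<tau>"
    and "dp_rank_ge L M \<kappa>"
  obtains c q l where "\<forall>t\<in>Field \<kappa>. c t < n" "\<forall>j. ict K N 1 {t \<in> Field \<kappa>. c t = j} q l"
proof -
  obtain q l where "ict L M 1 (Field \<kappa>) q l" by (rule ict_of_dp_rank_ge[OF assms(1,4)])
  then obtain q' l' where "ict K N n (Field \<kappa>) q' l'" by (rule trace_definition_ict[OF assms(3)])
  then obtain c q'' l'' where "\<forall>t\<in>Field \<kappa>. c t < n" "\<forall>j. ict K N 1 {t \<in> Field \<kappa>. c t = j} q'' l''"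
    by (rule ict_split[OF assms(2)])
  then show ?thesis by (rule that)
qed

text \<open>Each of the \<open>n\<close> coordinates accounts for a pattern in one variable, which
  has at most \<open>dp_rank K N\<close> rows, and together these patterns use all \<open>k\<close>
  rows.\<close>

lemma dp_rank_ge_trace_bound:
  assumes "is_structure L M" "is_structure K N" "trace_definition L M K N n \<tau>"
    and "finite_dp_rank K N" "dp_rank_ge L M (card_of {..<k :: nat})"
  shows "k \<le> n * dp_rank K N"
proof -
  obtain c q l where c: "\<forall>t\<in>{..<k}. c t < n" "\<forall>j. ict K N 1 {t \<in> {..<k}. c t = j} q l"
    by (rule trace_definition_split[OF assms(1-3,5), unfolded Field_card_of])
  have "card {t \<in> {..<k}. c t = j} \<le> dp_rank K N" for j
  proof -
    let ?X = "{t \<in> {..<k}. c t = j}"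
    obtain g where "bij_betw g {..<card ?X} ?X"
      using ex_bij_betw_nat_finite[of ?X] unfolding atLeast0LessThan by auto
    then have g: "inj_on g {..<card ?X}" "g ` {..<card ?X} \<subseteq> ?X"
      unfolding bij_betw_def by blast+
    have "dp_rank_ge K N (card_of {..<card ?X})"
      by (rule dp_rank_ge_of_ict_inj[where g = g, OF assms(2) spec[OF c(2), of j]])
        (simp_all only: Field_card_of g)
    then show ?thesis by (rule dp_rank_greatest(2)[OF assms(2,4)])
  qed
  then have "(\<Sum>j<n. card {t \<in> {..<k}. c t = j}) \<le> n * dp_rank K N"
    using sum_mono[of "{..<n}" "\<lambda>j. card {t \<in> {..<k}. c t = j}" "\<lambda>_. dp_rank K N"] by simp
  moreover have "{..<k} = (\<Union>j<n. {t \<in> {..<k}. c t = j})" using c(1) by auto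
  then have "k \<le> (\<Sum>j<n. card {t \<in> {..<k}. c t = j})"
    using card_UN_le[of "{..<n}" "\<lambda>j. {t \<in> {..<k}. c t = j}"] by (simp only: finite_lessThan card_lessThan)
  ultimately show ?thesis by linarith
qed

text \<open>Finitely many sets smaller than an infinite \<open>A\<close> have a union smaller than
  \<open>A\<close>. This is why the factor \<open>n\<close> disappears at infinite depth.\<close>

lemma infinite_pigeonhole:
  assumes inf: "infinite A" and c: "\<forall>t\<in>A. c t < (n :: nat)"
  obtains j where "|A| \<le>o |{t \<in> A. c t = j}|"
proof (rule ccontr)
  assume "\<not> thesis"
  then have less: "|{t \<in> A. c t = j}| <o |A|" for j
    using that[of j] not_ordLeq_iff_ordLess[OF card_of_Well_order card_of_Well_order] by blast
  have "|\<Union>j<m. {t \<in> A. c t = j}| <o |A|" for m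
  proof (induction m)
    case 0
    have "|{} :: 'a set| <o |A|"
      by (rule finite_ordLess_infinite[OF card_of_Well_order card_of_Well_order])
        (use inf in \<open>simp_all add: Field_card_of\<close>)
    then show ?case by simp
  next
    case (Suc m)
    have "(\<Union>j<Suc m. {t \<in> A. c t = j}) = (\<Union>j<m. {t \<in> A. c t = j}) \<union> {t \<in> A. c t = m}"
      by (auto simp: less_Suc_eq)
    then show ?case using card_of_Un_ordLess_infinite[OF inf Suc less[of m]] by (simp only:)
  qed
  moreover have "(\<Union>j<n. {t \<in> A. c t = j}) = A" using c by auto
  ultimately have "|A| <o |A|" by (metis (no_types))
  then show False using ordLess_irreflexive by blast
qed

theorem proposition4p2:
  fixes L :: "('f, 'r) language" and M :: "('a, 'f, 'r) fo_structure"
    and K :: "('g, 's) language" and N :: "('b, 'g, 's) fo_structure"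
    and n :: nat and \<tau> :: "'a \<Rightarrow> 'b list"
  assumes "is_structure L M" and "is_structure K N"
    and "trace_definition L M K N n \<tau>"
  shows "(finite_dp_rank K N \<longrightarrow> finite_dp_rank L M \<and> dp_rank L M \<le> n * dp_rank K N) \<and>
         (\<not> finite_dp_rank K N \<longrightarrow> dp_rank_le TYPE('k) L M K N)"
proof (intro conjI impI)
  assume N: "finite_dp_rank K N"
  note bound = dp_rank_ge_trace_bound[OF assms N]
  have "\<not> dp_rank_ge L M (card_of {..<Suc (n * dp_rank K N)})" using bound by fastforce
  then show M: "finite_dp_rank L M" unfolding finite_dp_rank_def by blast
  show "dp_rank L M \<le> n * dp_rank K N" by (rule bound[OF dp_rank_greatest(1)[OF assms(1) M]])
next
  assume "\<not> finite_dp_rank K N"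
  then have N: "dp_rank_ge K N (card_of {..<k :: nat})" for k unfolding finite_dp_rank_def by blast
  show "dp_rank_le TYPE('k) L M K N"
    unfolding dp_rank_le_def
  proof (intro allI impI)
    fix \<kappa> :: "'k rel"
    assume \<kappa>: "dp_rank_ge L M \<kappa>"
    show "dp_rank_ge K N \<kappa>"
    proof (cases "finite (Field \<kappa>)")
      \<comment> \<open>Splitting would shrink a finite depth; instead the infinite rank of
        \<open>N\<close> supplies a pattern of that depth directly.\<close>
      case True
      obtain q l where "ict K N 1 {..<card (Field \<kappa>)} q l"
        using N[of "card (Field \<kappa>)"] unfolding dp_rank_ge_iff[OF assms(2)] Field_card_of by blast
      moreover obtain g where "bij_betw g (Field \<kappa>) {..<card (Field \<kappa>)}"
        using ex_bij_betw_finite_nat[OF True] by (metis atLeast0LessThan)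
      then have "inj_on g (Field \<kappa>)" "g ` Field \<kappa> \<subseteq> {..<card (Field \<kappa>)}"
        unfolding bij_betw_def by blast+
      ultimately show ?thesis by (rule dp_rank_ge_of_ict_inj[OF assms(2)])
    next
      case False
      obtain c q l where c: "\<forall>t\<in>Field \<kappa>. c t < n" "\<forall>j. ict K N 1 {t \<in> Field \<kappa>. c t = j} q l"
        by (rule trace_definition_split[OF assms \<kappa>])
      obtain j where "|Field \<kappa>| \<le>o |{t \<in> Field \<kappa>. c t = j}|" by (rule infinite_pigeonhole[OF False c(1)])
      then obtain g where "inj_on g (Field \<kappa>)" "g ` Field \<kappa> \<subseteq> {t \<in> Field \<kappa>. c t = j}"
        unfolding card_of_ordLeq[symmetric] by blast
      then show ?thesis by (rule dp_rank_ge_of_ict_inj[OF assms(2) spec[OF c(2)]])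
    qed
  qed
qed

end
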